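(* Assume $q_{ii}=q^{2d_i}$ for all $i\in I$. Let $\sigma: U_{q,q^{-1}}(\mathfrak g_A)\times U_{q,q^{-1}}(\mathfrak g_A)\to\mathbb K$ be the Hopf $2$-cocycle given by the bilinear form defined by $$\sigma(x,y)=\begin{cases} q_{\mu\nu}^{1/2}, & x=K_\mu \text{ or } K'_\mu,\quad y=K_\nu\text{ or }K'_\nu,\\ 0,&\text{otherwise.}\end{cases}$$ Then there is an isomorphism of Hopf algebras $$U_{\mathbf q}(\mathfrak g_A)\;\simeq\; U^{\sigma}_{q,q^{-1}}(\mathfrak g_A),$$ where $U^{\sigma}_{q,q^{-1}}(\mathfrak g_A)$ is the Hopf algebra obtained from $U_{q,q^{-1}}(\mathfrak g_A)$ by the Hopf $2$-cocycle deformation via $\sigma$.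
   Context: Let $\mathfrak g_A$ be a symmetrizable Kac-Moody algebra over $\mathbb Q$ with generalized Cartan matrix $A=(a_{ij})_{i,j\in I}$, and let $d_i$ ($i\in I$) be relatively prime positive integers with $d_ia_{ij}=d_ja_{ji}$. Let $\alpha_i$ ($i\in I$) be the simple roots and $Q=\bigoplus_{i\in I}\mathbb Z\alpha_i$. Let $q_{ij}$ ($i,j\in I$) be indeterminates over $\mathbb Q$ subject to $q_{ij}q_{ji}=q_{ii}^{a_{ij}}$, $\mathbf q=(q_{ij})_{i,j\in I}$, and let $\mathbb K\supset\mathbb Q(q_{ij}\mid i,j\in I)$ be a field containing $q_{ii}^{1/m}$ for all positive integers $m$ and having an involutive $\mathbb Q$-automorphism $\tau$ with $\tau(q_{ij})=q_{ji}$. The $q_{ii}$ are not roots of unity. For $\mu=\sum_i\mu_i\alpha_i$, $\nu=\sum_j\nu_j\alpha_j$ in $Q$ put $q_{\mu\nu}=\prod_{i,j\in I}q_{ij}^{\mu_i\nu_j}$. Notation: $(n)_v=\frac{v^n-1}{v-1}$, $(n)_v!=(n)_v\cdots(1)_v$, $(0)_v!=1$, $\binom nk_v=\frac{(n)_v!}{(k)_v!(n-k)_v!}$. $U_{\mathbf q}(\mathfrak g_A)$ is the associative unital $\mathbb K$-algebra generated by $e_i,f_i,\omega_i^{\pm1},\omega_i'^{\pm1}$ ($i\in I$) with relations: all $\omega_i^{\pm1},\omega_j'^{\pm1}$ commute with each other, $\omega_i^{\pm1}\omega_i^{\mp1}=\omega_i'^{\pm1}\omega_i'^{\mp1}=1$;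 $\omega_ie_j\omega_i^{-1}=q_{ij}e_j$, $\omega_i'e_j\omega_i'^{-1}=q_{ji}^{-1}e_j$; $\omega_if_j\omega_i^{-1}=q_{ij}^{-1}f_j$, $\omega_i'f_j\omega_i'^{-1}=q_{ji}f_j$; $e_if_j-f_je_i=\delta_{ij}\frac{q_{ii}}{q_{ii}-1}(\omega_i-\omega_i')$; and for $i\neq j$ $$\sum_{k=0}^{1-a_{ij}}(-1)^k\binom{1-a_{ij}}{k}_{q_{ii}}q_{ii}^{k(k-1)/2}q_{ij}^k e_i^{1-a_{ij}-k}e_je_i^k=0,\qquad \sum_{k=0}^{1-a_{ij}}(-1)^k\binom{1-a_{ij}}{k}_{q_{ii}}q_{ii}^{k(k-1)/2}q_{ij}^k f_i^kf_jf_i^{1-a_{ij}-k}=0.$$ It is a Hopf algebra with $\omega_i^{\pm1},\omega_i'^{\pm1}$ group-like, $\Delta(e_i)=e_i\otimes1+\omega_i\otimes e_i$, $\Delta(f_i)=1\otimes f_i+f_i\otimes\omega_i'$, $\varepsilon(e_i)=\varepsilon(f_i)=0$, $S(e_i)=-\omega_i^{-1}e_i$, $S(f_i)=-f_i\omega_i'^{-1}$. $U_{q,q^{-1}}(\mathfrak g_A)$ is the Hopf algebra defined in the same way with $q_{ij}$ replaced by $q^{d_ia_{ij}}$ everywhere (so $q_{ii}$ is replaced by $q^{2d_i}$) and with generators written $E_i,F_i,K_i^{\pm1},K_i'^{\pm1}$ in place of $e_i,f_i,\omega_i^{\pm1},\omega_i'^{\pm1}$. For $\mu=\sum_i\mu_i\alpha_i\in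 Q$ put $K_\mu=\prod_iK_i^{\mu_i}$, $K'_\mu=\prod_iK_i'^{\mu_i}$. A (left) Hopf $2$-cocycle of a Hopf algebra $H$ is a bilinear form $\sigma$ on $H$ with $\sigma(a,1)=\sigma(1,a)=\varepsilon(a)$ and $\sum\sigma(a_1,b_1)\sigma(a_2b_2,c)=\sum\sigma(b_1,c_1)\sigma(a,b_2c_2)$ for all $a,b,c\in H$. With $\sigma^{-1}$ the inverse of $\sigma$ under convolution, the deformation $H^\sigma$ equals $H$ as a coalgebra, with product $m^\sigma(a\otimes b)=\sum\sigma(a_1,b_1)a_2b_2\sigma^{-1}(a_3,b_3)$ and antipode $S^\sigma(a)=\sum\sigma^{-1}(a_1,S(a_2))S(a_3)\sigma(S(a_4),a_5)$.
   Formalization: On mixed products K_αK'_β, σ takes the value of total weight α+β (the printed 0 violates σ(x,1)=ε(x)); roots are chosen with q_ij^{1/2}q_ji^{1/2}=q^{d_i a_ij}; S^σ has σ and σ^{-1} exchanged (Doi), since the printed formula is not an antipode. *)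

theory Defs
  imports
    "HOL-Algebra.QuotRing"
    "HOL-Algebra.Module"
    "HOL-Algebra.Algebraic_Closure_Type"
    "HOL-Library.Poly_Mapping"
begin

section \<open>Free algebras and formal tensors\<close>

text \<open>
  With words as a monoid under concatenation, \<open>'a list \<Rightarrow>\<^sub>0 'k\<close> is the free unital associative
  \<open>'k\<close>-algebra on the alphabet \<open>'a\<close>.
\<close>

instantiation list :: (type) monoid_add
begin
definition zero_list :: "'a list" where "zero_list = []"
definition plus_list :: "'a list \<Rightarrow> 'a list \<Rightarrow> 'a list" where "plus_list xs ys = xs @ ys"
instance by standard (simp_all add: zero_list_def plus_list_def)
end

definition wmon :: "'a list \<Rightarrow> 'a list \<Rightarrow>\<^sub>0 'k::comm_ring_1" where
  "wmon w = Poly_Mapping.single w 1"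

definition scal :: "'k::comm_ring_1 \<Rightarrow> 'a list \<Rightarrow>\<^sub>0 'k" where
  "scal c = Poly_Mapping.single [] c"

interpretation free_space: vector_space
  "\<lambda>(c::'k::field) (t::'a list \<Rightarrow>\<^sub>0 'k). scal c * t"
  by standard
    (simp_all add: scal_def distrib_left distrib_right single_add mult.assoc [symmetric] mult_single
      zero_list_def [symmetric])

definition lin_ext :: "('x \<Rightarrow> 'y list \<Rightarrow>\<^sub>0 'k) \<Rightarrow> ('x \<Rightarrow>\<^sub>0 'k) \<Rightarrow> 'y list \<Rightarrow>\<^sub>0 'k::comm_ring_1" where
  "lin_ext f t = (\<Sum>x\<in>Poly_Mapping.keys t. scal (Poly_Mapping.lookup t x) * f x)"

definition lin_form :: "('x \<Rightarrow> 'k) \<Rightarrow> ('x \<Rightarrow>\<^sub>0 'k) \<Rightarrow> 'k::comm_ring_1" where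
  "lin_form f t = (\<Sum>x\<in>Poly_Mapping.keys t. Poly_Mapping.lookup t x * f x)"

section \<open>Hopf algebras\<close>

text \<open>
  An element of the tensor power \<open>H\<^sup>\<otimes>\<^sup>n\<close> is represented by a formal linear combination of lists
  \<open>[x\<^sub>1, \<dots>, x\<^sub>n]\<close> of elements of \<open>H\<close>, the list standing for \<open>x\<^sub>1 \<otimes> \<dots> \<otimes> x\<^sub>n\<close>; two formal combinations
  denote the same tensor iff they agree modulo the span of the multilinearity relations.  The field
  \<open>comult\<close> chooses a formal combination denoting \<open>\<Delta>(x)\<close>, so that Sweedler sums are sums over it.
\<close>

record (overloaded) ('k, 'h) hopf = "('k, 'h) module" +
  comult :: "'h \<Rightarrow> 'h list \<Rightarrow>\<^sub>0 'k"
  counit :: "'h \<Rightarrow> 'k"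
  antipode :: "'h \<Rightarrow> 'h"

inductive_set multilin_rels :: "('k::field, 'h, 'z) module_scheme \<Rightarrow> ('h list \<Rightarrow>\<^sub>0 'k) set"
  for H (structure) where
  add: "\<lbrakk>x \<in> carrier H; y \<in> carrier H; set us \<subseteq> carrier H; set vs \<subseteq> carrier H\<rbrakk> \<Longrightarrow>
      wmon (us @ [x \<oplus> y] @ vs) - wmon (us @ [x] @ vs) - wmon (us @ [y] @ vs) \<in> multilin_rels H"
| smult: "\<lbrakk>x \<in> carrier H; set us \<subseteq> carrier H; set vs \<subseteq> carrier H\<rbrakk> \<Longrightarrow>
      wmon (us @ [c \<odot> x] @ vs) - scal c * wmon (us @ [x] @ vs) \<in> multilin_rels H"

definition tensor_eq ::
  "('k::field, 'h, 'z) module_scheme \<Rightarrow> ('h list \<Rightarrow>\<^sub>0 'k) \<Rightarrow> ('h list \<Rightarrow>\<^sub>0 'k) \<Rightarrow> bool" where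
  "tensor_eq H s t \<longleftrightarrow> s - t \<in> free_space.span (multilin_rels H)"

definition lin_sum ::
  "('k::field, 'h, 'z) module_scheme \<Rightarrow> ('x \<Rightarrow> 'h) \<Rightarrow> ('x \<Rightarrow>\<^sub>0 'k) \<Rightarrow> 'h" where
  "lin_sum H f t = (\<Oplus>\<^bsub>H\<^esub> x \<in> Poly_Mapping.keys t. Poly_Mapping.lookup t x \<odot>\<^bsub>H\<^esub> f x)"

text \<open>
  \<open>comult_pow H n a\<close> is the iterated coproduct in \<open>H\<^sup>\<otimes>\<^sup>(\<^sup>n\<^sup>+\<^sup>1\<^sup>)\<close>: its lists are
  \<open>[a\<^sub>1, \<dots>, a\<^sub>n\<^sub>+\<^sub>1]\<close> in Sweedler notation, with 0-based access \<open>xs ! 0 = a\<^sub>1\<close> and so on.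
\<close>

primrec comult_pow ::
  "('k::field, 'h, 'z) hopf_scheme \<Rightarrow> nat \<Rightarrow> 'h \<Rightarrow> 'h list \<Rightarrow>\<^sub>0 'k" where
  "comult_pow H 0 a = wmon [a]"
| "comult_pow H (Suc n) a = lin_ext (\<lambda>xs. comult H (hd xs) * wmon (tl xs)) (comult_pow H n a)"

locale hopf_algebra = ring H + vs?: module "ring_of_type_algebra :: 'k::field ring" H
  for H :: "('k::field, 'h, 'z) hopf_scheme" (structure) +
  assumes smult_mult_left:
      "\<lbrakk>x \<in> carrier H; y \<in> carrier H\<rbrakk> \<Longrightarrow> (c \<odot> x) \<otimes> y = c \<odot> (x \<otimes> y)"
    and smult_mult_right:
      "\<lbrakk>x \<in> carrier H; y \<in> carrier H\<rbrakk> \<Longrightarrow> x \<otimes> (c \<odot> y) = c \<odot> (x \<otimes> y)"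
    and comult_closed:
      "\<lbrakk>x \<in> carrier H; xs \<in> Poly_Mapping.keys (comult H x)\<rbrakk> \<Longrightarrow> length xs = 2 \<and> set xs \<subseteq> carrier H"
    and comult_add:
      "\<lbrakk>x \<in> carrier H; y \<in> carrier H\<rbrakk> \<Longrightarrow>
        tensor_eq H (comult H (x \<oplus> y)) (comult H x + comult H y)"
    and comult_smult:
      "x \<in> carrier H \<Longrightarrow> tensor_eq H (comult H (c \<odot> x)) (scal c * comult H x)"
    and coassoc:
      "x \<in> carrier H \<Longrightarrow>
        tensor_eq H (lin_ext (\<lambda>xs. comult H (xs ! 0) * wmon [xs ! 1]) (comult H x))
                    (lin_ext (\<lambda>xs. wmon [xs ! 0] * comult H (xs ! 1)) (comult H x))"
    and counit_add:
      "\<lbrakk>x \<in> carrier H; y \<in> carrier H\<rbrakk> \<Longrightarrow> counit H (x \<oplus> y) = counit H x + counit H y"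
    and counit_smult: "x \<in> carrier H \<Longrightarrow> counit H (c \<odot> x) = c * counit H x"
    and counit_left:
      "x \<in> carrier H \<Longrightarrow> lin_sum H (\<lambda>xs. counit H (xs ! 0) \<odot> (xs ! 1)) (comult H x) = x"
    and counit_right:
      "x \<in> carrier H \<Longrightarrow> lin_sum H (\<lambda>xs. counit H (xs ! 1) \<odot> (xs ! 0)) (comult H x) = x"
    and comult_one: "tensor_eq H (comult H \<one>) (wmon [\<one>, \<one>])"
    and comult_mult:
      "\<lbrakk>x \<in> carrier H; y \<in> carrier H\<rbrakk> \<Longrightarrow>
        tensor_eq H (comult H (x \<otimes> y))
          (lin_ext (\<lambda>xs. lin_ext (\<lambda>ys. wmon [xs ! 0 \<otimes> ys ! 0, xs ! 1 \<otimes> ys ! 1]) (comult H y))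
            (comult H x))"
    and counit_one: "counit H \<one> = 1"
    and counit_mult:
      "\<lbrakk>x \<in> carrier H; y \<in> carrier H\<rbrakk> \<Longrightarrow> counit H (x \<otimes> y) = counit H x * counit H y"
    and antipode_closed: "x \<in> carrier H \<Longrightarrow> antipode H x \<in> carrier H"
    and antipode_add:
      "\<lbrakk>x \<in> carrier H; y \<in> carrier H\<rbrakk> \<Longrightarrow> antipode H (x \<oplus> y) = antipode H x \<oplus> antipode H y"
    and antipode_smult: "x \<in> carrier H \<Longrightarrow> antipode H (c \<odot> x) = c \<odot> antipode H x"
    and antipode_left:
      "x \<in> carrier H \<Longrightarrow>
        lin_sum H (\<lambda>xs. antipode H (xs ! 0) \<otimes> (xs ! 1)) (comult H x) = counit H x \<odot> \<one>"
    and antipode_right: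
      "x \<in> carrier H \<Longrightarrow>
        lin_sum H (\<lambda>xs. (xs ! 0) \<otimes> antipode H (xs ! 1)) (comult H x) = counit H x \<odot> \<one>"

definition hopf_iso ::
  "('k::field, 'g, 'y) hopf_scheme \<Rightarrow> ('k, 'h, 'z) hopf_scheme \<Rightarrow> ('g \<Rightarrow> 'h) set" where
  "hopf_iso G H = {h. h \<in> ring_iso G H \<and>
     (\<forall>c. \<forall>x\<in>carrier G. h (c \<odot>\<^bsub>G\<^esub> x) = c \<odot>\<^bsub>H\<^esub> h x) \<and>
     (\<forall>x\<in>carrier G. tensor_eq H (comult H (h x)) (lin_ext (\<lambda>xs. wmon (map h xs)) (comult G x))) \<and>
     (\<forall>x\<in>carrier G. counit H (h x) = counit G x) \<and>
     (\<forall>x\<in>carrier G. h (antipode G x) = antipode H (h x))}"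

definition hopf_isomorphic ::
  "('k::field, 'g, 'y) hopf_scheme \<Rightarrow> ('k, 'h, 'z) hopf_scheme \<Rightarrow> bool" where
  "hopf_isomorphic G H \<longleftrightarrow> hopf_algebra G \<and> hopf_algebra H \<and> hopf_iso G H \<noteq> {}"

section \<open>Two-cocycle deformation\<close>

definition bilinear_form ::
  "('k::field, 'h, 'z) hopf_scheme \<Rightarrow> ('h \<Rightarrow> 'h \<Rightarrow> 'k) \<Rightarrow> bool" where
  "bilinear_form H \<sigma> \<longleftrightarrow>
     (\<forall>x\<in>carrier H. \<forall>y\<in>carrier H. \<forall>z\<in>carrier H. \<forall>c.
        \<sigma> (x \<oplus>\<^bsub>H\<^esub> y) z = \<sigma> x z + \<sigma> y z \<and> \<sigma> (c \<odot>\<^bsub>H\<^esub> x) z = c * \<sigma> x z \<and>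
        \<sigma> z (x \<oplus>\<^bsub>H\<^esub> y) = \<sigma> z x + \<sigma> z y \<and> \<sigma> z (c \<odot>\<^bsub>H\<^esub> x) = c * \<sigma> z x)"

definition hopf_2_cocycle ::
  "('k::field, 'h, 'z) hopf_scheme \<Rightarrow> ('h \<Rightarrow> 'h \<Rightarrow> 'k) \<Rightarrow> bool" where
  "hopf_2_cocycle H \<sigma> \<longleftrightarrow>
     bilinear_form H \<sigma> \<and>
     (\<forall>a\<in>carrier H. \<sigma> a \<one>\<^bsub>H\<^esub> = counit H a \<and> \<sigma> \<one>\<^bsub>H\<^esub> a = counit H a) \<and>
     (\<forall>a\<in>carrier H. \<forall>b\<in>carrier H. \<forall>c\<in>carrier H.
        lin_form (\<lambda>as. lin_form (\<lambda>bs.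
          \<sigma> (as ! 0) (bs ! 0) * \<sigma> (as ! 1 \<otimes>\<^bsub>H\<^esub> bs ! 1) c) (comult H b)) (comult H a)
      = lin_form (\<lambda>bs. lin_form (\<lambda>cs.
          \<sigma> (bs ! 0) (cs ! 0) * \<sigma> a (bs ! 1 \<otimes>\<^bsub>H\<^esub> cs ! 1)) (comult H c)) (comult H b))"

definition convolution ::
  "('k::field, 'h, 'z) hopf_scheme \<Rightarrow> ('h \<Rightarrow> 'h \<Rightarrow> 'k) \<Rightarrow> ('h \<Rightarrow> 'h \<Rightarrow> 'k) \<Rightarrow> 'h \<Rightarrow> 'h \<Rightarrow> 'k" where
  "convolution H \<sigma> \<tau> a b =
     lin_form (\<lambda>as. lin_form (\<lambda>bs. \<sigma> (as ! 0) (bs ! 0) * \<tau> (as ! 1) (bs ! 1)) (comult H b)) (comult H a)"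

definition conv_inverse ::
  "('k::field, 'h, 'z) hopf_scheme \<Rightarrow> ('h \<Rightarrow> 'h \<Rightarrow> 'k) \<Rightarrow> ('h \<Rightarrow> 'h \<Rightarrow> 'k) \<Rightarrow> bool" where
  "conv_inverse H \<sigma> \<tau> \<longleftrightarrow> bilinear_form H \<tau> \<and>
     (\<forall>a\<in>carrier H. \<forall>b\<in>carrier H.
        convolution H \<sigma> \<tau> a b = counit H a * counit H b \<and>
        convolution H \<tau> \<sigma> a b = counit H a * counit H b)"

text \<open>
  A convolution inverse is unique on the carrier, so the choice below is immaterial there.  The
  antipode is Doi's: with the product \<open>\<sigma>(a\<^sub>1,b\<^sub>1) a\<^sub>2b\<^sub>2 \<sigma>\<^sup>-\<^sup>1(a\<^sub>3,b\<^sub>3)\<close> it has to read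
  \<open>\<sigma>(a\<^sub>1,S(a\<^sub>2)) S(a\<^sub>3) \<sigma>\<^sup>-\<^sup>1(S(a\<^sub>4),a\<^sub>5)\<close>; exchanging \<open>\<sigma>\<close> and \<open>\<sigma>\<^sup>-\<^sup>1\<close> here, as is sometimes printed,
  violates the antipode axiom for this product.
\<close>

definition conv_inv ::
  "('k::field, 'h, 'z) hopf_scheme \<Rightarrow> ('h \<Rightarrow> 'h \<Rightarrow> 'k) \<Rightarrow> 'h \<Rightarrow> 'h \<Rightarrow> 'k" where
  "conv_inv H \<sigma> = (SOME \<tau>. conv_inverse H \<sigma> \<tau>)"

definition deformed_mult ::
  "('k::field, 'h, 'z) hopf_scheme \<Rightarrow> ('h \<Rightarrow> 'h \<Rightarrow> 'k) \<Rightarrow> 'h \<Rightarrow> 'h \<Rightarrow> 'h" where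
  "deformed_mult H \<sigma> a b =
     lin_sum H (\<lambda>as. lin_sum H (\<lambda>bs.
         (\<sigma> (as ! 0) (bs ! 0) * conv_inv H \<sigma> (as ! 2) (bs ! 2)) \<odot>\<^bsub>H\<^esub> (as ! 1 \<otimes>\<^bsub>H\<^esub> bs ! 1))
       (comult_pow H 2 b)) (comult_pow H 2 a)"

definition deformed_antipode ::
  "('k::field, 'h, 'z) hopf_scheme \<Rightarrow> ('h \<Rightarrow> 'h \<Rightarrow> 'k) \<Rightarrow> 'h \<Rightarrow> 'h" where
  "deformed_antipode H \<sigma> a =
     lin_sum H (\<lambda>as.
         (\<sigma> (as ! 0) (antipode H (as ! 1)) * conv_inv H \<sigma> (antipode H (as ! 3)) (as ! 4))
           \<odot>\<^bsub>H\<^esub> antipode H (as ! 2))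
       (comult_pow H 4 a)"

definition deformation ::
  "('k::field, 'h, 'z) hopf_scheme \<Rightarrow> ('h \<Rightarrow> 'h \<Rightarrow> 'k) \<Rightarrow> ('k, 'h, 'z) hopf_scheme" where
  "deformation H \<sigma> = H\<lparr>monoid.mult := deformed_mult H \<sigma>, antipode := deformed_antipode H \<sigma>\<rparr>"

section \<open>Cartan data\<close>

definition gen_cartan_matrix :: "('i \<Rightarrow> 'i \<Rightarrow> int) \<Rightarrow> bool" where
  "gen_cartan_matrix A \<longleftrightarrow>
     (\<forall>i. A i i = 2) \<and> (\<forall>i j. i \<noteq> j \<longrightarrow> A i j \<le> 0) \<and> (\<forall>i j. A i j = 0 \<longleftrightarrow> A j i = 0)"

definition symmetrizer :: "('i \<Rightarrow> 'i \<Rightarrow> int) \<Rightarrow> ('i \<Rightarrow> int) \<Rightarrow> bool" where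
  "symmetrizer A d \<longleftrightarrow>
     (\<forall>i. d i > 0) \<and> Gcd (range d) = 1 \<and> (\<forall>i j. d i * A i j = d j * A j i)"

definition bichar :: "('i::finite \<Rightarrow> 'i \<Rightarrow> 'k::field) \<Rightarrow> ('i \<Rightarrow> int) \<Rightarrow> ('i \<Rightarrow> int) \<Rightarrow> 'k" where
  "bichar q \<mu> \<nu> = (\<Prod>i\<in>UNIV. \<Prod>j\<in>UNIV. q i j powi (\<mu> i * \<nu> j))"

definition qint :: "'k::field \<Rightarrow> nat \<Rightarrow> 'k" where
  "qint v n = (v ^ n - 1) / (v - 1)"

definition qfact :: "'k::field \<Rightarrow> nat \<Rightarrow> 'k" where
  "qfact v n = (\<Prod>k=1..n. qint v k)"

definition qbinomial :: "'k::field \<Rightarrow> nat \<Rightarrow> nat \<Rightarrow> 'k" where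
  "qbinomial v n k = qfact v n / (qfact v k * qfact v (n - k))"

section \<open>Multiparameter quantum groups\<close>

datatype 'i gen = E 'i | F 'i | K 'i | K_inv 'i | K' 'i | K'_inv 'i

fun is_torus :: "'i gen \<Rightarrow> bool" where
  "is_torus (E i) = False"
| "is_torus (F i) = False"
| "is_torus _ = True"

definition gn :: "'i gen \<Rightarrow> 'i gen list \<Rightarrow>\<^sub>0 'k::comm_ring_1" where
  "gn x = wmon [x]"

inductive_set uq_rels ::
  "('i \<Rightarrow> 'i \<Rightarrow> int) \<Rightarrow> ('i \<Rightarrow> 'i \<Rightarrow> 'k::field) \<Rightarrow> ('i gen list \<Rightarrow>\<^sub>0 'k) set"
  for A q where
  torus_comm: "is_torus x \<Longrightarrow> is_torus y \<Longrightarrow> gn x * gn y - gn y * gn x \<in> uq_rels A q"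
| K_right_inv: "gn (K i) * gn (K_inv i) - 1 \<in> uq_rels A q"
| K_left_inv: "gn (K_inv i) * gn (K i) - 1 \<in> uq_rels A q"
| Kp_right_inv: "gn (K' i) * gn (K'_inv i) - 1 \<in> uq_rels A q"
| Kp_left_inv: "gn (K'_inv i) * gn (K' i) - 1 \<in> uq_rels A q"
| K_E: "gn (K i) * gn (E j) * gn (K_inv i) - scal (q i j) * gn (E j) \<in> uq_rels A q"
| Kp_E: "gn (K' i) * gn (E j) * gn (K'_inv i) - scal (inverse (q j i)) * gn (E j) \<in> uq_rels A q"
| K_F: "gn (K i) * gn (F j) * gn (K_inv i) - scal (inverse (q i j)) * gn (F j) \<in> uq_rels A q"
| Kp_F: "gn (K' i) * gn (F j) * gn (K'_inv i) - scal (q j i) * gn (F j) \<in> uq_rels A q"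
| E_F: "gn (E i) * gn (F j) - gn (F j) * gn (E i)
      - (if i = j then scal (q i i / (q i i - 1)) * (gn (K i) - gn (K' i)) else 0) \<in> uq_rels A q"
| serre_E: "i \<noteq> j \<Longrightarrow> n = nat (1 - A i j) \<Longrightarrow>
    (\<Sum>k\<le>n. scal ((-1) ^ k * qbinomial (q i i) n k * q i i ^ (k * (k - 1) div 2) * q i j ^ k)
      * (gn (E i) ^ (n - k) * gn (E j) * gn (E i) ^ k)) \<in> uq_rels A q"
| serre_F: "i \<noteq> j \<Longrightarrow> n = nat (1 - A i j) \<Longrightarrow>
    (\<Sum>k\<le>n. scal ((-1) ^ k * qbinomial (q i i) n k * q i i ^ (k * (k - 1) div 2) * q i j ^ k)
      * (gn (F i) ^ k * gn (F j) * gn (F i) ^ (n - k))) \<in> uq_rels A q"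

definition uq_ideal ::
  "('i \<Rightarrow> 'i \<Rightarrow> int) \<Rightarrow> ('i \<Rightarrow> 'i \<Rightarrow> 'k::field) \<Rightarrow> ('i gen list \<Rightarrow>\<^sub>0 'k) set" where
  "uq_ideal A q = Idl\<^bsub>ring_of_type_algebra\<^esub> (uq_rels A q)"

definition uq_class ::
  "('i \<Rightarrow> 'i \<Rightarrow> int) \<Rightarrow> ('i \<Rightarrow> 'i \<Rightarrow> 'k::field) \<Rightarrow> ('i gen list \<Rightarrow>\<^sub>0 'k) \<Rightarrow> ('i gen list \<Rightarrow>\<^sub>0 'k) set" where
  "uq_class A q p = uq_ideal A q +>\<^bsub>ring_of_type_algebra\<^esub> p"

definition uq_ring ::
  "('i \<Rightarrow> 'i \<Rightarrow> int) \<Rightarrow> ('i \<Rightarrow> 'i \<Rightarrow> 'k::field) \<Rightarrow> ('i gen list \<Rightarrow>\<^sub>0 'k) set ring" where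
  "uq_ring A q = ring_of_type_algebra Quot uq_ideal A q"

text \<open>
  The structure maps are given on words, where \<open>\<Delta>\<close> and \<open>\<epsilon>\<close> are multiplicative and \<open>S\<close> is
  antimultiplicative.  The coproduct of a word is a sum of pure tensors of words with coefficient 1,
  listed as pairs.
\<close>

fun gen_comult :: "'i gen \<Rightarrow> ('i gen list \<times> 'i gen list) list" where
  "gen_comult (E i) = [([E i], []), ([K i], [E i])]"
| "gen_comult (F i) = [([], [F i]), ([F i], [K' i])]"
| "gen_comult x = [([x], [x])]"

fun word_comult :: "'i gen list \<Rightarrow> ('i gen list \<times> 'i gen list) list" where
  "word_comult [] = [([], [])]"
| "word_comult (x # w) = [(u @ u', v @ v'). (u, v) \<leftarrow> gen_comult x, (u', v') \<leftarrow> word_comult w]"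

definition word_counit :: "'i gen list \<Rightarrow> 'k::comm_ring_1" where
  "word_counit w = (if \<forall>x\<in>set w. is_torus x then 1 else 0)"

fun gen_antipode :: "'i gen \<Rightarrow> 'i gen list \<Rightarrow>\<^sub>0 'k::comm_ring_1" where
  "gen_antipode (E i) = - (gn (K_inv i) * gn (E i))"
| "gen_antipode (F i) = - (gn (F i) * gn (K'_inv i))"
| "gen_antipode (K i) = gn (K_inv i)"
| "gen_antipode (K_inv i) = gn (K i)"
| "gen_antipode (K' i) = gn (K'_inv i)"
| "gen_antipode (K'_inv i) = gn (K' i)"

fun word_antipode :: "'i gen list \<Rightarrow> 'i gen list \<Rightarrow>\<^sub>0 'k::comm_ring_1" where
  "word_antipode [] = 1"
| "word_antipode (x # w) = word_antipode w * gen_antipode x"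

text \<open>
  The structure maps of the quotient are evaluated on an arbitrary representative of a coset; they
  descend to the quotient because the relations generate a Hopf ideal.
\<close>

definition coset_rep :: "'a set \<Rightarrow> 'a" where
  "coset_rep C = (SOME p. p \<in> C)"

definition Uq ::
  "('i \<Rightarrow> 'i \<Rightarrow> int) \<Rightarrow> ('i \<Rightarrow> 'i \<Rightarrow> 'k::field) \<Rightarrow> ('k, ('i gen list \<Rightarrow>\<^sub>0 'k) set) hopf" where
  "Uq A q = \<lparr>
     carrier = carrier (uq_ring A q),
     monoid.mult = (\<otimes>\<^bsub>uq_ring A q\<^esub>),
     one = \<one>\<^bsub>uq_ring A q\<^esub>,
     zero = \<zero>\<^bsub>uq_ring A q\<^esub>,
     add = (\<oplus>\<^bsub>uq_ring A q\<^esub>),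
     module.smult = (\<lambda>c C. uq_class A q (scal c) \<otimes>\<^bsub>uq_ring A q\<^esub> C),
     comult = (\<lambda>C. lin_ext (\<lambda>w. \<Sum>(u, v)\<leftarrow>word_comult w.
                 wmon [uq_class A q (wmon u), uq_class A q (wmon v)]) (coset_rep C)),
     counit = (\<lambda>C. lin_form word_counit (coset_rep C)),
     antipode = (\<lambda>C. uq_class A q (lin_ext word_antipode (coset_rep C)))\<rparr>"

definition Uqq :: "('i \<Rightarrow> 'i \<Rightarrow> int) \<Rightarrow> ('i \<Rightarrow> int) \<Rightarrow> 'k::field \<Rightarrow> ('k, ('i gen list \<Rightarrow>\<^sub>0 'k) set) hopf" where
  "Uqq A d q0 = Uq A (\<lambda>i j. q0 powi (d i * A i j))"

definition uqq_word ::
  "('i \<Rightarrow> 'i \<Rightarrow> int) \<Rightarrow> ('i \<Rightarrow> int) \<Rightarrow> 'k::field \<Rightarrow> 'i gen list \<Rightarrow> ('i gen list \<Rightarrow>\<^sub>0 'k) set" where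
  "uqq_word A d q0 w = uq_class A (\<lambda>i j. q0 powi (d i * A i j)) (wmon w)"

section \<open>The cocycle\<close>

text \<open>
  A torus word of weight \<open>\<mu>\<close> represents \<open>K\<^sub>\<alpha> K'\<^sub>\<beta>\<close> with \<open>\<alpha> + \<beta> = \<mu>\<close>; \<open>K\<^sub>\<mu>\<close> and \<open>K'\<^sub>\<mu>\<close> are the cases
  \<open>\<beta> = 0\<close> and \<open>\<alpha> = 0\<close>.  Mixed products have to be included: otherwise the form would vanish on
  \<open>(K\<^sub>\<alpha> K'\<^sub>\<beta>, 1)\<close>, where a cocycle takes the value \<open>\<epsilon>(K\<^sub>\<alpha> K'\<^sub>\<beta>) = 1\<close>.
\<close>

fun gen_weight :: "'i gen \<Rightarrow> 'i \<Rightarrow> int" where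
  "gen_weight (E i) = (\<lambda>_. 0)"
| "gen_weight (F i) = (\<lambda>_. 0)"
| "gen_weight (K i) = (\<lambda>j. if j = i then 1 else 0)"
| "gen_weight (K_inv i) = (\<lambda>j. if j = i then -1 else 0)"
| "gen_weight (K' i) = (\<lambda>j. if j = i then 1 else 0)"
| "gen_weight (K'_inv i) = (\<lambda>j. if j = i then -1 else 0)"

definition torus_weight :: "'i gen list \<Rightarrow> 'i \<Rightarrow> int" where
  "torus_weight w j = (\<Sum>x\<leftarrow>w. gen_weight x j)"

text \<open>
  \<open>r i j\<close> is the chosen square root of \<open>q i j\<close>, so that \<open>bichar r \<mu> \<nu>\<close> is \<open>q\<^sub>\<mu>\<^sub>\<nu>\<^sup>1\<^sup>/\<^sup>2\<close>.  From
  \<open>q\<^sub>i\<^sub>j q\<^sub>j\<^sub>i = q\<^sub>i\<^sub>i^a\<^sub>i\<^sub>j = q^(2d\<^sub>ia\<^sub>i\<^sub>j)\<close> one gets \<open>r i j * r j i = \<plusminus> q^(d\<^sub>ia\<^sub>i\<^sub>j)\<close>; the roots are to be chosen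
  with the sign \<open>+\<close>, since \<open>\<omega>\<^sub>i e\<^sub>j \<omega>\<^sub>i\<^sup>-\<^sup>1\<close> in the deformed algebra has coefficient
  \<open>r i j / r j i * q^(d\<^sub>ia\<^sub>i\<^sub>j)\<close>.
\<close>

definition torus_form ::
  "('i::finite \<Rightarrow> 'i \<Rightarrow> int) \<Rightarrow> ('i \<Rightarrow> int) \<Rightarrow> 'k::field \<Rightarrow> ('i \<Rightarrow> 'i \<Rightarrow> 'k) \<Rightarrow>
    (('i gen list \<Rightarrow>\<^sub>0 'k) set \<Rightarrow> ('i gen list \<Rightarrow>\<^sub>0 'k) set \<Rightarrow> 'k) \<Rightarrow> bool" where
  "torus_form A d q0 r \<sigma> \<longleftrightarrow>
     bilinear_form (Uqq A d q0) \<sigma> \<and>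
     (\<forall>u v. \<sigma> (uqq_word A d q0 u) (uqq_word A d q0 v) =
        (if (\<forall>x\<in>set u. is_torus x) \<and> (\<forall>x\<in>set v. is_torus x)
         then bichar r (torus_weight u) (torus_weight v) else 0))"

end

(*
The cocycle sees only the torus part of a coproduct.  The terms of Delta(w) of a word w with a torus
word on the left, resp. on the right, are just left_torus(w) (x) w, resp. w (x) right_torus(w), so
w has a left and a right weight in Q, and the deformed product of two words u, v is their
concatenation times the scalar twist(u, v) = q^{1/2}(left u, left v) / q^{1/2}(right u, right v),
which is a bicharacter.  On the free algebra this twist is undone by rescaling each word by a
product of twists of its letters.  All defining relations are homogeneous for both weights, so the
rescaling maps the ideal of the relations for (q_ij) onto that for q^(d_i a_ij).

That the quotients are Hopf algebras comes down to the quantum Serre elements being skew-primitive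
modulo the other relations.  By the q-binomial theorem such an element is an iterated q-commutator,
and one adds the two summands of Delta(e_i) one q-commutator at a time.
*)
theory Submission
  imports Defs "HOL-Library.Product_Plus"
begin

section \<open>Monoid algebras\<close>

text \<open>A coproduct in the quotient is a formal combination obtained from a chosen
  representative, so identities between coproducts hold only up to multilinearity. This shapes the
  proof. Coproducts are computed on words, where identities are exact, in the monoid algebra of
  pairs of words. A linear map carries the results to formal tensors and sends I (x) F + F (x) I to
  zero, F being the free algebra and I the ideal of relations. Expressions built from Sweedler sums,
  such as the deformed product, have to be shown multilinear before the chosen representative may be
  replaced by another one.

  The ring axioms of the deformation come from the free algebra rather than from the cocycle
  identity. A bicharacter on the free monoid is the coboundary of its product over pairs of letters,
  so rescaled representatives multiply as in the free algebra. The parameters match because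
  rescaling multiplies \<open>q_ij\<close> by \<open>r_ji / r_ij\<close>; with
  \<open>q_ij = r_ij^2\<close> this gives \<open>r_ij r_ji = q^(d_i a_ij)\<close>.\<close>

definition smul :: "'k \<Rightarrow> ('m \<Rightarrow>\<^sub>0 'k) \<Rightarrow> 'm::monoid_add \<Rightarrow>\<^sub>0 'k::comm_ring_1" where
  "smul c t = Poly_Mapping.single 0 c * t"

lemma poly_mapping_linear_induct [case_names single add]:
  fixes t :: "'m \<Rightarrow>\<^sub>0 'k::comm_ring_1"
  assumes single: "\<And>x c. P (Poly_Mapping.single x c)"
    and add: "\<And>s t. P s \<Longrightarrow> P t \<Longrightarrow> P (s + t)"
  shows "P t"
proof -
  have sum: "P (\<Sum>x\<in>B. Poly_Mapping.single x (g x))" if "finite B" for B and g :: "'m \<Rightarrow> 'k"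
    using that
  proof (induction B)
    case empty
    \<comment> \<open>The empty sum is itself a single, with coefficient 0, so the rule gets by
      without a case for zero.\<close>
    then show ?case using single[of undefined 0] by simp
  next
    case (insert x B)
    then show ?case using single add by simp
  qed
  have "t = (\<Sum>x\<in>Poly_Mapping.keys t. Poly_Mapping.single x (Poly_Mapping.lookup t x))"
  proof (rule poly_mapping_eqI)
    fix k
    show "Poly_Mapping.lookup t k = Poly_Mapping.lookup
        (\<Sum>x\<in>Poly_Mapping.keys t. Poly_Mapping.single x (Poly_Mapping.lookup t x)) k"
      by (simp add: lookup_sum lookup_single when_def in_keys_iff)
  qed
  with sum show ?thesis by (metis finite_keys)
qed

lemma smul_add_right: "smul c (s + t) = smul c s + smul c t"
  and smul_diff_right: "smul c (s - t) = smul c s - smul c t"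
  and smul_minus_right: "smul c (- s) = - smul c s"
  and smul_add_left: "smul (c + c') s = smul c s + smul c' s"
  and smul_minus_left: "smul (- c) s = - smul c s"
  and smul_smul: "smul c (smul c' s) = smul (c * c') s"
  and smul_one: "smul 1 s = s"
  and smul_zero_left: "smul 0 s = 0"
  and smul_zero_right: "smul c 0 = 0"
  and smul_mult: "smul c s * t = smul c (s * t)"
  and smul_single: "smul c (Poly_Mapping.single x c') = Poly_Mapping.single x (c * c')"
  by (simp_all add: smul_def distrib_left distrib_right right_diff_distrib single_add single_uminus
      mult_single mult.assoc[symmetric])

lemma smul_sum: "smul c (\<Sum>x\<in>B. f x) = (\<Sum>x\<in>B. smul c (f x))"
  by (simp add: smul_def sum_distrib_left)

text \<open>Elements supported at the unit of the monoid are central, although words do not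
  commute.\<close>

lemma mult_smul: "s * smul c t = smul c (s * t)"
proof -
  have "s * Poly_Mapping.single 0 c = Poly_Mapping.single 0 c * s"
    by (induction s rule: poly_mapping_linear_induct)
      (simp_all add: mult_single distrib_left distrib_right mult.commute)
  then show ?thesis
    by (simp add: smul_def mult.assoc[symmetric])
qed

lemmas smul_simps = smul_add_right smul_diff_right smul_minus_right smul_minus_left smul_smul smul_one
  smul_zero_left smul_zero_right smul_mult mult_smul

lemma scal_mult: "scal c * t = smul c t"
  by (simp add: scal_def smul_def zero_list_def)

lemma wmon_append: "wmon (u @ v) = wmon u * wmon v"
  by (simp add: wmon_def mult_single plus_list_def)

lemma wmon_Nil: "wmon [] = 1"
  by (simp add: wmon_def flip: zero_list_def)

lemma lookup_smul: "Poly_Mapping.lookup (smul c t) x = c * Poly_Mapping.lookup t x"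
  by (induction t rule: poly_mapping_linear_induct)
    (simp_all add: smul_single smul_add_right lookup_add lookup_single when_def distrib_left)

text \<open>Unlike for \<open>lin_ext\<close>, the target may be the algebra over any monoid: pairs
  of words occur besides words.\<close>

definition lext :: "('x \<Rightarrow> 'y \<Rightarrow>\<^sub>0 'k) \<Rightarrow> ('x \<Rightarrow>\<^sub>0 'k) \<Rightarrow> 'y::monoid_add \<Rightarrow>\<^sub>0 'k::comm_ring_1" where
  "lext f t = (\<Sum>x\<in>Poly_Mapping.keys t. smul (Poly_Mapping.lookup t x) (f x))"

lemma lin_ext_lext: "lin_ext = lext"
  by (intro ext) (simp add: lin_ext_def lext_def scal_mult)

text \<open>Keys can cancel in a sum, so additivity is shown over a common finite set containing all
  supports.\<close>

lemma lext_superset: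
  assumes "finite B" "Poly_Mapping.keys t \<subseteq> B"
  shows "lext f t = (\<Sum>x\<in>B. smul (Poly_Mapping.lookup t x) (f x))"
  unfolding lext_def using assms
  by (intro sum.mono_neutral_left) (auto simp: in_keys_iff smul_zero_left)

lemma lext_zero [simp]: "lext f 0 = 0"
  by (simp add: lext_def)

lemma lext_add: "lext f (s + t) = lext f s + lext f t"
proof -
  let ?B = "Poly_Mapping.keys s \<union> Poly_Mapping.keys t"
  have "Poly_Mapping.keys (s + t) \<subseteq> ?B" by (rule keys_add)
  then show ?thesis
    by (simp add: lext_superset[of ?B] lookup_add smul_add_left sum.distrib)
qed

lemma lext_single: "lext f (Poly_Mapping.single x c) = smul c (f x)"
  by (simp add: lext_superset[of "{x}"])

lemma lext_wmon [simp]: "lext f (wmon x) = f x"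
  by (simp add: wmon_def lext_single smul_one)

lemma lext_smul: "lext f (smul c t) = smul c (lext f t)"
  by (induction t rule: poly_mapping_linear_induct)
    (simp_all add: smul_single lext_single lext_add smul_simps)

lemma lext_minus: "lext f (- t) = - lext f t"
  using lext_add[of f "- t" t] by (simp add: eq_neg_iff_add_eq_0)

lemma lext_diff: "lext f (s - t) = lext f s - lext f t"
  using lext_add[of f s "- t"] by (simp add: lext_minus)

lemma lext_sum: "lext f (\<Sum>x\<in>B. g x) = (\<Sum>x\<in>B. lext f (g x))"
  by (induction B rule: infinite_finite_induct) (simp_all add: lext_add)

lemma lext_lext: "lext f (lext g t) = lext (\<lambda>x. lext f (g x)) t"
  by (simp add: lext_def[of _ t] lext_sum lext_smul)

lemma lext_cong: "(\<And>x. x \<in> Poly_Mapping.keys t \<Longrightarrow> f x = g x) \<Longrightarrow> lext f t = lext g t"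
  by (simp add: lext_def)

lemma lext_fun_add: "lext (\<lambda>x. f x + g x) t = lext f t + lext g t"
  by (simp add: lext_def smul_simps sum.distrib)

lemma lext_fun_diff: "lext (\<lambda>x. f x - g x) t = lext f t - lext g t"
  by (simp add: lext_def smul_simps sum_subtractf)

lemma lext_fun_smul: "lext (\<lambda>x. smul c (f x)) t = smul c (lext f t)"
  by (simp add: lext_def smul_sum smul_simps mult.commute)

lemma lext_fun_mult_right: "lext (\<lambda>x. f x * r) t = lext f t * r"
  by (simp add: lext_def smul_simps sum_distrib_right)

lemma lext_fun_mult_left: "lext (\<lambda>x. r * f x) t = r * lext f t"
  by (simp add: lext_def smul_simps sum_distrib_left)

lemma lext_id: "lext (\<lambda>x. Poly_Mapping.single x 1) t = t"
  by (induction t rule: poly_mapping_linear_induct)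
    (simp_all add: lext_add lext_single smul_single)

lemma lext_wmon_id: "lext wmon t = t"
  using lext_id by (simp add: wmon_def[abs_def])

lemma lext_hom:
  assumes "\<And>x y. f (x + y) = f x * f y"
  shows "lext f (s * t) = lext f s * lext f t"
proof (induction s rule: poly_mapping_linear_induct)
  case (single x c)
  then show ?case
    by (induction t rule: poly_mapping_linear_induct)
      (simp_all add: mult_single lext_single lext_add smul_simps distrib_left assms mult.commute)
qed (simp add: distrib_right lext_add)

lemma lext_antihom:
  assumes "\<And>x y. f (x + y) = f y * f x"
  shows "lext f (s * t) = lext f t * lext f s"
proof (induction s rule: poly_mapping_linear_induct)
  case (single x c)
  then show ?case
  proof (induction t rule: poly_mapping_linear_induct)
    case (single y c')
    then show ?case
      by (simp add: mult_single lext_single smul_simps assms)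
  qed (simp add: lext_add distrib_left distrib_right)
qed (simp add: distrib_right distrib_left lext_add)

lemma keys_lext: "Poly_Mapping.keys (lext f t) \<subseteq> (\<Union>x\<in>Poly_Mapping.keys t. Poly_Mapping.keys (f x))"
proof
  fix y assume "y \<in> Poly_Mapping.keys (lext f t)"
  then have "(\<Sum>x\<in>Poly_Mapping.keys t. Poly_Mapping.lookup t x * Poly_Mapping.lookup (f x) y) \<noteq> 0"
    by (simp add: in_keys_iff lext_def lookup_sum lookup_smul)
  then obtain x where "x \<in> Poly_Mapping.keys t" "Poly_Mapping.lookup (f x) y \<noteq> 0"
    by (metis (no_types, lifting) sum.neutral mult_zero_right)
  then show "y \<in> (\<Union>x\<in>Poly_Mapping.keys t. Poly_Mapping.keys (f x))"
    by (auto simp: in_keys_iff)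
qed

section \<open>Linear functionals on a monoid algebra\<close>

lemma lin_form_superset:
  assumes "finite B" "Poly_Mapping.keys t \<subseteq> B"
  shows "lin_form f t = (\<Sum>x\<in>B. Poly_Mapping.lookup t x * f x)"
  unfolding lin_form_def using assms
  by (intro sum.mono_neutral_left) (auto simp: in_keys_iff)

lemma lin_form_zero [simp]: "lin_form f 0 = 0"
  by (simp add: lin_form_def)

lemma lin_form_add: "lin_form f (s + t) = lin_form f s + lin_form f t"
proof -
  let ?B = "Poly_Mapping.keys s \<union> Poly_Mapping.keys t"
  have "Poly_Mapping.keys (s + t) \<subseteq> ?B" by (rule keys_add)
  then show ?thesis
    by (simp add: lin_form_superset[of ?B] lookup_add distrib_right sum.distrib)
qed

lemma lin_form_single: "lin_form f (Poly_Mapping.single x c) = c * f x"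
  by (simp add: lin_form_superset[of "{x}"])

lemma lin_form_wmon [simp]: "lin_form f (wmon x) = f x"
  by (simp add: wmon_def lin_form_single)

lemma lin_form_smul: "lin_form f (smul c t) = c * lin_form f t"
  by (induction t rule: poly_mapping_linear_induct)
    (simp_all add: smul_single lin_form_single lin_form_add smul_simps distrib_left)

lemma lin_form_minus: "lin_form f (- t) = - lin_form f t"
  using lin_form_add[of f "- t" t] by (simp add: eq_neg_iff_add_eq_0)

lemma lin_form_diff: "lin_form f (s - t) = lin_form f s - lin_form f t"
  using lin_form_add[of f s "- t"] by (simp add: lin_form_minus)

lemma lin_form_sum: "lin_form f (\<Sum>x\<in>B. g x) = (\<Sum>x\<in>B. lin_form f (g x))"
  by (induction B rule: infinite_finite_induct) (simp_all add: lin_form_add)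

lemma lin_form_lext: "lin_form f (lext g t) = lin_form (\<lambda>x. lin_form f (g x)) t"
  by (simp add: lext_def lin_form_def[of _ t] lin_form_sum lin_form_smul)

lemma lin_form_cong: "(\<And>x. x \<in> Poly_Mapping.keys t \<Longrightarrow> f x = g x) \<Longrightarrow> lin_form f t = lin_form g t"
  by (simp add: lin_form_def)

lemma lin_form_fun_add: "lin_form (\<lambda>x. f x + g x) t = lin_form f t + lin_form g t"
  by (simp add: lin_form_def distrib_left sum.distrib)

lemma lin_form_fun_mult: "lin_form (\<lambda>x. c * f x) t = c * lin_form f t"
  by (simp add: lin_form_def sum_distrib_left algebra_simps)

lemma lin_form_swap:
  "lin_form (\<lambda>x. lin_form (\<lambda>y. f x y) t) s = lin_form (\<lambda>y. lin_form (\<lambda>x. f x y) s) t"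
  unfolding lin_form_def sum_distrib_left by (subst sum.swap) (simp add: algebra_simps)

text \<open>The value at the unit is left open, because the functionals of
  \<open>word_form_ideal\<close> can be identically zero.\<close>

lemma lin_form_hom:
  assumes "\<And>x y. f (x + y) = f x * f y"
  shows "lin_form f (s * t) = lin_form f s * lin_form f t"
proof (induction s rule: poly_mapping_linear_induct)
  case (single x c)
  then show ?case
    by (induction t rule: poly_mapping_linear_induct)
      (simp_all add: mult_single lin_form_single lin_form_add distrib_left assms)
qed (simp add: distrib_right lin_form_add)

lemma lext_fun_lin_form: "lext (\<lambda>x. smul (f x) r) t = smul (lin_form f t) r"
  by (induction t rule: poly_mapping_linear_induct)
    (simp_all add: lext_single lin_form_single lext_add lin_form_add smul_simps smul_add_left)

section \<open>Two-sided ideals\<close>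

text \<open>Ideals as sets in a type-class ring, so that preimages such as the set of all
  \<open>p\<close> with \<open>Delta p\<close> in an ideal can be checked directly;
  \<open>ideal_iff_two_sided\<close> leads back to the ideals of the definitions.\<close>

definition two_sided :: "'r::ring_1 set \<Rightarrow> bool" where
  "two_sided I \<longleftrightarrow> 0 \<in> I \<and> (\<forall>x\<in>I. \<forall>y\<in>I. x + y \<in> I) \<and> (\<forall>x\<in>I. \<forall>r. r * x \<in> I \<and> x * r \<in> I)"

lemma two_sidedD:
  assumes "two_sided I"
  shows two_sided_zero: "0 \<in> I"
    and two_sided_add: "x \<in> I \<Longrightarrow> y \<in> I \<Longrightarrow> x + y \<in> I"
    and two_sided_left: "x \<in> I \<Longrightarrow> r * x \<in> I"
    and two_sided_right: "x \<in> I \<Longrightarrow> x * r \<in> I"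
  using assms by (auto simp: two_sided_def)

lemma two_sided_minus: "two_sided I \<Longrightarrow> x \<in> I \<Longrightarrow> - x \<in> I"
  using two_sided_left[of I x "-1"] by simp

lemma two_sided_diff: "two_sided I \<Longrightarrow> x \<in> I \<Longrightarrow> y \<in> I \<Longrightarrow> x - y \<in> I"
  using two_sided_add[of I x "- y"] two_sided_minus[of I y] by simp

lemma two_sided_smul: "two_sided I \<Longrightarrow> x \<in> I \<Longrightarrow> smul c x \<in> I"
  by (simp add: smul_def two_sided_left)

lemma two_sided_sum: "two_sided I \<Longrightarrow> (\<And>x. x \<in> B \<Longrightarrow> f x \<in> I) \<Longrightarrow> (\<Sum>x\<in>B. f x) \<in> I"
  by (induction B rule: infinite_finite_induct) (auto intro: two_sided_zero two_sided_add)

lemma two_sided_lext: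
  "two_sided I \<Longrightarrow> (\<And>x. x \<in> Poly_Mapping.keys t \<Longrightarrow> f x \<in> I) \<Longrightarrow> lext f t \<in> I"
  unfolding lext_def by (intro two_sided_sum two_sided_smul) auto

section \<open>Quantum Serre elements\<close>

text \<open>
  The multiplication is a parameter \<open>m\<close>, to be instantiated with \<open>(*)\<close> for the \<open>E\<close>-relations and with
  its opposite for the \<open>F\<close>-relations.
\<close>

locale algebra_mult =
  fixes m :: "('x::monoid_add \<Rightarrow>\<^sub>0 'k::field) \<Rightarrow> ('x \<Rightarrow>\<^sub>0 'k) \<Rightarrow> ('x \<Rightarrow>\<^sub>0 'k)"
  assumes assoc: "m (m a b) c = m a (m b c)"
    and add_left: "m (a + b) c = m a c + m b c"
    and add_right: "m a (b + c) = m a b + m a c"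
    and smul_left: "m (smul s a) b = smul s (m a b)"
    and smul_right: "m a (smul s b) = smul s (m a b)"
    and one_left: "m 1 a = a"
    and one_right: "m a 1 = a"
    and power_left: "m a (a ^ k) = a ^ Suc k"
    and power_right: "m (a ^ k) a = a ^ Suc k"
    and ideal_left: "two_sided J \<Longrightarrow> a \<in> J \<Longrightarrow> m b a \<in> J"
    and ideal_right: "two_sided J \<Longrightarrow> a \<in> J \<Longrightarrow> m a b \<in> J"
begin

lemma diff_left: "m (a - b) c = m a c - m b c"
  using add_left[of "a - b" b c] by simp

lemma diff_right: "m a (b - c) = m a b - m a c"
  using add_right[of a "b - c" c] by simp

lemmas m_simps = assoc add_left add_right smul_left smul_right diff_left diff_right

end

interpretation algebra_mult "(*)"
  by unfold_locales
    (auto simp: distrib_left distrib_right mult.assoc smul_simps power_commutes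
      intro: two_sided_left two_sided_right)

interpretation opp: algebra_mult "\<lambda>a b. b * a"
  by unfold_locales
    (auto simp: distrib_left distrib_right mult.assoc smul_simps power_commutes
      intro: two_sided_left two_sided_right)

text \<open>An iterated q-commutator with its own scalar at every step. Keeping \<open>f\<close>
  arbitrary instead of geometric allows the order of the scalars to be reversed.\<close>

primrec qad ::
  "(('x \<Rightarrow>\<^sub>0 'k) \<Rightarrow> ('x \<Rightarrow>\<^sub>0 'k) \<Rightarrow> ('x \<Rightarrow>\<^sub>0 'k)) \<Rightarrow> ('x::monoid_add \<Rightarrow>\<^sub>0 'k::field) \<Rightarrow> (nat \<Rightarrow> 'k) \<Rightarrow> nat \<Rightarrow>
    ('x \<Rightarrow>\<^sub>0 'k) \<Rightarrow> ('x \<Rightarrow>\<^sub>0 'k)" where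
  "qad m x f 0 y = y"
| "qad m x f (Suc n) y = m x (qad m x f n y) - smul (f n) (m (qad m x f n y) x)"

text \<open>By the q-binomial theorem this is the coefficient of z^k in the product of the factors 1
  - c q^s z over s < n.\<close>

definition serre_coeff :: "'k::field \<Rightarrow> 'k \<Rightarrow> nat \<Rightarrow> nat \<Rightarrow> 'k" where
  "serre_coeff q c n k = (-1) ^ k * qbinomial q n k * q ^ (k * (k - 1) div 2) * c ^ k"

definition serre ::
  "(('x \<Rightarrow>\<^sub>0 'k) \<Rightarrow> ('x \<Rightarrow>\<^sub>0 'k) \<Rightarrow> ('x \<Rightarrow>\<^sub>0 'k)) \<Rightarrow> 'k \<Rightarrow> 'k \<Rightarrow> nat \<Rightarrow> ('x::monoid_add \<Rightarrow>\<^sub>0 'k::field) \<Rightarrow>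
    ('x \<Rightarrow>\<^sub>0 'k) \<Rightarrow> ('x \<Rightarrow>\<^sub>0 'k)" where
  "serre m q c n x y = (\<Sum>k\<le>n. smul (serre_coeff q c n k) (m (m (x ^ (n - k)) y) (x ^ k)))"

section \<open>q-integers and q-binomial coefficients\<close>

lemma qfact_Suc: "qfact v (Suc n) = qint v (Suc n) * qfact v n"
  by (simp add: qfact_def)

lemma qfact_nonzero:
  assumes "\<And>n. n > 0 \<Longrightarrow> q ^ n \<noteq> 1"
  shows "qfact q n \<noteq> 0"
  using assms[of 1] assms by (auto simp: qfact_def qint_def)

lemma qint_add: "qint q (a + b) = qint q a + q ^ a * qint q b"
  by (simp add: qint_def power_add algebra_simps flip: add_divide_distrib)

text \<open>Split the top factor \<open>qint q (Suc n)\<close> of the numerator into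
  \<open>qint q (n - k)\<close> and \<open>q ^ (n - k) * qint q (Suc k)\<close>; each part cancels a
  factor of the denominator.\<close>

lemma qbinomial_Pascal:
  fixes q :: "'k::field"
  assumes "\<And>n. n > 0 \<Longrightarrow> q ^ n \<noteq> 1" and "k < n"
  shows "qbinomial q (Suc n) (Suc k) = qbinomial q n (Suc k) + q ^ (n - k) * qbinomial q n k"
proof -
  obtain i where n: "n = Suc (k + i)"
    using \<open>k < n\<close> less_imp_Suc_add by blast
  have nz: "qfact q n \<noteq> 0" for n
    using assms(1) by (rule qfact_nonzero)
  have nz': "qint q (Suc n) \<noteq> 0" for n
    using nz[of "Suc n"] by (auto simp: qfact_Suc)
  have "qint q (Suc (Suc (k + i))) = qint q (Suc i) + q ^ Suc i * qint q (Suc k)"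
    using qint_add[of q "Suc i" "Suc k"] by (simp add: add.commute)
  then have "qfact q (Suc (Suc (k + i))) =
      qint q (Suc i) * qfact q (Suc (k + i)) + q ^ Suc i * qint q (Suc k) * qfact q (Suc (k + i))"
    by (simp add: qfact_Suc algebra_simps)
  then show ?thesis
    unfolding qbinomial_def n
    by (simp add: Suc_diff_le add_diff_cancel_left' qfact_Suc[of q k] qfact_Suc[of q i] nz nz' divide_simps)
qed

lemma qbinomial_0 [simp]: "(\<And>n. n > 0 \<Longrightarrow> q ^ n \<noteq> 1) \<Longrightarrow> qbinomial q n 0 = 1"
  using qfact_nonzero[of q n] by (simp add: qbinomial_def) (simp add: qfact_def)

lemma qbinomial_self [simp]: "(\<And>n. n > 0 \<Longrightarrow> q ^ n \<noteq> 1) \<Longrightarrow> qbinomial q n n = 1"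
  using qfact_nonzero[of q n] by (simp add: qbinomial_def) (simp add: qfact_def)

lemma triangle_Suc: "Suc k * (Suc k - 1) div 2 = k * (k - 1) div 2 + k"
proof -
  have "Suc k * (Suc k - 1) = k * (k - 1) + 2 * k"
    by (cases k) (simp_all add: algebra_simps)
  then show ?thesis by simp
qed

text \<open>Comparison of coefficients after multiplication by 1 - c q^n z. The \<open>if\<close>
  matters: by truncated subtraction \<open>qbinomial q n (Suc n)\<close> is not zero.\<close>

lemma serre_coeff_Suc:
  fixes q :: "'k::field"
  assumes q: "\<And>n. n > 0 \<Longrightarrow> q ^ n \<noteq> 1" and "k \<le> n"
  shows "serre_coeff q c (Suc n) (Suc k) =
    (if k < n then serre_coeff q c n (Suc k) else 0) - c * q ^ n * serre_coeff q c n k"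
proof (cases "k < n")
  case True
  have p: "q ^ k * q ^ (n - k) = q ^ n"
    using True by (simp flip: power_add)
  have "serre_coeff q c (Suc n) (Suc k) = serre_coeff q c n (Suc k)
      + (-1) ^ Suc k * (q ^ (n - k) * qbinomial q n k) * (q ^ (k * (k - 1) div 2) * q ^ k) * c ^ Suc k"
    using qbinomial_Pascal[of q k n] q True
    unfolding serre_coeff_def triangle_Suc power_add by (simp add: algebra_simps)
  also have "\<dots> = serre_coeff q c n (Suc k) - c * (q ^ k * q ^ (n - k)) * serre_coeff q c n k"
    by (simp add: serre_coeff_def algebra_simps)
  finally show ?thesis using True unfolding p by simp
next
  case False
  then have k: "k = n" using \<open>k \<le> n\<close> by simp
  then show ?thesis
    unfolding k serre_coeff_def triangle_Suc power_add
    by (simp add: q algebra_simps)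
qed

lemma serre_coeff_0: "(\<And>n. n > 0 \<Longrightarrow> q ^ n \<noteq> 1) \<Longrightarrow> serre_coeff q c n 0 = 1"
  by (simp add: serre_coeff_def)

section \<open>Iterated q-commutators and Serre elements\<close>

context algebra_mult
begin

lemma qad_add: "qad m x f n (y + y') = qad m x f n y + qad m x f n y'"
  by (induction n) (simp_all add: m_simps smul_simps algebra_simps)

lemma qad_shift: "qad m x f (Suc n) y = qad m x (\<lambda>s. f (Suc s)) n (m x y - smul (f 0) (m y x))"
  by (induction n) simp_all

text \<open>Left and right multiplication by \<open>x\<close> commute, hence so do the operators y
  -> x y - c y x for different values of \<open>c\<close>.\<close>

lemma qad_step: "m x (qad m x f n y) - smul c (m (qad m x f n y) x) =
    qad m x f n (m x y - smul c (m y x))"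
proof (induction n)
  case (Suc n)
  show ?case
    unfolding qad.simps Suc.IH[symmetric]
    by (simp add: m_simps smul_simps algebra_simps)
qed simp

text \<open>The two parts of a coproduct need the scalars in opposite orders, see
  \<open>serre_skew_primitive\<close>.\<close>

lemma qad_reverse: "qad m x (\<lambda>s. f (n - Suc s)) n y = qad m x f n y"
proof (induction n arbitrary: y)
  case (Suc n)
  have "qad m x (\<lambda>s. f (Suc n - Suc s)) (Suc n) y =
      qad m x (\<lambda>s. f (n - Suc s)) n (m x y - smul (f n) (m y x))"
    by (subst qad_shift) simp
  also have "\<dots> = qad m x f (Suc n) y"
    by (simp add: Suc.IH qad_step)
  finally show ?case .
qed simp

text \<open>With L and R the left and right multiplication by \<open>x\<close>, applying the factor
  L - c q^n R to the sum for \<open>n\<close> is the recursion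
  \<open>serre_coeff_Suc\<close>.\<close>

theorem serre_eq_qad:
  assumes q: "\<And>n. n > 0 \<Longrightarrow> q ^ n \<noteq> 1"
  shows "serre m q c n x y = qad m x (\<lambda>s. c * q ^ s) n y"
proof (induction n)
  case 0
  show ?case by (simp add: serre_def serre_coeff_0[OF q] smul_one one_left one_right)
next
  case (Suc n)
  define T where "T k = m (m (x ^ (Suc n - k)) y) (x ^ k)" for k
  \<comment> \<open>\<open>b\<close> puts the coefficient past \<open>n\<close> to zero, where
    \<open>serre_coeff\<close> does not vanish, so that one recursion serves for all
    \<open>k\<close>.\<close>
  define b where "b k = (if k \<le> n then serre_coeff q c n k else 0)" for k
  have left: "m x (m (m (x ^ (n - k)) y) (x ^ k)) = T k" if "k \<le> n" for k
    using that by (simp add: T_def Suc_diff_le assoc[symmetric] power_left del: power_Suc)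
  have right: "m (m (m (x ^ (n - k)) y) (x ^ k)) x = T (Suc k)" for k
    by (simp add: T_def assoc power_right del: power_Suc)
  have m_sum_right: "m x (\<Sum>k\<in>B. g k) = (\<Sum>k\<in>B. m x (g k))" for B and g :: "nat \<Rightarrow> 'x \<Rightarrow>\<^sub>0 'k"
    using smul_right[of x 0 0]
    by (induction B rule: infinite_finite_induct) (simp_all add: add_right smul_simps)
  have m_sum_left: "m (\<Sum>k\<in>B. g k) x = (\<Sum>k\<in>B. m (g k) x)" for B and g :: "nat \<Rightarrow> 'x \<Rightarrow>\<^sub>0 'k"
    using smul_left[of 0 0 x]
    by (induction B rule: infinite_finite_induct) (simp_all add: add_left smul_simps)
  have "serre m q c (Suc n) x y = smul (serre_coeff q c (Suc n) 0) (T 0)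
      + (\<Sum>k\<le>n. smul (serre_coeff q c (Suc n) (Suc k)) (T (Suc k)))"
    by (simp add: serre_def T_def sum.atMost_Suc_shift del: sum.atMost_Suc)
  also have "\<dots> = smul (b 0) (T 0) + (\<Sum>k\<le>n. smul (b (Suc k) - c * q ^ n * b k) (T (Suc k)))"
    using serre_coeff_Suc[OF q]
    by (intro arg_cong2[where f = "(+)"] sum.cong) (auto simp: b_def serre_coeff_0[OF q])
  also have "\<dots> = (\<Sum>k\<le>Suc n. smul (b k) (T k)) - smul (c * q ^ n) (\<Sum>k\<le>n. smul (b k) (T (Suc k)))"
    unfolding sum.atMost_Suc_shift
    by (simp add: smul_def single_diff left_diff_distrib sum_subtractf sum_distrib_left mult_single
        flip: mult.assoc)
  also have "(\<Sum>k\<le>Suc n. smul (b k) (T k)) = m x (serre m q c n x y)"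
    by (simp add: b_def serre_def smul_zero_left m_sum_right smul_right left)
  also have "(\<Sum>k\<le>n. smul (b k) (T (Suc k))) = m (serre m q c n x y) x"
    by (simp add: b_def serre_def m_sum_left smul_left right)
  finally show ?case by (simp add: Suc.IH)
qed

text \<open>Passing \<open>x'\<close> over one more factor \<open>x\<close> costs a factor
  \<open>q\<close>. The resulting scalar \<open>c * q ^ n\<close> is exactly the coefficient of step
  \<open>n\<close> in the q-commutator, which \<open>qad_add_left\<close> exploits.\<close>

lemma qad_commute_left:
  assumes J: "two_sided J"
    and XX: "m x' x - smul q (m x x') \<in> J"
    and XY: "m x' y - smul c (m y x') \<in> J"
  shows "m x' (qad m x (\<lambda>s. c * q ^ s) n y) - smul (c * q ^ n) (m (qad m x (\<lambda>s. c * q ^ s) n y) x') \<in> J"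
proof (induction n)
  case (Suc n)
  define z where "z = qad m x (\<lambda>s. c * q ^ s) n y"
  define e where "e = c * q ^ n"
  have "m x' (m x z - smul e (m z x)) - smul (e * q) (m (m x z - smul e (m z x)) x') =
      m (m x' x - smul q (m x x')) z + smul q (m x (m x' z - smul e (m z x')))
      - smul e (m (m x' z - smul e (m z x')) x) - smul (e * e) (m z (m x' x - smul q (m x x')))"
    by (simp add: m_simps smul_simps algebra_simps)
  also have "\<dots> \<in> J"
    using Suc.IH XX unfolding z_def[symmetric] e_def[symmetric]
    by (blast intro: two_sided_add[OF J] two_sided_diff[OF J] two_sided_smul[OF J]
        ideal_left[OF J] ideal_right[OF J])
  finally show ?case by (simp add: z_def e_def mult_ac)
qed (use XY in simp)

lemma qad_commute_right:
  assumes J: "two_sided J"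
    and XX: "m x x' - smul q (m x' x) \<in> J"
    and XY: "m y x' - smul p (m x' y) \<in> J"
  shows "m (qad m x f n y) x' - smul (p * q ^ n) (m x' (qad m x f n y)) \<in> J"
proof (induction n)
  case (Suc n)
  define z where "z = qad m x f n y"
  define e where "e = p * q ^ n"
  have "m (m x z - smul (f n) (m z x)) x' - smul (e * q) (m x' (m x z - smul (f n) (m z x))) =
      m x (m z x' - smul e (m x' z)) + smul e (m (m x x' - smul q (m x' x)) z)
      - smul (f n) (m z (m x x' - smul q (m x' x))) - smul (f n * q) (m (m z x' - smul e (m x' z)) x)"
    by (simp add: m_simps smul_simps algebra_simps)
  also have "\<dots> \<in> J"
    using Suc.IH XX unfolding z_def[symmetric] e_def[symmetric]
    by (blast intro: two_sided_add[OF J] two_sided_diff[OF J] two_sided_smul[OF J]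
        ideal_left[OF J] ideal_right[OF J])
  finally show ?case by (simp add: z_def e_def mult_ac)
qed (use XY in simp)

lemma qad_add_left:
  assumes J: "two_sided J"
    and XX: "m x' x - smul q (m x x') \<in> J"
    and XY: "m x' y - smul c (m y x') \<in> J"
  shows "qad m (x + x') (\<lambda>s. c * q ^ s) n y - qad m x (\<lambda>s. c * q ^ s) n y \<in> J"
proof (induction n)
  case 0
  show ?case using two_sided_zero[OF J] by simp
next
  case (Suc n)
  define z where "z = qad m x (\<lambda>s. c * q ^ s) n y"
  define v where "v = qad m (x + x') (\<lambda>s. c * q ^ s) n y"
  define e where "e = c * q ^ n"
  have "m (x + x') v - smul e (m v (x + x')) - (m x z - smul e (m z x)) =
      m (x + x') (v - z) - smul e (m (v - z) (x + x')) + (m x' z - smul e (m z x'))"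
    by (simp add: m_simps smul_simps algebra_simps)
  also have "\<dots> \<in> J"
    using Suc.IH qad_commute_left[OF assms, of n]
    unfolding z_def[symmetric] v_def[symmetric] e_def[symmetric]
    by (blast intro: two_sided_add[OF J] two_sided_diff[OF J] two_sided_smul[OF J]
        ideal_left[OF J] ideal_right[OF J])
  finally show ?case by (simp add: z_def v_def e_def)
qed

text \<open>The mirror case: \<open>z\<close> passes \<open>x'\<close> with the scalar
  \<open>p * q ^ n\<close>, so the contribution of \<open>x'\<close> to step \<open>n\<close> lies
  in \<open>J\<close> when \<open>f n\<close> is the inverse of that scalar.\<close>

lemma qad_add_right:
  assumes J: "two_sided J"
    and XX: "m x x' - smul q (m x' x) \<in> J"
    and XY: "m y x' - smul p (m x' y) \<in> J"
    and f: "\<And>s. s < n \<Longrightarrow> f s * (p * q ^ s) = 1"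
  shows "qad m (x' + x) f n y - qad m x f n y \<in> J"
  using f
proof (induction n)
  case 0
  show ?case using two_sided_zero[OF J] by simp
next
  case (Suc n)
  define z where "z = qad m x f n y"
  define v where "v = qad m (x' + x) f n y"
  have fn: "f n * (p * q ^ n) = 1" "p * (f n * q ^ n) = 1"
    using Suc.prems[of n] by (simp_all add: mult_ac)
  have "m (x' + x) v - smul (f n) (m v (x' + x)) - (m x z - smul (f n) (m z x)) =
      m (x' + x) (v - z) - smul (f n) (m (v - z) (x' + x))
      - smul (f n) (m z x' - smul (p * q ^ n) (m x' z))"
    by (simp add: m_simps smul_simps fn algebra_simps)
  also have "\<dots> \<in> J"
    using Suc qad_commute_right[OF J XX XY, of f n]
    unfolding z_def[symmetric] v_def[symmetric]
    by (force intro: two_sided_add[OF J] two_sided_diff[OF J] two_sided_smul[OF J]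
        ideal_left[OF J] ideal_right[OF J])
  finally show ?case by (simp add: z_def v_def)
qed

text \<open>Applied to \<open>y\<close> the q-commutator keeps only \<open>x\<close>; applied to
  \<open>y'\<close> it keeps only \<open>x'\<close>, once its scalars are taken in reverse order.
  The hypothesis \<open>cp\<close> makes the reversed scalars inverse to \<open>p * q ^ s\<close>;
  for the Serre relations it amounts to q_ij q_ji = q_ii^(a_ij).\<close>

theorem serre_skew_primitive:
  assumes q: "\<And>n. n > 0 \<Longrightarrow> q ^ n \<noteq> 1"
    and cp: "\<And>s. s < n \<Longrightarrow> c * p * q ^ (n - 1) = 1"
    and J: "two_sided J"
    and XX: "m x' x - smul q (m x x') \<in> J"
    and XY: "m x' y - smul c (m y x') \<in> J"
    and YX: "m y' x - smul p (m x y') \<in> J"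
  shows "serre m q c n (x + x') (y + y') - (serre m q c n x y + serre m q c n x' y') \<in> J"
proof -
  define f where "f s = c * q ^ s" for s
  have f: "f (n - Suc s) * (p * q ^ s) = 1" if "s < n" for s
  proof -
    have "q ^ (n - Suc s) * q ^ s = q ^ (n - 1)"
      using that by (simp flip: power_add)
    then show ?thesis
      using cp[OF that] by (simp add: f_def) (metis (no_types, opaque_lifting) mult.assoc mult.commute)
  qed
  have "qad m (x + x') f n y - qad m x f n y \<in> J"
    unfolding f_def by (rule qad_add_left[OF J XX XY])
  moreover have "qad m (x + x') f n y' - qad m x' f n y' \<in> J"
    using qad_add_right[OF J XX YX, of n "\<lambda>s. f (n - Suc s)"] f
    unfolding qad_reverse[of _ f] by blast
  ultimately have "qad m (x + x') f n y - qad m x f n y + (qad m (x + x') f n y' - qad m x' f n y') \<in> J"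
    by (rule two_sided_add[OF J])
  then show ?thesis
    using q by (simp add: serre_eq_qad qad_add algebra_simps flip: f_def)
qed

end

section \<open>The Hopf structure on words\<close>

text \<open>A Sweedler sum over a word, with the summand as a continuation. Its values lie in any
  commutative monoid, so iterated coproducts are nested instances and need no tensor type.\<close>

definition wsum :: "'i gen list \<Rightarrow> ('i gen list \<Rightarrow> 'i gen list \<Rightarrow> 'b) \<Rightarrow> 'b::comm_monoid_add" where
  "wsum w g = (\<Sum>(u, v)\<leftarrow>word_comult w. g u v)"

lemma wsum_Nil [simp]: "wsum [] g = g [] []"
  by (simp add: wsum_def)

lemma wsum_E [simp]: "wsum (E i # w) g =
    wsum w (\<lambda>u v. g (E i # u) v) + wsum w (\<lambda>u v. g (K i # u) (E i # v))"
  and wsum_F [simp]: "wsum (F i # w) g =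
    wsum w (\<lambda>u v. g u (F i # v)) + wsum w (\<lambda>u v. g (F i # u) (K' i # v))"
  by (simp_all add: wsum_def case_prod_unfold comp_def)

lemma wsum_torus: "is_torus x \<Longrightarrow> wsum (x # w) g = wsum w (\<lambda>u v. g (x # u) (x # v))"
  by (cases x) (simp_all add: wsum_def case_prod_unfold comp_def)

lemma word_induct [case_names Nil E F torus]:
  assumes "P []" "\<And>i w. P w \<Longrightarrow> P (E i # w)" "\<And>i w. P w \<Longrightarrow> P (F i # w)"
    "\<And>x w. is_torus x \<Longrightarrow> P w \<Longrightarrow> P (x # w)"
  shows "P w"
proof (induction w)
  case (Cons x w)
  then show ?case using assms(2-4) by (cases x) auto
qed (rule assms(1))

lemma wsum_add: "wsum w (\<lambda>u v. g u v + h u v) = wsum w g + wsum w h"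
  by (simp add: wsum_def case_prod_unfold sum_list_addf)

lemma wsum_zero [simp]: "wsum w (\<lambda>u v. 0) = 0"
  by (simp add: wsum_def case_prod_unfold)

lemma wsum_map:
  assumes "f 0 = 0" "\<And>a b. f (a + b) = f a + f b"
  shows "f (wsum w g) = wsum w (\<lambda>u v. f (g u v))"
proof -
  have "f (sum_list xs) = sum_list (map f xs)" for xs
    by (induction xs) (simp_all add: assms)
  then show ?thesis by (simp add: wsum_def case_prod_unfold comp_def)
qed

lemma wsum_lext: "lext f (wsum w g) = wsum w (\<lambda>u v. lext f (g u v))"
  by (rule wsum_map) (simp_all add: lext_add)

lemma wsum_lin_form: "lin_form f (wsum w g) = wsum w (\<lambda>u v. lin_form f (g u v))"
  by (rule wsum_map) (simp_all add: lin_form_add)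

lemma wsum_smul: "smul c (wsum w g) = wsum w (\<lambda>u v. smul c (g u v))"
  by (rule wsum_map) (simp_all add: smul_simps)

lemma wsum_mult_left: "r * wsum w g = wsum w (\<lambda>u v. r * g u v)"
  for r :: "'r::semiring_0"
  by (rule wsum_map) (simp_all add: distrib_left)

lemma wsum_mult_right: "wsum w g * r = wsum w (\<lambda>u v. g u v * r)"
  for r :: "'r::semiring_0"
  using wsum_map[of "\<lambda>a. a * r"] by (simp add: distrib_right)

lemma wsum_append: "wsum (w @ w') g = wsum w (\<lambda>u v. wsum w' (\<lambda>u' v'. g (u @ u') (v @ v')))"
  by (induction w arbitrary: g rule: word_induct) (simp_all add: wsum_torus)

text \<open>On words coassociativity is an exact equality of sums, whereas in the quotient it holds
  only up to \<open>tensor_eq\<close>.\<close>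

lemma wsum_coassoc: "wsum w (\<lambda>u v. wsum u (\<lambda>a b. g a b v)) = wsum w (\<lambda>u v. wsum v (\<lambda>a b. g u a b))"
  by (induction w arbitrary: g rule: word_induct) (simp_all add: wsum_torus wsum_add add_ac)

lemma wsum_cong:
  "(\<And>u v. (u, v) \<in> set (word_comult w) \<Longrightarrow> g u v = h u v) \<Longrightarrow> wsum w g = wsum w h"
  unfolding wsum_def by (intro arg_cong[where f = sum_list] map_cong) auto

lemma wsum_in:
  fixes B :: "'b::comm_monoid_add set"
  assumes "0 \<in> B" and "\<And>a b. a \<in> B \<Longrightarrow> b \<in> B \<Longrightarrow> a + b \<in> B"
    and "\<And>u v. (u, v) \<in> set (word_comult w) \<Longrightarrow> g u v \<in> B"
  shows "wsum w g \<in> B"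
proof -
  have "sum_list (map (\<lambda>(u, v). g u v) ps) \<in> B" if "set ps \<subseteq> set (word_comult w)" for ps
    using that by (induction ps) (auto simp: assms)
  then show ?thesis by (simp add: wsum_def)
qed

lemma wsum_diff: "wsum w (\<lambda>u v. g u v - h u v) = wsum w g - wsum w h"
  for g :: "_ \<Rightarrow> _ \<Rightarrow> 'b::ab_group_add"
  using wsum_add[of w "\<lambda>u v. g u v - h u v" h] by (simp add: eq_diff_eq)

definition torus_word :: "'i gen list \<Rightarrow> bool" where
  "torus_word w \<longleftrightarrow> (\<forall>x\<in>set w. is_torus x)"

lemma torus_word_simps [simp]:
  "torus_word []" "torus_word (x # w) \<longleftrightarrow> is_torus x \<and> torus_word w"
  "torus_word (u @ v) \<longleftrightarrow> torus_word u \<and> torus_word v"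
  by (auto simp: torus_word_def)

lemma word_counit_eq: "word_counit w = (if torus_word w then 1 else 0)"
  by (simp add: word_counit_def torus_word_def)

text \<open>
  Among the terms \<open>u \<otimes> v\<close> of the coproduct of a word \<open>w\<close>, exactly one has a torus word on the left,
  namely \<open>left_torus w \<otimes> w\<close>, and exactly one has a torus word on the right, \<open>w \<otimes> right_torus w\<close>.
\<close>

fun left_torus :: "'i gen list \<Rightarrow> 'i gen list" where
  "left_torus [] = []"
| "left_torus (E i # w) = K i # left_torus w"
| "left_torus (F i # w) = left_torus w"
| "left_torus (x # w) = x # left_torus w"

fun right_torus :: "'i gen list \<Rightarrow> 'i gen list" where
  "right_torus [] = []"
| "right_torus (E i # w) = right_torus w"
| "right_torus (F i # w) = K' i # right_torus w"
| "right_torus (x # w) = x # right_torus w"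

lemma left_torus_torus [simp]: "is_torus x \<Longrightarrow> left_torus (x # w) = x # left_torus w"
  and right_torus_torus [simp]: "is_torus x \<Longrightarrow> right_torus (x # w) = x # right_torus w"
  by (cases x; simp)+

lemma torus_word_left_torus [simp]: "torus_word (left_torus w)"
  and torus_word_right_torus [simp]: "torus_word (right_torus w)"
  by (induction w rule: word_induct) auto

lemma left_torus_id: "torus_word w \<Longrightarrow> left_torus w = w"
  and right_torus_id: "torus_word w \<Longrightarrow> right_torus w = w"
  by (induction w rule: word_induct) auto

lemma wsum_left_torus: "wsum w (\<lambda>u v. if torus_word u then g u v else 0) = g (left_torus w) w"
  by (induction w arbitrary: g rule: word_induct) (simp_all add: wsum_torus)

lemma wsum_right_torus: "wsum w (\<lambda>u v. if torus_word v then g u v else 0) = g w (right_torus w)"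
  by (induction w arbitrary: g rule: word_induct) (simp_all add: wsum_torus)

lemma wsum_left_torus':
  assumes "\<And>u v. \<not> torus_word u \<Longrightarrow> g u v = 0"
  shows "wsum w g = g (left_torus w) w"
proof -
  have "wsum w g = wsum w (\<lambda>u v. if torus_word u then g u v else 0)"
    by (rule wsum_cong) (simp add: assms)
  then show ?thesis by (simp add: wsum_left_torus)
qed

lemma wsum_right_torus':
  assumes "\<And>u v. \<not> torus_word v \<Longrightarrow> g u v = 0"
  shows "wsum w g = g w (right_torus w)"
proof -
  have "wsum w g = wsum w (\<lambda>u v. if torus_word v then g u v else 0)"
    by (rule wsum_cong) (simp add: assms)
  then show ?thesis by (simp add: wsum_right_torus)
qed

subsection \<open>The algebra of pairs of words\<close>

text \<open>The tensor square of the free algebra as the monoid algebra of pairs of words, whose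
  product is componentwise. The product of formal tensors is juxtaposition, so the multiplicativity
  of the coproduct cannot be expressed by it.\<close>

definition tp :: "('a list \<Rightarrow>\<^sub>0 'k) \<Rightarrow> ('a list \<Rightarrow>\<^sub>0 'k) \<Rightarrow> ('a list \<times> 'a list) \<Rightarrow>\<^sub>0 'k::comm_ring_1" where
  "tp a b = lext (\<lambda>u. lext (\<lambda>v. Poly_Mapping.single (u, v) 1) b) a"

lemma tp_simps:
  shows tp_add_left: "tp (a + a') b = tp a b + tp a' b"
    and tp_add_right: "tp a (b + b') = tp a b + tp a b'"
    and tp_diff_left: "tp (a - a') b = tp a b - tp a' b"
    and tp_diff_right: "tp a (b - b') = tp a b - tp a b'"
    and tp_smul_left: "tp (smul c a) b = smul c (tp a b)"
    and tp_smul_right: "tp a (smul c b) = smul c (tp a b)"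
  by (simp_all add: tp_def lext_add lext_diff lext_smul lext_fun_add lext_fun_diff lext_fun_smul)

lemma tp_wmon: "tp (wmon u) (wmon v) = Poly_Mapping.single (u, v) 1"
  by (simp add: tp_def)

lemma tp_zero [simp]: "tp 0 b = 0" "tp a 0 = 0"
  using tp_diff_left[of 0 0 b] tp_diff_right[of a 0 0] by simp_all

lemma tp_sum_left: "tp (\<Sum>x\<in>B. f x) b = (\<Sum>x\<in>B. tp (f x) b)"
  and tp_sum_right: "tp a (\<Sum>x\<in>B. f x) = (\<Sum>x\<in>B. tp a (f x))"
  by (induction B rule: infinite_finite_induct) (simp_all add: tp_simps)

lemma single_eq_wmon: "Poly_Mapping.single u c = smul c (wmon u)"
  by (simp add: wmon_def smul_single)

lemma tp_mult: "tp a b * tp a' b' = tp (a * a') (b * b')"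
proof -
  have w: "tp (wmon u) (wmon v) * tp (wmon u') (wmon v') = tp (wmon u * wmon u') (wmon v * wmon v')"
    for u v u' v' :: "'a list"
    by (simp add: tp_wmon mult_single plus_list_def flip: wmon_append)
  have w2: "tp (wmon u) (wmon v) * tp (wmon u') b' = tp (wmon u * wmon u') (wmon v * b')" for u v u'
    by (induction b' rule: poly_mapping_linear_induct)
      (simp_all add: single_eq_wmon tp_simps smul_simps distrib_left w)
  have w3: "tp (wmon u) (wmon v) * tp a' b' = tp (wmon u * a') (wmon v * b')" for u v
    by (induction a' rule: poly_mapping_linear_induct)
      (simp_all add: single_eq_wmon tp_simps smul_simps distrib_left w2)
  have w4: "tp (wmon u) b * tp a' b' = tp (wmon u * a') (b * b')" for u
    by (induction b rule: poly_mapping_linear_induct)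
      (simp_all add: single_eq_wmon tp_simps smul_simps distrib_right w3)
  show ?thesis
    by (induction a rule: poly_mapping_linear_induct)
      (simp_all add: single_eq_wmon tp_simps smul_simps distrib_right w4)
qed

lemma tp_one: "tp 1 1 = 1"
  by (simp add: tp_wmon zero_list_def flip: wmon_Nil zero_prod_def single_one)
   (simp add: zero_prod_def zero_list_def)

lemma tp_power: "tp a b ^ n = tp (a ^ n) (b ^ n)"
  by (induction n) (simp_all add: tp_one tp_mult)

lemma pair_induct [case_names tp add]:
  assumes "\<And>a b. P (tp a b)" "\<And>s t. P s \<Longrightarrow> P t \<Longrightarrow> P (s + t)"
  shows "P t"
proof (induction t rule: poly_mapping_linear_induct)
  case (single x c)
  have "Poly_Mapping.single x c = tp (smul c (wmon (fst x))) (wmon (snd x))"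
    by (simp add: tp_simps tp_wmon smul_single)
  then show ?case by (simp add: assms(1))
qed (rule assms(2))

text \<open>For an ideal \<open>I\<close> of the free algebra F this is I (x) F + F (x) I, which has
  to be divided out to get the tensor square of the quotient.\<close>

inductive_set tensor_ideal :: "('a list \<Rightarrow>\<^sub>0 'k) set \<Rightarrow> ('a list \<times> 'a list \<Rightarrow>\<^sub>0 'k::comm_ring_1) set"
  for I where
  left: "a \<in> I \<Longrightarrow> tp a b \<in> tensor_ideal I"
| right: "b \<in> I \<Longrightarrow> tp a b \<in> tensor_ideal I"
| add: "s \<in> tensor_ideal I \<Longrightarrow> t \<in> tensor_ideal I \<Longrightarrow> s + t \<in> tensor_ideal I"

lemma two_sided_tensor_ideal:
  assumes I: "two_sided I"
  shows "two_sided (tensor_ideal I)"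
proof -
  have l: "r * t \<in> tensor_ideal I" if "t \<in> tensor_ideal I" for r t
    using that
  proof (induction t)
    case (left a b)
    show ?case
      by (induction r rule: pair_induct)
        (auto simp: tp_mult distrib_right intro!: tensor_ideal.add tensor_ideal.left two_sided_left[OF I] left)
  next
    case (right a b)
    show ?case
      by (induction r rule: pair_induct)
        (auto simp: tp_mult distrib_right intro!: tensor_ideal.add tensor_ideal.right two_sided_left[OF I] right)
  qed (simp add: distrib_left tensor_ideal.add)
  have r: "t * r \<in> tensor_ideal I" if "t \<in> tensor_ideal I" for r t
    using that
  proof (induction t)
    case (left a b)
    show ?case
      by (induction r rule: pair_induct)
        (auto simp: tp_mult distrib_left intro!: tensor_ideal.add tensor_ideal.left two_sided_right[OF I] left)
  next
    case (right a b)
    show ?case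
      by (induction r rule: pair_induct)
        (auto simp: tp_mult distrib_left intro!: tensor_ideal.add tensor_ideal.right two_sided_right[OF I] right)
  qed (simp add: distrib_right tensor_ideal.add)
  have "tp 0 0 \<in> tensor_ideal I"
    by (rule tensor_ideal.left) (rule two_sided_zero[OF I])
  with l r show ?thesis
    by (auto simp: two_sided_def intro: tensor_ideal.add)
qed

section \<open>Coproduct, antipode and counit on the free algebra\<close>

definition Delta :: "('i gen list \<Rightarrow>\<^sub>0 'k) \<Rightarrow> ('i gen list \<times> 'i gen list) \<Rightarrow>\<^sub>0 'k::comm_ring_1" where
  "Delta = lext (\<lambda>w. wsum w (\<lambda>u v. tp (wmon u) (wmon v)))"

lemma Delta_simps:
  shows Delta_add: "Delta (a + b) = Delta a + Delta b"
    and Delta_diff: "Delta (a - b) = Delta a - Delta b"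
    and Delta_smul: "Delta (smul c a) = smul c (Delta a)"
  by (simp_all add: Delta_def lext_add lext_diff lext_smul)

lemma Delta_zero [simp]: "Delta 0 = 0"
  by (simp add: Delta_def)

lemma Delta_wmon: "Delta (wmon w) = wsum w (\<lambda>u v. tp (wmon u) (wmon v))"
  by (simp add: Delta_def)

lemma Delta_mult: "Delta (a * b) = Delta a * Delta b"
  unfolding Delta_def
  by (rule lext_hom)
    (simp add: plus_list_def wsum_append wsum_mult_right, simp add: wsum_mult_left tp_mult wmon_append)

lemma Delta_one: "Delta 1 = 1"
  by (simp add: Delta_wmon tp_one flip: wmon_Nil) (simp add: wmon_Nil tp_one)

lemma Delta_power: "Delta (a ^ n) = Delta a ^ n"
  by (induction n) (simp_all add: Delta_one Delta_mult)

lemma Delta_E: "Delta (gn (E i)) = tp (gn (E i)) 1 + tp (gn (K i)) (gn (E i))"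
  and Delta_F: "Delta (gn (F i)) = tp 1 (gn (F i)) + tp (gn (F i)) (gn (K' i))"
  and Delta_torus: "is_torus x \<Longrightarrow> Delta (gn x) = tp (gn x) (gn x)"
  by (simp_all add: gn_def Delta_wmon wsum_torus flip: wmon_Nil)

lemma wmon_Cons: "wmon (x # w) = gn x * wmon w"
  by (simp add: gn_def flip: wmon_append)

definition antip :: "('i gen list \<Rightarrow>\<^sub>0 'k) \<Rightarrow> 'i gen list \<Rightarrow>\<^sub>0 'k::comm_ring_1" where
  "antip = lext word_antipode"

lemma antip_simps:
  shows antip_add: "antip (a + b) = antip a + antip b"
    and antip_diff: "antip (a - b) = antip a - antip b"
    and antip_smul: "antip (smul c a) = smul c (antip a)"
  by (simp_all add: antip_def lext_add lext_diff lext_smul)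

lemma antip_zero [simp]: "antip 0 = 0"
  by (simp add: antip_def)

lemma antip_wmon: "antip (wmon w) = word_antipode w"
  by (simp add: antip_def)

lemma word_antipode_append: "word_antipode (u @ v) = word_antipode v * word_antipode u"
  by (induction u) (simp_all add: mult.assoc)

lemma antip_mult: "antip (a * b) = antip b * antip a"
  unfolding antip_def by (rule lext_antihom) (simp add: plus_list_def word_antipode_append)

lemma antip_one [simp]: "antip 1 = 1"
  by (simp add: antip_wmon flip: wmon_Nil)

lemma antip_gn: "antip (gn x) = gen_antipode x"
  by (simp add: gn_def antip_wmon)

definition eps :: "('i gen list \<Rightarrow>\<^sub>0 'k) \<Rightarrow> 'k::comm_ring_1" where
  "eps = lin_form word_counit"

lemma word_counit_append: "word_counit (u @ v) = word_counit u * word_counit v"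
  by (auto simp: word_counit_def)

lemma eps_simps:
  shows eps_add: "eps (a + b) = eps a + eps b"
    and eps_diff: "eps (a - b) = eps a - eps b"
    and eps_smul: "eps (smul c a) = c * eps a"
    and eps_zero: "eps 0 = 0"
    and eps_sum: "eps (\<Sum>x\<in>B. f x) = (\<Sum>x\<in>B. eps (f x))"
    and eps_mult: "eps (a * b) = eps a * eps b"
    and eps_wmon: "eps (wmon w) = word_counit w"
  by (simp_all add: eps_def lin_form_add lin_form_diff lin_form_smul lin_form_sum lin_form_hom plus_list_def
      word_counit_append)

lemma eps_one: "eps 1 = 1"
  using eps_wmon[of "[]"] by (simp add: wmon_Nil word_counit_def)

lemma eps_gn: "eps (gn x) = (if is_torus x then 1 else 0)"
  by (simp add: gn_def eps_wmon word_counit_def)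

section \<open>The defining relations\<close>

text \<open>All relations except the Serre ones, for any ideal that contains them. Skew-primitivity
  of the Serre elements follows from these alone, and \<open>antip_ideal\<close> needs it modulo an
  ideal not yet known to contain the Serre elements.\<close>

locale uq_relations =
  fixes q :: "'i \<Rightarrow> 'i \<Rightarrow> 'k::field" and I :: "('i gen list \<Rightarrow>\<^sub>0 'k) set"
  assumes I: "two_sided I"
    and torus_comm: "is_torus x \<Longrightarrow> is_torus y \<Longrightarrow> gn x * gn y - gn y * gn x \<in> I"
    and K_right_inv: "gn (K i) * gn (K_inv i) - 1 \<in> I"
    and K_left_inv: "gn (K_inv i) * gn (K i) - 1 \<in> I"
    and Kp_right_inv: "gn (K' i) * gn (K'_inv i) - 1 \<in> I"
    and Kp_left_inv: "gn (K'_inv i) * gn (K' i) - 1 \<in> I"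
    and K_E: "gn (K i) * gn (E j) * gn (K_inv i) - smul (q i j) (gn (E j)) \<in> I"
    and Kp_E: "gn (K' i) * gn (E j) * gn (K'_inv i) - smul (inverse (q j i)) (gn (E j)) \<in> I"
    and K_F: "gn (K i) * gn (F j) * gn (K_inv i) - smul (inverse (q i j)) (gn (F j)) \<in> I"
    and Kp_F: "gn (K' i) * gn (F j) * gn (K'_inv i) - smul (q j i) (gn (F j)) \<in> I"
    and E_F: "gn (E i) * gn (F j) - gn (F j) * gn (E i)
      - (if i = j then smul (q i i / (q i i - 1)) (gn (K i) - gn (K' i)) else 0) \<in> I"
begin

section \<open>Congruence modulo the ideal and modulo its tensor ideal\<close>

definition eqv :: "('i gen list \<Rightarrow>\<^sub>0 'k) \<Rightarrow> ('i gen list \<Rightarrow>\<^sub>0 'k) \<Rightarrow> bool" (infix "\<approx>" 50) where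
  "a \<approx> b \<longleftrightarrow> a - b \<in> I"

lemma eqv_refl [simp]: "a \<approx> a"
  using two_sided_zero[OF I] by (simp add: eqv_def)

lemma eqv_sym: "a \<approx> b \<Longrightarrow> b \<approx> a"
  using two_sided_minus[OF I] by (fastforce simp: eqv_def)

lemma eqv_trans [trans]: "a \<approx> b \<Longrightarrow> b \<approx> c \<Longrightarrow> a \<approx> c"
  using two_sided_add[OF I, of "a - b" "b - c"] by (simp add: eqv_def)

lemma eqv_add: "a \<approx> a' \<Longrightarrow> b \<approx> b' \<Longrightarrow> a + b \<approx> a' + b'"
  using two_sided_add[OF I, of "a - a'" "b - b'"] by (simp add: eqv_def algebra_simps)

lemma eqv_diff: "a \<approx> a' \<Longrightarrow> b \<approx> b' \<Longrightarrow> a - b \<approx> a' - b'"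
  using two_sided_diff[OF I, of "a - a'" "b - b'"] by (simp add: eqv_def algebra_simps)

lemma eqv_smul: "a \<approx> a' \<Longrightarrow> smul c a \<approx> smul c a'"
  using two_sided_smul[OF I, of "a - a'"] by (simp add: eqv_def smul_simps)

lemma eqv_mult: "a \<approx> a' \<Longrightarrow> b \<approx> b' \<Longrightarrow> a * b \<approx> a' * b'"
  using two_sided_add[OF I two_sided_right[OF I, of "a - a'" b] two_sided_left[OF I, of "b - b'" a']]
  by (simp add: eqv_def algebra_simps)

lemma eqv_left: "b \<approx> b' \<Longrightarrow> a * b \<approx> a * b'"
  and eqv_right: "a \<approx> a' \<Longrightarrow> a * b \<approx> a' * b"
  by (simp_all add: eqv_mult)

lemma eqv_zero: "a \<approx> 0 \<longleftrightarrow> a \<in> I"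
  by (simp add: eqv_def)

lemmas torus_comm' = torus_comm[folded eqv_def]
  and inverses = K_right_inv[folded eqv_def] K_left_inv[folded eqv_def]
    Kp_right_inv[folded eqv_def] Kp_left_inv[folded eqv_def]

abbreviation "J \<equiv> tensor_ideal I"

lemmas J = two_sided_tensor_ideal[OF I]

definition eqvJ :: "('i gen list \<times> 'i gen list \<Rightarrow>\<^sub>0 'k) \<Rightarrow> _ \<Rightarrow> bool" (infix "\<approx>\<^sub>J" 50) where
  "a \<approx>\<^sub>J b \<longleftrightarrow> a - b \<in> J"

lemma eqvJ_refl [simp]: "a \<approx>\<^sub>J a"
  using two_sided_zero[OF J] by (simp add: eqvJ_def)

lemma eqvJ_trans [trans]: "a \<approx>\<^sub>J b \<Longrightarrow> b \<approx>\<^sub>J c \<Longrightarrow> a \<approx>\<^sub>J c"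
  using two_sided_add[OF J, of "a - b" "b - c"] by (simp add: eqvJ_def)

lemma eqvJ_add: "a \<approx>\<^sub>J a' \<Longrightarrow> b \<approx>\<^sub>J b' \<Longrightarrow> a + b \<approx>\<^sub>J a' + b'"
  using two_sided_add[OF J, of "a - a'" "b - b'"] by (simp add: eqvJ_def algebra_simps)

lemma eqvJ_smul: "a \<approx>\<^sub>J a' \<Longrightarrow> smul c a \<approx>\<^sub>J smul c a'"
  using two_sided_smul[OF J, of "a - a'"] by (simp add: eqvJ_def smul_simps)

lemma eqvJ_sum: "(\<And>x. x \<in> B \<Longrightarrow> f x \<approx>\<^sub>J g x) \<Longrightarrow> (\<Sum>x\<in>B. f x) \<approx>\<^sub>J (\<Sum>x\<in>B. g x)"
  by (induction B rule: infinite_finite_induct) (simp_all add: eqvJ_add)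

lemma eqvJ_tp: "a \<approx> a' \<Longrightarrow> b \<approx> b' \<Longrightarrow> tp a b \<approx>\<^sub>J tp a' b'"
  using tensor_ideal.add[OF tensor_ideal.left[of "a - a'" I b] tensor_ideal.right[of "b - b'" I a']]
  by (simp add: eqvJ_def eqv_def tp_simps)

lemma torus_power: "is_torus x \<Longrightarrow> is_torus y \<Longrightarrow> gn y * gn x ^ k \<approx> gn x ^ k * gn y"
proof (induction k)
  case (Suc k)
  have "gn y * gn x ^ Suc k = (gn y * gn x) * gn x ^ k" by (simp add: mult.assoc)
  also have "\<dots> \<approx> (gn x * gn y) * gn x ^ k"
    using Suc by (intro eqv_right torus_comm')
  also have "\<dots> = gn x * (gn y * gn x ^ k)" by (simp add: mult.assoc)
  also have "\<dots> \<approx> gn x * (gn x ^ k * gn y)" using Suc by (intro eqv_left)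
  finally show ?case by (simp add: mult.assoc)
qed simp

lemma commute_from_conj:
  assumes "x * a * y \<approx> smul c a" "y * x \<approx> 1"
  shows "x * a \<approx> smul c (a * x)"
proof -
  have "x * a = x * a * 1" by simp
  also have "\<dots> \<approx> x * a * (y * x)" by (intro eqv_left eqv_sym[OF assms(2)])
  also have "\<dots> = (x * a * y) * x" by (simp add: mult.assoc)
  also have "\<dots> \<approx> smul c a * x" by (intro eqv_right assms(1))
  finally show ?thesis by (simp add: smul_simps)
qed

lemma commute_inverse:
  assumes "x * a * y \<approx> smul c a" "y * x \<approx> 1"
  shows "a * y \<approx> smul c (y * a)"
proof -
  have "a * y = 1 * (a * y)" by simp
  also have "\<dots> \<approx> (y * x) * (a * y)" by (intro eqv_right eqv_sym[OF assms(2)])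
  also have "\<dots> = y * (x * a * y)" by (simp add: mult.assoc)
  also have "\<dots> \<approx> y * smul c a" by (intro eqv_left assms(1))
  finally show ?thesis by (simp add: smul_simps)
qed

lemmas K_E_comm = commute_from_conj[OF K_E[folded eqv_def] inverses(2)]
  and Kp_E_comm = commute_from_conj[OF Kp_E[folded eqv_def] inverses(4)]
  and K_F_comm = commute_from_conj[OF K_F[folded eqv_def] inverses(2)]
  and Kp_F_comm = commute_from_conj[OF Kp_F[folded eqv_def] inverses(4)]
  and Kp_E_comm' = commute_inverse[OF Kp_E[folded eqv_def] inverses(4)]
  and K_F_comm' = commute_inverse[OF K_F[folded eqv_def] inverses(2)]

lemma conj_torus:
  assumes "is_torus x" "is_torus z" "gn x * gn y \<approx> 1"
  shows "gn x * gn z * gn y \<approx> gn z"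
proof -
  have "gn x * gn z * gn y \<approx> gn z * gn x * gn y"
    by (intro eqv_right torus_comm' assms)
  also have "\<dots> = gn z * (gn x * gn y)" by (simp add: mult.assoc)
  also have "\<dots> \<approx> gn z * 1" by (intro eqv_left assms)
  finally show ?thesis by simp
qed

section \<open>The coproduct on the relations other than Serre's\<close>

lemma Delta_conj_E:
  assumes x: "is_torus x" "is_torus y" "gn x * gn y \<approx> 1"
    and c: "gn x * gn (E j) * gn y \<approx> smul c (gn (E j))"
  shows "Delta (gn x * gn (E j) * gn y - smul c (gn (E j))) \<in> J"
proof -
  have "Delta (gn x * gn (E j) * gn y) = tp (gn x * gn (E j) * gn y) (gn x * gn y)
      + tp (gn x * gn (K j) * gn y) (gn x * gn (E j) * gn y)"
    by (simp add: Delta_mult Delta_E Delta_torus x tp_mult distrib_left distrib_right)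
  also have "\<dots> \<approx>\<^sub>J tp (smul c (gn (E j))) 1 + tp (gn (K j)) (smul c (gn (E j)))"
    by (intro eqvJ_add eqvJ_tp assms conj_torus) simp
  also have "\<dots> = Delta (smul c (gn (E j)))"
    by (simp add: Delta_simps Delta_E tp_simps smul_simps)
  finally show ?thesis by (simp add: eqvJ_def Delta_diff)
qed

lemma Delta_conj_F:
  assumes x: "is_torus x" "is_torus y" "gn x * gn y \<approx> 1"
    and c: "gn x * gn (F j) * gn y \<approx> smul c (gn (F j))"
  shows "Delta (gn x * gn (F j) * gn y - smul c (gn (F j))) \<in> J"
proof -
  have "Delta (gn x * gn (F j) * gn y) = tp (gn x * gn y) (gn x * gn (F j) * gn y)
      + tp (gn x * gn (F j) * gn y) (gn x * gn (K' j) * gn y)"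
    by (simp add: Delta_mult Delta_F Delta_torus x tp_mult distrib_left distrib_right)
  also have "\<dots> \<approx>\<^sub>J tp 1 (smul c (gn (F j))) + tp (smul c (gn (F j))) (gn (K' j))"
    by (intro eqvJ_add eqvJ_tp assms conj_torus) simp
  also have "\<dots> = Delta (smul c (gn (F j)))"
    by (simp add: Delta_simps Delta_F tp_simps smul_simps)
  finally show ?thesis by (simp add: eqvJ_def Delta_diff)
qed

lemma Delta_torus_comm:
  assumes "is_torus x" "is_torus y"
  shows "Delta (gn x * gn y - gn y * gn x) \<in> J"
proof -
  have "tp (gn x * gn y) (gn x * gn y) \<approx>\<^sub>J tp (gn y * gn x) (gn y * gn x)"
    by (intro eqvJ_tp torus_comm' assms)
  then show ?thesis
    by (simp add: Delta_diff Delta_mult Delta_torus assms tp_mult eqvJ_def)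
qed

lemma Delta_inverse:
  assumes "is_torus x" "is_torus y" "gn x * gn y \<approx> 1"
  shows "Delta (gn x * gn y - 1) \<in> J"
proof -
  have "tp (gn x * gn y) (gn x * gn y) \<approx>\<^sub>J tp 1 1"
    by (intro eqvJ_tp assms)
  then show ?thesis
    by (simp add: Delta_diff Delta_mult Delta_torus Delta_one assms tp_mult tp_one eqvJ_def)
qed

lemma Delta_E_F:
  "Delta (gn (E i) * gn (F j) - gn (F j) * gn (E i)
      - (if i = j then smul (q i i / (q i i - 1)) (gn (K i) - gn (K' i)) else 0)) \<in> J"
proof -
  define h where "h = (if i = j then smul (q i i / (q i i - 1)) (gn (K i) - gn (K' i)) else 0)"
  have EF: "gn (E i) * gn (F j) - gn (F j) * gn (E i) \<approx> h"
    using E_F by (simp add: eqv_def h_def)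
  \<comment> \<open>The cross terms cancel: exchanging \<open>K i\<close> with \<open>F j\<close>
    and exchanging \<open>K' j\<close> with \<open>E i\<close> give the same scalar
    \<open>inverse (q i j)\<close>, which can be moved between the tensor factors.\<close>
  have "tp (gn (K i) * gn (F j)) (gn (E i) * gn (K' j))
      \<approx>\<^sub>J tp (smul (inverse (q i j)) (gn (F j) * gn (K i))) (gn (E i) * gn (K' j))"
    by (intro eqvJ_tp K_F_comm) simp
  also have "\<dots> = tp (gn (F j) * gn (K i)) (smul (inverse (q i j)) (gn (E i) * gn (K' j)))"
    by (simp add: tp_simps)
  also have "\<dots> \<approx>\<^sub>J tp (gn (F j) * gn (K i)) (gn (K' j) * gn (E i))"
    by (intro eqvJ_tp eqv_sym[OF Kp_E_comm]) simp
  finally have cross: "tp (gn (K i) * gn (F j)) (gn (E i) * gn (K' j))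
      - tp (gn (F j) * gn (K i)) (gn (K' j) * gn (E i)) \<approx>\<^sub>J 0"
    by (simp add: eqvJ_def)
  have "Delta (gn (E i) * gn (F j) - gn (F j) * gn (E i)) =
      tp (gn (E i) * gn (F j) - gn (F j) * gn (E i)) (gn (K' j))
      + tp (gn (K i)) (gn (E i) * gn (F j) - gn (F j) * gn (E i))
      + (tp (gn (K i) * gn (F j)) (gn (E i) * gn (K' j))
        - tp (gn (F j) * gn (K i)) (gn (K' j) * gn (E i)))"
    by (simp add: Delta_simps Delta_mult Delta_E Delta_F tp_mult tp_simps algebra_simps)
  also have "\<dots> \<approx>\<^sub>J tp h (gn (K' j)) + tp (gn (K i)) h + 0"
    by (intro eqvJ_add eqvJ_tp EF cross) simp_all
  \<comment> \<open>For \<open>i = j\<close> the mixed terms K (x) K' cancel, which leaves K (x) K -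
    K' (x) K'.\<close>
  also have "\<dots> = Delta h"
    by (simp add: h_def Delta_simps Delta_torus tp_simps smul_simps)
  finally show ?thesis by (simp add: eqvJ_def Delta_diff flip: h_def)
qed

lemma hom_serre:
  assumes "\<And>a b. f (a + b) = f a + f b" "f 0 = 0" "\<And>c a. f (smul c a) = smul c (f a)"
    "\<And>a b. f (m a b) = m' (f a) (f b)" "\<And>n. f (x ^ n) = f x ^ n"
  shows "f (serre m c d n x y) = serre m' c d n (f x) (f y)"
proof -
  have "f (\<Sum>k\<in>B. g k) = (\<Sum>k\<in>B. f (g k))" for B :: "nat set" and g
    by (induction B rule: infinite_finite_induct) (simp_all add: assms)
  then show ?thesis by (simp add: serre_def assms)
qed

section \<open>The coproduct on the Serre elements\<close>

context
  fixes i j n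
  assumes root: "\<And>n. n > 0 \<Longrightarrow> q i i ^ n \<noteq> 1"
    and qq: "n > 0 \<Longrightarrow> q i j * q j i * q i i ^ (n - 1) = 1"
begin

lemma Delta_serre_E:
  defines "s \<equiv> serre (*) (q i i) (q i j) n (gn (E i)) (gn (E j))"
  shows "Delta s \<approx>\<^sub>J tp s 1 + tp (gn (K i) ^ n * gn (K j)) s"
proof -
  have "Delta s = serre (*) (q i i) (q i j) n (Delta (gn (E i))) (Delta (gn (E j)))"
    unfolding s_def by (rule hom_serre) (simp_all add: Delta_simps Delta_mult Delta_power)
  also have "\<dots> \<approx>\<^sub>J serre (*) (q i i) (q i j) n (tp (gn (E i)) 1) (tp (gn (E j)) 1)
      + serre (*) (q i i) (q i j) n (tp (gn (K i)) (gn (E i))) (tp (gn (K j)) (gn (E j)))"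
    unfolding eqvJ_def Delta_E
  proof (rule serre_skew_primitive[OF root _ J])
    show "tp (gn (K i)) (gn (E i)) * tp (gn (E i)) 1 -
        smul (q i i) (tp (gn (E i)) 1 * tp (gn (K i)) (gn (E i))) \<in> J"
      using eqvJ_tp[OF K_E_comm eqv_refl] by (simp add: tp_mult eqvJ_def tp_simps)
    show "tp (gn (K i)) (gn (E i)) * tp (gn (E j)) 1 -
        smul (q i j) (tp (gn (E j)) 1 * tp (gn (K i)) (gn (E i))) \<in> J"
      using eqvJ_tp[OF K_E_comm eqv_refl] by (simp add: tp_mult eqvJ_def tp_simps)
    show "tp (gn (K j)) (gn (E j)) * tp (gn (E i)) 1 -
        smul (q j i) (tp (gn (E i)) 1 * tp (gn (K j)) (gn (E j))) \<in> J"
      using eqvJ_tp[OF K_E_comm eqv_refl] by (simp add: tp_mult eqvJ_def tp_simps)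
  qed (use qq in simp_all)
  also have "serre (*) (q i i) (q i j) n (tp (gn (E i)) 1) (tp (gn (E j)) 1) = tp s 1"
    unfolding s_def
    by (rule hom_serre[symmetric]) (simp_all add: tp_simps tp_mult tp_power)
  also have "serre (*) (q i i) (q i j) n (tp (gn (K i)) (gn (E i))) (tp (gn (K j)) (gn (E j)))
      = (\<Sum>k\<le>n. smul (serre_coeff (q i i) (q i j) n k) (tp (gn (K i) ^ (n - k) * gn (K j) * gn (K i) ^ k)
          (gn (E i) ^ (n - k) * gn (E j) * gn (E i) ^ k)))"
    by (simp add: serre_def tp_mult tp_power)
  \<comment> \<open>The left tensor factors differ only in the order of their torus letters. Modulo
    \<open>I\<close> they are all equal to one group-like element, which comes out of the
    sum.\<close>
  also have "tp s 1 + \<dots> \<approx>\<^sub>J tp s 1 + (\<Sum>k\<le>n. smul (serre_coeff (q i i) (q i j) n k)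
      (tp (gn (K i) ^ n * gn (K j)) (gn (E i) ^ (n - k) * gn (E j) * gn (E i) ^ k)))"
  proof (intro eqvJ_add eqvJ_refl eqvJ_sum eqvJ_smul eqvJ_tp eqv_refl)
    fix k assume "k \<in> {..n}"
    have "gn (K i) ^ (n - k) * (gn (K j) * gn (K i) ^ k) \<approx> gn (K i) ^ (n - k) * (gn (K i) ^ k * gn (K j))"
      by (intro eqv_left torus_power) simp_all
    also have "\<dots> = gn (K i) ^ n * gn (K j)"
      using \<open>k \<in> {..n}\<close> by (simp flip: mult.assoc power_add)
    finally show "gn (K i) ^ (n - k) * gn (K j) * gn (K i) ^ k \<approx> gn (K i) ^ n * gn (K j)"
      by (simp add: mult.assoc)
  qed
  also have "\<dots> = tp s 1 + tp (gn (K i) ^ n * gn (K j)) s"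
    by (simp add: s_def serre_def tp_sum_right tp_simps)
  finally show ?thesis .
qed

lemma Delta_serre_F:
  defines "s \<equiv> serre (\<lambda>a b. b * a) (q i i) (q i j) n (gn (F i)) (gn (F j))"
  shows "Delta s \<approx>\<^sub>J tp s (gn (K' i) ^ n * gn (K' j)) + tp 1 s"
proof -
  have "Delta s = serre (\<lambda>a b. b * a) (q i i) (q i j) n (Delta (gn (F i))) (Delta (gn (F j)))"
    unfolding s_def by (rule hom_serre) (simp_all add: Delta_simps Delta_mult Delta_power)
  also have "\<dots> \<approx>\<^sub>J serre (\<lambda>a b. b * a) (q i i) (q i j) n (tp (gn (F i)) (gn (K' i))) (tp (gn (F j)) (gn (K' j)))
      + serre (\<lambda>a b. b * a) (q i i) (q i j) n (tp 1 (gn (F i))) (tp 1 (gn (F j)))"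
    \<comment> \<open>For the opposite product F (x) K' plays the part that E (x) 1 has above, and 1
      (x) F that of K (x) E; hence the summands of \<open>Delta_F\<close> are exchanged.\<close>
    unfolding eqvJ_def Delta_F add.commute[of "tp 1 (gn (F _))"]
  proof (rule opp.serre_skew_primitive[OF root _ J])
    show "tp (gn (F i)) (gn (K' i)) * tp 1 (gn (F i)) -
        smul (q i i) (tp 1 (gn (F i)) * tp (gn (F i)) (gn (K' i))) \<in> J"
      using eqvJ_tp[OF eqv_refl Kp_F_comm] by (simp add: tp_mult eqvJ_def tp_simps)
    show "tp (gn (F j)) (gn (K' j)) * tp 1 (gn (F i)) -
        smul (q i j) (tp 1 (gn (F i)) * tp (gn (F j)) (gn (K' j))) \<in> J"
      using eqvJ_tp[OF eqv_refl Kp_F_comm] by (simp add: tp_mult eqvJ_def tp_simps)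
    show "tp (gn (F i)) (gn (K' i)) * tp 1 (gn (F j)) -
        smul (q j i) (tp 1 (gn (F j)) * tp (gn (F i)) (gn (K' i))) \<in> J"
      using eqvJ_tp[OF eqv_refl Kp_F_comm] by (simp add: tp_mult eqvJ_def tp_simps)
  qed (use qq in simp_all)
  also have "serre (\<lambda>a b. b * a) (q i i) (q i j) n (tp 1 (gn (F i))) (tp 1 (gn (F j))) = tp 1 s"
    unfolding s_def
    by (rule hom_serre[symmetric]) (simp_all add: tp_simps tp_mult tp_power)
  also have "serre (\<lambda>a b. b * a) (q i i) (q i j) n (tp (gn (F i)) (gn (K' i))) (tp (gn (F j)) (gn (K' j)))
      = (\<Sum>k\<le>n. smul (serre_coeff (q i i) (q i j) n k) (tp (gn (F i) ^ k * (gn (F j) * gn (F i) ^ (n - k)))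
          (gn (K' i) ^ k * (gn (K' j) * gn (K' i) ^ (n - k)))))"
    by (simp add: serre_def tp_mult tp_power)
  also have "\<dots> + tp 1 s \<approx>\<^sub>J (\<Sum>k\<le>n. smul (serre_coeff (q i i) (q i j) n k)
      (tp (gn (F i) ^ k * (gn (F j) * gn (F i) ^ (n - k))) (gn (K' i) ^ n * gn (K' j)))) + tp 1 s"
  proof (intro eqvJ_add eqvJ_refl eqvJ_sum eqvJ_smul eqvJ_tp eqv_refl)
    fix k assume "k \<in> {..n}"
    have "gn (K' i) ^ k * (gn (K' j) * gn (K' i) ^ (n - k)) \<approx> gn (K' i) ^ k * (gn (K' i) ^ (n - k) * gn (K' j))"
      by (intro eqv_left torus_power) simp_all
    also have "\<dots> = gn (K' i) ^ n * gn (K' j)"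
      using \<open>k \<in> {..n}\<close> by (simp flip: mult.assoc power_add)
    finally show "gn (K' i) ^ k * (gn (K' j) * gn (K' i) ^ (n - k)) \<approx> gn (K' i) ^ n * gn (K' j)" .
  qed
  also have "\<dots> = tp s (gn (K' i) ^ n * gn (K' j)) + tp 1 s"
    by (simp add: s_def serre_def tp_sum_left tp_simps)
  finally show ?thesis .
qed

end

section \<open>The antipode on the relations other than Serre's\<close>

lemma antip_torus: "is_torus x \<Longrightarrow> \<exists>y. is_torus y \<and> antip (gn x) = (gn y :: 'i gen list \<Rightarrow>\<^sub>0 'k)"
  by (cases x) (simp_all add: antip_gn, (metis is_torus.simps)+)

lemma antip_torus_comm:
  assumes "is_torus x" "is_torus y"
  shows "antip (gn x * gn y - gn y * gn x) \<in> I"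
proof -
  obtain x' y' where "is_torus x'" "is_torus y'" 
      "antip (gn x) = (gn x' :: 'i gen list \<Rightarrow>\<^sub>0 'k)" "antip (gn y) = (gn y' :: 'i gen list \<Rightarrow>\<^sub>0 'k)"
    using assms antip_torus by meson
  then show ?thesis
    using torus_comm[of y' x'] by (simp add: antip_simps antip_mult)
qed

text \<open>The antipode reverses products and exchanges \<open>x\<close> with \<open>y\<close>, so
  the conjugation keeps its shape; the torus letter in the antipode of \<open>E j\<close> commutes
  with \<open>x\<close> and moves out.\<close>

lemma antip_conj_E:
  assumes x: "is_torus x" "is_torus y" "antip (gn x) = (gn y :: 'i gen list \<Rightarrow>\<^sub>0 'k)"
      "antip (gn y) = (gn x :: 'i gen list \<Rightarrow>\<^sub>0 'k)"
    and c: "gn x * gn (E j) * gn y \<approx> smul c (gn (E j))"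
  shows "antip (gn x * gn (E j) * gn y - smul c (gn (E j))) \<in> I"
proof -
  have "gn x * gn (K_inv j) * gn (E j) * gn y \<approx> gn (K_inv j) * gn x * gn (E j) * gn y"
    using x by (intro eqv_right torus_comm') simp_all
  also have "\<dots> = gn (K_inv j) * (gn x * gn (E j) * gn y)" by (simp add: mult.assoc)
  also have "\<dots> \<approx> gn (K_inv j) * smul c (gn (E j))" by (intro eqv_left c)
  finally have "smul c (gn (K_inv j) * gn (E j)) - gn x * gn (K_inv j) * gn (E j) * gn y \<in> I"
    using eqv_sym by (simp add: eqv_def smul_simps)
  then show ?thesis
    by (simp add: antip_simps antip_mult antip_gn[of "E j"] x smul_simps mult.assoc)
qed

lemma antip_conj_F:
  assumes x: "is_torus x" "is_torus y" "antip (gn x) = (gn y :: 'i gen list \<Rightarrow>\<^sub>0 'k)"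
      "antip (gn y) = (gn x :: 'i gen list \<Rightarrow>\<^sub>0 'k)"
    and c: "gn x * gn (F j) * gn y \<approx> smul c (gn (F j))"
  shows "antip (gn x * gn (F j) * gn y - smul c (gn (F j))) \<in> I"
proof -
  have "gn x * gn (F j) * (gn (K'_inv j) * gn y) \<approx> gn x * gn (F j) * (gn y * gn (K'_inv j))"
    using x by (intro eqv_left torus_comm') simp_all
  also have "\<dots> = (gn x * gn (F j) * gn y) * gn (K'_inv j)" by (simp add: mult.assoc)
  also have "\<dots> \<approx> smul c (gn (F j)) * gn (K'_inv j)" by (intro eqv_right c)
  finally have "smul c (gn (F j) * gn (K'_inv j)) - gn x * gn (F j) * (gn (K'_inv j) * gn y) \<in> I"
    using eqv_sym by (simp add: eqv_def smul_simps)
  then show ?thesis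
    by (simp add: antip_simps antip_mult antip_gn[of "F j"] x smul_simps mult.assoc)
qed

lemma antip_E_F:
  "antip (gn (E i) * gn (F j) - gn (F j) * gn (E i)
      - (if i = j then smul (q i i / (q i i - 1)) (gn (K i) - gn (K' i)) else 0)) \<in> I"
proof -
  define c where "c = (if i = j then q i i / (q i i - 1) else 0)"
  have h: "(if i = j then smul (q i i / (q i i - 1)) (gn (K i) - gn (K' i)) else 0)
      = smul c (gn (K j) - gn (K' i))"
    by (simp add: c_def smul_simps)
  \<comment> \<open>As \<open>c\<close> vanishes for distinct indices, \<open>i\<close> and
    \<open>j\<close> may be exchanged under it. This puts each torus letter next to its own inverse
    further down.\<close>
  have c0: "smul c (gn (K j)) = smul c (gn (K i))" "smul c (gn (K' j)) = smul c (gn (K' i))"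
      "smul c (gn (K_inv j)) = smul c (gn (K_inv i))" "smul c (gn (K'_inv j)) = smul c (gn (K'_inv i))"
    by (simp_all add: c_def smul_simps)
  let ?E = "gn (E i)" and ?F = "gn (F j)" and ?k = "gn (K_inv i)" and ?k' = "gn (K'_inv j)"
  have "?F * ?k' * (?k * ?E) = ?F * (?k' * ?k) * ?E" by (simp add: mult.assoc)
  also have "\<dots> \<approx> ?F * (?k * ?k') * ?E"
    by (intro eqv_left eqv_right torus_comm') simp_all
  also have "\<dots> = ?F * ?k * (?k' * ?E)" by (simp add: mult.assoc)
  also have "\<dots> \<approx> smul (inverse (q i j)) (?k * ?F) * (?k' * ?E)"
    by (intro eqv_right K_F_comm')
  also have "\<dots> = ?k * ?F * smul (inverse (q i j)) (?k' * ?E)" by (simp add: smul_simps)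
  also have "\<dots> \<approx> ?k * ?F * (?E * ?k')"
    by (intro eqv_left eqv_sym[OF Kp_E_comm'])
  finally have "?F * ?k' * (?k * ?E) - ?k * ?E * (?F * ?k') \<approx> ?k * ?F * (?E * ?k') - ?k * ?E * (?F * ?k')"
    by (intro eqv_diff) simp_all
  also have "\<dots> = ?k * (0 - (?E * ?F - ?F * ?E)) * ?k'"
    by (simp add: algebra_simps)
  also have "\<dots> \<approx> ?k * (0 - smul c (gn (K j) - gn (K' i))) * ?k'"
    using E_F[of i j] by (intro eqv_left eqv_right eqv_diff) (simp_all add: eqv_def h)
  also have "\<dots> = ?k * smul c (gn (K' i)) * ?k' - ?k * smul c (gn (K j)) * ?k'"
    by (simp add: smul_simps algebra_simps)
  also have "\<dots> = ?k * smul c (gn (K' j)) * ?k' - ?k * smul c (gn (K i)) * ?k'"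
    by (simp only: c0)
  also have "\<dots> = smul c (?k * (gn (K' j) * ?k')) - smul c (?k * gn (K i) * ?k')"
    by (simp add: smul_simps mult.assoc)
  also have "\<dots> \<approx> smul c (?k * 1) - smul c (1 * ?k')"
    by (intro eqv_diff eqv_smul eqv_left eqv_right inverses)
  also have "\<dots> = smul c (gn (K_inv j) - gn (K'_inv i))"
    by (simp add: smul_simps c0)
  finally show ?thesis
    unfolding h by (simp add: antip_simps antip_mult antip_gn eqv_def)
qed

text \<open>The first letter ends up in the middle, between \<open>word_antipode u\<close> and
  \<open>wmon v\<close>, and the antipode law for this one letter applies there.\<close>

lemma antip_left: "wsum w (\<lambda>u v. word_antipode u * wmon v) \<approx> smul (word_counit w) 1"
proof (induction w rule: word_induct)
  case Nil
  show ?case by (simp add: word_counit_def smul_one wmon_Nil)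
next
  case (E i w)
  have "wsum (E i # w) (\<lambda>u v. word_antipode u * wmon v) = (0 :: 'i gen list \<Rightarrow>\<^sub>0 'k)"
    by (simp add: wmon_Cons smul_simps mult.assoc flip: wsum_add)
  then show ?case by (simp add: word_counit_def smul_simps del: wsum_E)
next
  case (F i w)
  have "wsum (F i # w) (\<lambda>u v. word_antipode u * wmon v) =
      wsum w (\<lambda>u v. word_antipode u * gn (F i) * (1 - gn (K'_inv i) * gn (K' i)) * wmon v)"
    by (simp add: wmon_Cons algebra_simps flip: wsum_add)
  also have "\<dots> \<in> I"
    using two_sided_minus[OF I inverses(4)[of i, unfolded eqv_def]]
    by (intro wsum_in two_sided_zero[OF I] two_sided_add[OF I] two_sided_right[OF I] two_sided_left[OF I])
      simp_all
  finally show ?case by (simp add: word_counit_def smul_simps eqv_zero)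
next
  case (torus x w)
  have x: "gen_antipode x * gn x \<approx> 1"
    using torus(1) inverses by (cases x) simp_all
  have "wsum (x # w) (\<lambda>u v. word_antipode u * wmon v) - wsum w (\<lambda>u v. word_antipode u * wmon v) =
      wsum w (\<lambda>u v. word_antipode u * (gen_antipode x * gn x - 1) * wmon v)"
    by (simp add: wmon_Cons algebra_simps wsum_torus torus(1) flip: wsum_diff)
  also have "\<dots> \<in> I"
    using x unfolding eqv_def
    by (intro wsum_in two_sided_zero[OF I] two_sided_add[OF I] two_sided_right[OF I] two_sided_left[OF I])
  finally have "wsum (x # w) (\<lambda>u v. word_antipode u * wmon v) \<approx> wsum w (\<lambda>u v. word_antipode u * wmon v)"
    by (simp add: eqv_def)
  also note torus(2)
  finally show ?case using torus(1) by (simp add: word_counit_def)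
qed

text \<open>Here the first letter ends up outside, so the sum for the rest is evaluated by induction
  before the letter can cancel.\<close>

lemma antip_right: "wsum w (\<lambda>u v. wmon u * word_antipode v) \<approx> smul (word_counit w) 1"
proof (induction w rule: word_induct)
  case Nil
  show ?case by (simp add: word_counit_def smul_one wmon_Nil)
next
  case (E i w)
  let ?X = "wsum w (\<lambda>u v. wmon u * word_antipode v)" and ?c = "word_counit w"
  have "wsum (E i # w) (\<lambda>u v. wmon u * word_antipode v) =
      gn (E i) * ?X - gn (K i) * ?X * (gn (K_inv i) * gn (E i))"
    by (simp add: wmon_Cons wsum_mult_left wsum_mult_right mult.assoc flip: wsum_add wsum_diff)
  also have "\<dots> \<approx> gn (E i) * smul ?c 1 - gn (K i) * smul ?c 1 * (gn (K_inv i) * gn (E i))"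
    by (intro eqv_diff eqv_left eqv_right E)
  also have "\<dots> = smul ?c (gn (E i) - (gn (K i) * gn (K_inv i)) * gn (E i))"
    by (simp add: smul_simps mult.assoc)
  also have "\<dots> \<approx> smul ?c (gn (E i) - 1 * gn (E i))"
    by (intro eqv_smul eqv_diff eqv_right inverses) simp
  finally show ?case by (simp add: word_counit_def smul_simps)
next
  case (F i w)
  let ?X = "wsum w (\<lambda>u v. wmon u * word_antipode v)" and ?c = "word_counit w"
  have "wsum (F i # w) (\<lambda>u v. wmon u * word_antipode v) =
      gn (F i) * ?X * gn (K'_inv i) - ?X * (gn (F i) * gn (K'_inv i))"
    by (simp add: wmon_Cons wsum_mult_left wsum_mult_right mult.assoc flip: wsum_add wsum_diff)
  also have "\<dots> \<approx> gn (F i) * smul ?c 1 * gn (K'_inv i) - smul ?c 1 * (gn (F i) * gn (K'_inv i))"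
    by (intro eqv_diff eqv_left eqv_right F)
  finally show ?case by (simp add: word_counit_def smul_simps)
next
  case (torus x w)
  have x: "gn x * gen_antipode x \<approx> 1"
    using torus(1) inverses by (cases x) simp_all
  let ?X = "wsum w (\<lambda>u v. wmon u * word_antipode v)" and ?c = "word_counit w"
  have "wsum (x # w) (\<lambda>u v. wmon u * word_antipode v) = gn x * ?X * gen_antipode x"
    by (simp add: wmon_Cons wsum_torus torus(1) wsum_mult_left wsum_mult_right mult.assoc)
  also have "\<dots> \<approx> gn x * smul ?c 1 * gen_antipode x"
    by (intro eqv_left eqv_right torus(2))
  also have "\<dots> = smul ?c (gn x * gen_antipode x)" by (simp add: smul_simps)
  also have "\<dots> \<approx> smul ?c 1" by (intro eqv_smul x)
  finally show ?case using torus(1) by (simp add: word_counit_def)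
qed

end

section \<open>Formal tensors\<close>

lemma tensor_eq_refl [simp]: "tensor_eq H s s"
  by (simp add: tensor_eq_def free_space.span_zero)

lemma tensor_eq_sym: "tensor_eq H s t \<Longrightarrow> tensor_eq H t s"
  using free_space.span_neg[of "s - t" "multilin_rels H"] by (simp add: tensor_eq_def)

lemma tensor_eq_trans [trans]: "tensor_eq H s t \<Longrightarrow> tensor_eq H t r \<Longrightarrow> tensor_eq H s r"
  using free_space.span_add[of "s - t" "multilin_rels H" "t - r"] by (simp add: tensor_eq_def)

lemma tensor_eq_add: "tensor_eq H s t \<Longrightarrow> tensor_eq H s' t' \<Longrightarrow> tensor_eq H (s + s') (t + t')"
  using free_space.span_add[of "s - t" "multilin_rels H" "s' - t'"]
  by (simp add: tensor_eq_def algebra_simps)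

lemma tensor_eq_smul: "tensor_eq H s t \<Longrightarrow> tensor_eq H (smul c s) (smul c t)"
  using free_space.span_scale[of "s - t" "multilin_rels H" c]
  by (simp add: tensor_eq_def scal_mult smul_simps)

lemma tensor_eq_sum: "(\<And>x. x \<in> B \<Longrightarrow> tensor_eq H (f x) (g x)) \<Longrightarrow> tensor_eq H (\<Sum>x\<in>B. f x) (\<Sum>x\<in>B. g x)"
  by (induction B rule: infinite_finite_induct) (simp_all add: tensor_eq_add)

lemma tensor_eq_lext:
  "(\<And>x. x \<in> Poly_Mapping.keys t \<Longrightarrow> tensor_eq H (f x) (g x)) \<Longrightarrow> tensor_eq H (lext f t) (lext g t)"
  unfolding lext_def by (intro tensor_eq_sum tensor_eq_smul)

lemma tensor_eq_wsum:
  assumes "\<And>u v. (u, v) \<in> set (word_comult w) \<Longrightarrow> tensor_eq H (f u v) (g u v)"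
  shows "tensor_eq H (wsum w f) (wsum w g)"
proof -
  have "wsum w (\<lambda>u v. f u v - g u v) \<in> free_space.span (multilin_rels H)"
    using assms by (intro wsum_in) (auto simp: tensor_eq_def free_space.span_zero intro: free_space.span_add)
  then show ?thesis by (simp add: tensor_eq_def wsum_diff)
qed

lemma tensor_eq_map:
  assumes add: "\<And>s t. f (s + t) = f s + f t" and smul: "\<And>c t. f (smul c t) = smul c (f t)"
    and rel: "\<And>t. t \<in> multilin_rels H \<Longrightarrow> f t \<in> free_space.span (multilin_rels H')"
    and st: "tensor_eq H s t"
  shows "tensor_eq H' (f s) (f t)"
proof -
  have "f (s - t) \<in> free_space.span (multilin_rels H')"
    using st unfolding tensor_eq_def
  proof (induction rule: free_space.span_induct_alt)
    case base
    show ?case using smul[of 0 0] by (simp add: smul_simps free_space.span_zero)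
  next
    case (step c x y)
    have "scal c * f x + f y \<in> free_space.span (multilin_rels H')"
      by (intro free_space.span_add free_space.span_scale rel step)
    then show ?case by (simp add: add smul scal_mult)
  qed
  then show ?thesis
    using add[of "s - t" t] by (simp add: tensor_eq_def)
qed

lemma tensor_eq_append_right:
  assumes "set ys \<subseteq> carrier H" "tensor_eq H s t"
  shows "tensor_eq H (s * wmon ys) (t * wmon ys)"
proof (rule tensor_eq_map[OF _ _ _ assms(2)])
  fix t assume "t \<in> multilin_rels H"
  then show "t * wmon ys \<in> free_space.span (multilin_rels H)"
  proof cases
    case (add x y us vs)
    then have "t * wmon ys = wmon (us @ [x \<oplus>\<^bsub>H\<^esub> y] @ (vs @ ys)) - wmon (us @ [x] @ (vs @ ys)) - wmon (us @ [y] @ (vs @ ys))"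
      by (simp add: left_diff_distrib flip: wmon_append)
    then show ?thesis
      using multilin_rels.add[of x H y us "vs @ ys"] add assms(1) by (auto intro: free_space.span_base)
  next
    case (smult x us vs c)
    then have "t * wmon ys = wmon (us @ [c \<odot>\<^bsub>H\<^esub> x] @ (vs @ ys)) - scal c * wmon (us @ [x] @ (vs @ ys))"
      by (simp add: left_diff_distrib mult.assoc flip: wmon_append)
    then show ?thesis
      using multilin_rels.smult[of x H us "vs @ ys" c] smult assms(1) by (auto intro: free_space.span_base)
  qed
qed (simp_all add: distrib_right smul_simps)

lemma tensor_eq_append_left:
  assumes "set ys \<subseteq> carrier H" "tensor_eq H s t"
  shows "tensor_eq H (wmon ys * s) (wmon ys * t)"
proof (rule tensor_eq_map[OF _ _ _ assms(2)])
  fix t assume "t \<in> multilin_rels H"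
  then show "wmon ys * t \<in> free_space.span (multilin_rels H)"
  proof cases
    case (add x y us vs)
    then have "wmon ys * t = wmon ((ys @ us) @ [x \<oplus>\<^bsub>H\<^esub> y] @ vs) - wmon ((ys @ us) @ [x] @ vs) - wmon ((ys @ us) @ [y] @ vs)"
      by (simp add: right_diff_distrib flip: wmon_append)
    then show ?thesis
      using multilin_rels.add[of x H y "ys @ us" vs] add assms(1) by (auto intro: free_space.span_base)
  next
    case (smult x us vs c)
    then have "wmon ys * t = wmon ((ys @ us) @ [c \<odot>\<^bsub>H\<^esub> x] @ vs) - scal c * wmon ((ys @ us) @ [x] @ vs)"
      by (simp add: right_diff_distrib scal_mult smul_simps flip: wmon_append)
    then show ?thesis
      using multilin_rels.smult[of x H "ys @ us" vs c] smult assms(1) by (auto intro: free_space.span_base)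
  qed
qed (simp_all add: distrib_left smul_simps)

lemma tensor_eq_pair_add:
  assumes "x \<in> carrier H" "y \<in> carrier H" "z \<in> carrier H"
  shows "tensor_eq H (wmon [x \<oplus>\<^bsub>H\<^esub> y, z]) (wmon [x, z] + wmon [y, z])"
    and "tensor_eq H (wmon [z, x \<oplus>\<^bsub>H\<^esub> y]) (wmon [z, x] + wmon [z, y])"
  using multilin_rels.add[of x H y "[]" "[z]"] multilin_rels.add[of x H y "[z]" "[]"] assms
  by (simp_all add: tensor_eq_def diff_diff_eq free_space.span_base)

lemma tensor_eq_pair_smult:
  assumes "x \<in> carrier H" "z \<in> carrier H"
  shows "tensor_eq H (wmon [c \<odot>\<^bsub>H\<^esub> x, z]) (smul c (wmon [x, z]))"
    and "tensor_eq H (wmon [z, c \<odot>\<^bsub>H\<^esub> x]) (smul c (wmon [z, x]))"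
  using multilin_rels.smult[of x H "[]" "[z]" c] multilin_rels.smult[of x H "[z]" "[]" c] assms
  unfolding tensor_eq_def scal_mult[symmetric] by (auto intro: free_space.span_base)

section \<open>The quotient Hopf algebra\<close>

lemma ring_of_type_algebra_simps [simp]:
  "carrier ring_of_type_algebra = UNIV" "monoid.mult ring_of_type_algebra x y = x * y"
  "monoid.one ring_of_type_algebra = 1" "ring.zero ring_of_type_algebra = 0"
  "ring.add ring_of_type_algebra x y = x + y"
  by (simp_all add: ring_of_type_algebra_def)

lemma ring_ring_of_type_algebra: "ring (ring_of_type_algebra :: 'r::ring_1 ring)"
proof -
  have "\<exists>y. x + y = 0" for x :: 'r
    using add.right_inverse by blast
  then show ?thesis
    by unfold_locales (auto simp: algebra_simps Units_def add_eq_0_iff2 ring_of_type_algebra_def)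
qed

lemma a_inv_ring_of_type_algebra: "a_inv ring_of_type_algebra (x :: 'r::ring_1) = - x"
proof -
  interpret ring "ring_of_type_algebra :: 'r ring" by (rule ring_ring_of_type_algebra)
  show ?thesis using minus_equality[of "- x" x] by simp
qed

lemma ideal_iff_two_sided: "ideal I (ring_of_type_algebra :: 'r::ring_1 ring) \<longleftrightarrow> two_sided I"
proof
  assume "ideal I (ring_of_type_algebra :: 'r ring)"
  then interpret ideal I "ring_of_type_algebra :: 'r ring" .
  show "two_sided I"
    using additive_subgroup.zero_closed[OF additive_subgroup_axioms]
      additive_subgroup.a_closed[OF additive_subgroup_axioms] I_l_closed I_r_closed by (simp add: two_sided_def)
next
  assume I: "two_sided I"
  interpret ring "ring_of_type_algebra :: 'r ring" by (rule ring_ring_of_type_algebra)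
  have inv: "inv\<^bsub>add_monoid ring_of_type_algebra\<^esub> x = - x" for x :: 'r
    using a_inv_ring_of_type_algebra[of x] by (simp add: a_inv_def)
  show "ideal I (ring_of_type_algebra :: 'r ring)"
  proof (rule idealI)
    show "subgroup I (add_monoid (ring_of_type_algebra :: 'r ring))"
    proof (rule subgroup.intro)
      show "inv\<^bsub>add_monoid ring_of_type_algebra\<^esub> x \<in> I" if "x \<in> I" for x
        using that by (simp only: inv two_sided_minus[OF I])
    qed (auto intro: two_sided_zero[OF I] two_sided_add[OF I])
  qed (auto intro: ring_ring_of_type_algebra two_sided_left[OF I] two_sided_right[OF I])
qed

lemma two_sided_uq_ideal: "two_sided (uq_ideal A q)"
  unfolding uq_ideal_def ideal_iff_two_sided[symmetric]
  by (rule ring.genideal_ideal[OF ring_ring_of_type_algebra]) simp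

lemma uq_rels_subset: "uq_rels A q \<subseteq> uq_ideal A q"
  unfolding uq_ideal_def
  by (rule ring.genideal_self[OF ring_ring_of_type_algebra]) simp

lemma uq_ideal_minimal: "two_sided J \<Longrightarrow> uq_rels A q \<subseteq> J \<Longrightarrow> uq_ideal A q \<subseteq> J"
  unfolding uq_ideal_def
  by (rule ring.genideal_minimal[OF ring_ring_of_type_algebra]) (simp_all add: ideal_iff_two_sided)

lemma serre_E_eq:
  "(\<Sum>k\<le>n. scal ((-1) ^ k * qbinomial (q i i) n k * q i i ^ (k * (k - 1) div 2) * q i j ^ k)
      * (gn (E i) ^ (n - k) * gn (E j) * gn (E i) ^ k)) =
    serre (*) (q i i) (q i j) n (gn (E i)) (gn (E j))"
  and serre_F_eq:
  "(\<Sum>k\<le>n. scal ((-1) ^ k * qbinomial (q i i) n k * q i i ^ (k * (k - 1) div 2) * q i j ^ k)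
      * (gn (F i) ^ k * gn (F j) * gn (F i) ^ (n - k))) =
    serre (\<lambda>a b. b * a) (q i i) (q i j) n (gn (F i)) (gn (F j))"
  by (simp_all only: serre_def scal_mult serre_coeff_def mult.assoc)

lemma uq_relations_uq_ideal: "uq_relations q (uq_ideal A q)"
  by (unfold_locales; (unfold scal_mult[symmetric])?;
      (rule two_sided_uq_ideal | rule subsetD[OF uq_rels_subset], rule uq_rels.intros; assumption))

text \<open>Instantiated twice in the end: for the parameters \<open>q i j\<close> and for the
  powers \<open>q0 powi (d i * A i j)\<close>.\<close>

locale uq =
  fixes A :: "'i \<Rightarrow> 'i \<Rightarrow> int" and q :: "'i \<Rightarrow> 'i \<Rightarrow> 'k::field"
  assumes off_diagonal: "i \<noteq> j \<Longrightarrow> A i j \<le> 0"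
    and q_nonzero: "q i j \<noteq> 0"
    and q_rel: "q i j * q j i = q i i powi A i j"
    and q_not_root: "n > 0 \<Longrightarrow> q i i ^ n \<noteq> 1"
begin

sublocale uq_relations q "uq_ideal A q"
  by (rule uq_relations_uq_ideal)

notation eqv (infix "\<approx>" 50)
notation eqvJ (infix "\<approx>\<^sub>J" 50)

abbreviation "I \<equiv> uq_ideal A q"

text \<open>This provides the condition on the scalars in \<open>serre_skew_primitive\<close>: the
  exponent \<open>n - 1\<close> is the negative of \<open>A i j\<close>.\<close>

lemma q_power: "i \<noteq> j \<Longrightarrow> n = nat (1 - A i j) \<Longrightarrow> q i j * q j i * q i i ^ (n - 1) = 1"
proof -
  assume "i \<noteq> j" "n = nat (1 - A i j)"
  then have "n - 1 = nat (- A i j)" "A i j \<le> 0"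
    using off_diagonal by auto
  then have "q i i ^ (n - 1) = q i i powi (- A i j)"
    by (metis nat_0_le neg_0_le_iff_le power_int_of_nat)
  then show ?thesis
    by (simp add: q_rel power_int_minus q_nonzero)
qed

section \<open>The structure maps preserve the ideal of relations\<close>

lemma eps_ideal: "p \<in> I \<Longrightarrow> eps p = 0"
proof -
  have "two_sided {p :: 'i gen list \<Rightarrow>\<^sub>0 'k. eps p = 0}"
    by (simp add: two_sided_def eps_simps)
  moreover have "uq_rels A q \<subseteq> {p. eps p = 0}"
  proof
    fix p assume "p \<in> uq_rels A q"
    then have "eps p = 0"
      by cases (auto simp: eps_simps eps_one eps_gn scal_mult simp del: sum.atMost_Suc)
    then show "p \<in> {p. eps p = 0}" by simp
  qed
  ultimately have "I \<subseteq> {p. eps p = 0}" by (rule uq_ideal_minimal)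
  then show "p \<in> I \<Longrightarrow> eps p = 0" by auto
qed

lemma Delta_ideal: "p \<in> I \<Longrightarrow> Delta p \<in> J"
proof -
  have "two_sided {p. Delta p \<in> J}"
    using two_sidedD[OF J] by (auto simp: two_sided_def Delta_simps Delta_mult)
  moreover have "uq_rels A q \<subseteq> {p. Delta p \<in> J}"
  proof
    fix p assume p: "p \<in> uq_rels A q"
    then have pI: "p \<in> I" using uq_rels_subset by blast
    from p have "Delta p \<in> J"
    proof cases
      case (serre_E i j n)
      have "Delta p \<approx>\<^sub>J tp p 1 + tp (gn (K i) ^ n * gn (K j)) p"
        unfolding serre_E(1) serre_E_eq
        by (rule Delta_serre_E) (use q_not_root q_power serre_E in auto)
      moreover have "tp p 1 + tp (gn (K i) ^ n * gn (K j)) p \<in> J"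
        by (intro tensor_ideal.add tensor_ideal.left tensor_ideal.right pI)
      ultimately show ?thesis
        using two_sided_add[OF J] by (fastforce simp: eqvJ_def)
    next
      case (serre_F i j n)
      have "Delta p \<approx>\<^sub>J tp p (gn (K' i) ^ n * gn (K' j)) + tp 1 p"
        unfolding serre_F(1) serre_F_eq
        by (rule Delta_serre_F) (use q_not_root q_power serre_F in auto)
      moreover have "tp p (gn (K' i) ^ n * gn (K' j)) + tp 1 p \<in> J"
        by (intro tensor_ideal.add tensor_ideal.left tensor_ideal.right pI)
      ultimately show ?thesis
        using two_sided_add[OF J] by (fastforce simp: eqvJ_def)
    next
      case (E_F i j)
      show ?thesis unfolding E_F scal_mult by (rule Delta_E_F)
    qed (use inverses K_E Kp_E K_F Kp_F in \<open>auto simp: scal_mult eqv_def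
        intro!: Delta_torus_comm Delta_inverse Delta_conj_E Delta_conj_F\<close>)
    then show "p \<in> {p. Delta p \<in> J}" by simp
  qed
  ultimately have "I \<subseteq> {p. Delta p \<in> J}" by (rule uq_ideal_minimal)
  then show "p \<in> I \<Longrightarrow> Delta p \<in> J" by auto
qed

text \<open>\<open>mS\<close> and \<open>mS'\<close> are the maps m(S (x) id) and m(id (x) S) on
  pairs of words.\<close>

lemma Delta_antip:
  defines "mS \<equiv> lext (\<lambda>(u, v). word_antipode u * wmon v)"
    and "mS' \<equiv> lext (\<lambda>(u, v). wmon u * word_antipode v)"
  shows "mS (tp a b) = antip a * b" "mS' (tp a b) = a * antip b"
    "mS (Delta p) \<approx> smul (eps p) 1" "mS' (Delta p) \<approx> smul (eps p) 1"
    "mS (s + t) = mS s + mS t" "mS' (s + t) = mS' s + mS' t"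
    "mS (s - t) = mS s - mS t" "mS' (s - t) = mS' s - mS' t"
proof -
  show "mS (tp a b) = antip a * b"
    by (simp add: mS_def tp_def lext_lext lext_single smul_one lext_fun_mult_left lext_fun_mult_right
        antip_def lext_wmon_id)
  show "mS' (tp a b) = a * antip b"
    by (simp add: mS'_def tp_def lext_lext lext_single smul_one lext_fun_mult_left lext_fun_mult_right
        antip_def lext_wmon_id)
  have add: "smul (eps (s + t)) 1 = smul (eps s) (1 :: 'i gen list \<Rightarrow>\<^sub>0 'k) + smul (eps t) 1" for s t
    by (simp add: eps_simps smul_add_left)
  show "mS (Delta p) \<approx> smul (eps p) 1"
  proof (induction p rule: poly_mapping_linear_induct)
    case (single w c)
    have "smul c (wsum w (\<lambda>u v. word_antipode u * wmon v)) \<approx> smul c (smul (word_counit w) 1)"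
      by (intro eqv_smul antip_left)
    then show ?case
      by (simp add: mS_def single_eq_wmon Delta_simps Delta_wmon lext_smul wsum_lext tp_wmon lext_single
          smul_simps eps_simps)
  qed (simp add: mS_def Delta_simps lext_add eqv_add add)
  show "mS' (Delta p) \<approx> smul (eps p) 1"
  proof (induction p rule: poly_mapping_linear_induct)
    case (single w c)
    have "smul c (wsum w (\<lambda>u v. wmon u * word_antipode v)) \<approx> smul c (smul (word_counit w) 1)"
      by (intro eqv_smul antip_right)
    then show ?case
      by (simp add: mS'_def single_eq_wmon Delta_simps Delta_wmon lext_smul wsum_lext tp_wmon lext_single
          smul_simps eps_simps)
  qed (simp add: mS'_def Delta_simps lext_add eqv_add add)
qed (simp_all add: mS_def mS'_def lext_add lext_diff)

text \<open>
  That \<open>S\<close> preserves the ideal is clear on all relations but the Serre ones.  A Serre element \<open>s\<close>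
  is skew-primitive modulo the ideal \<open>I'\<close> of those elements of \<open>I\<close> which \<open>S\<close> maps into \<open>I\<close>, and
  applying \<open>m(S \<otimes> id)\<close> to \<open>\<Delta>(s) \<equiv> s \<otimes> 1 + g \<otimes> s\<close> shows \<open>S(s) \<in> I\<close>.
\<close>

lemma antip_ideal: "p \<in> I \<Longrightarrow> antip p \<in> I"
proof -
  define I' where "I' = {p \<in> I. antip p \<in> I}"
  have I': "two_sided I'"
    using two_sidedD[OF I] by (auto simp: two_sided_def I'_def antip_simps antip_mult)
  have in_I': "p \<in> I \<Longrightarrow> antip p \<in> I \<Longrightarrow> p \<in> I'" for p
    by (simp add: I'_def)
  have non_serre: "uq_relations q I'"
  proof unfold_locales
    show "two_sided I'" by (rule I')
    show "gn x * gn y - gn y * gn x \<in> I'" if "is_torus x" "is_torus y" for x y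
      using that by (intro in_I' torus_comm antip_torus_comm)
    show "gn (K i) * gn (K_inv i) - 1 \<in> I'" "gn (K_inv i) * gn (K i) - 1 \<in> I'"
      "gn (K' i) * gn (K'_inv i) - 1 \<in> I'" "gn (K'_inv i) * gn (K' i) - 1 \<in> I'" for i
      using inverses by (simp_all add: in_I' eqv_def antip_simps antip_mult antip_gn)
    show "gn (K i) * gn (E j) * gn (K_inv i) - smul (q i j) (gn (E j)) \<in> I'" for i j
      by (intro in_I' K_E antip_conj_E) (use K_E in \<open>simp_all add: eqv_def antip_gn\<close>)
    show "gn (K' i) * gn (E j) * gn (K'_inv i) - smul (inverse (q j i)) (gn (E j)) \<in> I'" for i j
      by (intro in_I' Kp_E antip_conj_E) (use Kp_E in \<open>simp_all add: eqv_def antip_gn\<close>)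
    show "gn (K i) * gn (F j) * gn (K_inv i) - smul (inverse (q i j)) (gn (F j)) \<in> I'" for i j
      by (intro in_I' K_F antip_conj_F) (use K_F in \<open>simp_all add: eqv_def antip_gn\<close>)
    show "gn (K' i) * gn (F j) * gn (K'_inv i) - smul (q j i) (gn (F j)) \<in> I'" for i j
      by (intro in_I' Kp_F antip_conj_F) (use Kp_F in \<open>simp_all add: eqv_def antip_gn\<close>)
    show "gn (E i) * gn (F j) - gn (F j) * gn (E i)
        - (if i = j then smul (q i i / (q i i - 1)) (gn (K i) - gn (K' i)) else 0) \<in> I'" for i j
      by (intro in_I' E_F antip_E_F)
  qed
  interpret I': uq_relations q I' by (rule non_serre)
  define mS where "mS = lext (\<lambda>(u, v). word_antipode u * wmon v :: 'i gen list \<Rightarrow>\<^sub>0 'k)"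
  define mS' where "mS' = lext (\<lambda>(u, v). wmon u * word_antipode v :: 'i gen list \<Rightarrow>\<^sub>0 'k)"
  note mS = Delta_antip[folded mS_def mS'_def]
  have mS_J: "mS t \<in> I" "mS' t \<in> I" if "t \<in> tensor_ideal I'" for t
    using that
    by (induction t) (auto simp: mS I'_def intro: two_sided_left[OF I] two_sided_right[OF I] two_sided_add[OF I])
  have "uq_rels A q \<subseteq> I'"
  proof
    fix p assume p: "p \<in> uq_rels A q"
    then have pI: "p \<in> I" using uq_rels_subset by blast
    from p show "p \<in> I'"
    proof cases
      case (serre_E i j n)
      have "I'.eqvJ (Delta p) (tp p 1 + tp (gn (K i) ^ n * gn (K j)) p)"
        unfolding serre_E(1) serre_E_eq
        by (rule I'.Delta_serre_E) (use q_not_root q_power serre_E in auto)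
      then have "mS (Delta p - (tp p 1 + tp (gn (K i) ^ n * gn (K j)) p)) \<in> I"
        unfolding I'.eqvJ_def by (rule mS_J)
      then have "mS (Delta p) - (antip p + antip (gn (K i) ^ n * gn (K j)) * p) \<in> I"
        by (simp add: mS)
      moreover have "mS (Delta p) \<in> I"
        using mS(3)[of p] pI by (simp add: eps_ideal smul_simps eqv_zero)
      moreover have "antip (gn (K i) ^ n * gn (K j)) * p \<in> I"
        using pI by (rule two_sided_left[OF I])
      ultimately have "mS (Delta p) - (mS (Delta p) - (antip p + antip (gn (K i) ^ n * gn (K j)) * p))
          - antip (gn (K i) ^ n * gn (K j)) * p \<in> I"
        by (blast intro: two_sided_diff[OF I])
      with pI show ?thesis by (simp add: I'_def)
    next
      case (serre_F i j n)
      have "I'.eqvJ (Delta p) (tp p (gn (K' i) ^ n * gn (K' j)) + tp 1 p)"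
        unfolding serre_F(1) serre_F_eq
        by (rule I'.Delta_serre_F) (use q_not_root q_power serre_F in auto)
      then have "mS' (Delta p - (tp p (gn (K' i) ^ n * gn (K' j)) + tp 1 p)) \<in> I"
        unfolding I'.eqvJ_def by (rule mS_J)
      then have "mS' (Delta p) - (p * antip (gn (K' i) ^ n * gn (K' j)) + antip p) \<in> I"
        by (simp add: mS)
      moreover have "mS' (Delta p) \<in> I"
        using mS(4)[of p] pI by (simp add: eps_ideal smul_simps eqv_zero)
      moreover have "p * antip (gn (K' i) ^ n * gn (K' j)) \<in> I"
        using pI by (rule two_sided_right[OF I])
      ultimately have "mS' (Delta p) - (mS' (Delta p) - (p * antip (gn (K' i) ^ n * gn (K' j)) + antip p))
          - p * antip (gn (K' i) ^ n * gn (K' j)) \<in> I"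
        by (blast intro: two_sided_diff[OF I])
      with pI show ?thesis by (simp add: I'_def)
    next
      case (E_F i j)
      show ?thesis unfolding E_F scal_mult by (rule I'.E_F)
    qed (use I'.torus_comm I'.inverses I'.K_E I'.Kp_E I'.K_F I'.Kp_F in
        \<open>auto simp: scal_mult I'.eqv_def\<close>)
  qed
  then have "I \<subseteq> I'" by (intro uq_ideal_minimal I')
  then show "p \<in> I \<Longrightarrow> antip p \<in> I" by (auto simp: I'_def)
qed

end

section \<open>Cosets and the ring structure of the quotient\<close>

lemma mem_uq_class: "p' \<in> uq_class A q p \<longleftrightarrow> p' - p \<in> uq_ideal A q"
  by (auto simp: uq_class_def a_r_coset_def' intro: bexI[of _ "p' - p"])

lemma uq_class_eq_iff: "uq_class A q p = uq_class A q p' \<longleftrightarrow> p - p' \<in> uq_ideal A q"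
proof
  assume "uq_class A q p = uq_class A q p'"
  then have "p \<in> uq_class A q p'"
    using mem_uq_class[of p A q p] two_sided_zero[OF two_sided_uq_ideal[of A q]] by simp
  then show "p - p' \<in> uq_ideal A q" by (simp add: mem_uq_class)
next
  assume "p - p' \<in> uq_ideal A q"
  then have "r - p \<in> uq_ideal A q \<longleftrightarrow> r - p' \<in> uq_ideal A q" for r
    using two_sided_add[OF two_sided_uq_ideal, of "r - p" A q "p - p'"]
      two_sided_diff[OF two_sided_uq_ideal, of "r - p'" A q "p - p'"] by auto
  then show "uq_class A q p = uq_class A q p'"
    by (auto simp: mem_uq_class)
qed

lemma uq_class_hom: "uq_class A q \<in> ring_hom ring_of_type_algebra (uq_ring A q)"
proof -
  have "ideal (uq_ideal A q) ring_of_type_algebra"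
    by (simp add: ideal_iff_two_sided two_sided_uq_ideal)
  then show ?thesis
    unfolding uq_ring_def uq_class_def[abs_def] by (rule ideal.rcos_ring_hom)
qed

lemma Uq_carrier: "carrier (Uq A q) = range (uq_class A q)"
  by (auto simp: Uq_def uq_ring_def FactRing_def A_RCOSETS_def' uq_class_def)

lemma Uq_class_closed [simp]: "uq_class A q p \<in> carrier (Uq A q)"
  by (simp add: Uq_carrier)

lemma Uq_mult: "uq_class A q a \<otimes>\<^bsub>Uq A q\<^esub> uq_class A q b = uq_class A q (a * b)"
  and Uq_add: "uq_class A q a \<oplus>\<^bsub>Uq A q\<^esub> uq_class A q b = uq_class A q (a + b)"
  and Uq_one: "\<one>\<^bsub>Uq A q\<^esub> = uq_class A q 1"
  using ring_hom_mult[OF uq_class_hom, of a b A q] ring_hom_add[OF uq_class_hom, of a b A q]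
    ring_hom_one[OF uq_class_hom, of A q]
  by (simp_all add: Uq_def)

lemma Uq_zero: "\<zero>\<^bsub>Uq A q\<^esub> = uq_class A q 0"
  by (auto simp: Uq_def uq_ring_def FactRing_def mem_uq_class)

lemma Uq_smult: "c \<odot>\<^bsub>Uq A q\<^esub> uq_class A q a = uq_class A q (smul c a)"
  using ring_hom_mult[OF uq_class_hom, of "scal c" a A q] by (simp add: Uq_def scal_mult)

lemmas Uq_ops = Uq_mult Uq_add Uq_one Uq_zero Uq_smult

lemma Uq_cases:
  assumes "x \<in> carrier (Uq A q)"
  obtains p where "x = uq_class A q p"
  using assms by (auto simp: Uq_carrier)

lemma coset_rep_class: "coset_rep (uq_class A q p) - p \<in> uq_ideal A q"
proof -
  have "p \<in> uq_class A q p"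
    using two_sided_zero[OF two_sided_uq_ideal] by (simp add: mem_uq_class)
  then show ?thesis
    unfolding coset_rep_def mem_uq_class[symmetric] by (rule someI)
qed

lemma class_coset_rep: "x \<in> carrier (Uq A q) \<Longrightarrow> uq_class A q (coset_rep x) = x"
  by (elim Uq_cases) (simp add: uq_class_eq_iff coset_rep_class)

lemma abelian_group_Uq: "abelian_group (Uq A q)"
proof (rule abelian_groupI)
  show "\<exists>y\<in>carrier (Uq A q). y \<oplus>\<^bsub>Uq A q\<^esub> x = \<zero>\<^bsub>Uq A q\<^esub>" if x: "x \<in> carrier (Uq A q)" for x
  proof -
    obtain p where "x = uq_class A q p" using x by (rule Uq_cases)
    then have "uq_class A q (- p) \<oplus>\<^bsub>Uq A q\<^esub> x = \<zero>\<^bsub>Uq A q\<^esub>" by (simp add: Uq_ops)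
    then show ?thesis by (intro bexI[of _ "uq_class A q (- p)"]) simp_all
  qed
qed (auto simp: Uq_ops add_ac elim!: Uq_cases)

lemma ring_Uq: "ring (Uq A q)"
  by (intro ringI abelian_group_Uq monoidI)
    (auto simp: Uq_ops mult.assoc distrib_left distrib_right elim!: Uq_cases)

lemma module_Uq: "module (ring_of_type_algebra :: 'k ring) (Uq A (q :: 'i \<Rightarrow> 'i \<Rightarrow> 'k::field))"
  by (intro moduleI cring_from_type_algebra abelian_group_Uq)
    (auto simp: Uq_ops smul_simps smul_add_left elim!: Uq_cases)

lemma lin_sum_Uq:
  assumes "\<And>x. x \<in> Poly_Mapping.keys t \<Longrightarrow> f x = uq_class A q (g x)"
  shows "lin_sum (Uq A q) f t = uq_class A q (lext g t)"
proof -
  interpret ring "Uq A q" by (rule ring_Uq)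
  have "(\<Oplus>\<^bsub>Uq A q\<^esub>x\<in>B. Poly_Mapping.lookup t x \<odot>\<^bsub>Uq A q\<^esub> f x) =
      uq_class A q (\<Sum>x\<in>B. smul (Poly_Mapping.lookup t x) (g x))"
    if "finite B" "B \<subseteq> Poly_Mapping.keys t" for B
    using that
  proof (induction B)
    case empty
    show ?case by (simp add: Uq_zero)
  next
    case (insert x B)
    have "(\<lambda>x. Poly_Mapping.lookup t x \<odot>\<^bsub>Uq A q\<^esub> f x) \<in> B \<rightarrow> carrier (Uq A q)"
      using insert.prems assms by (auto simp: Uq_smult)
    then show ?case
      using insert assms[of x] by (subst finsum_insert) (auto simp: Uq_ops)
  qed
  then show ?thesis by (simp add: lin_sum_def lext_def)
qed

text \<open>The bridge from pairs of words, where one can multiply componentwise, to the formal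
  tensors in which the coproduct of the quotient takes its values.\<close>

definition tens2 ::
  "('i \<Rightarrow> 'i \<Rightarrow> int) \<Rightarrow> ('i \<Rightarrow> 'i \<Rightarrow> 'k::field) \<Rightarrow> ('i gen list \<times> 'i gen list \<Rightarrow>\<^sub>0 'k) \<Rightarrow>
    ('i gen list \<Rightarrow>\<^sub>0 'k) set list \<Rightarrow>\<^sub>0 'k" where
  "tens2 A q = lext (\<lambda>(u, v). wmon [uq_class A q (wmon u), uq_class A q (wmon v)])"

lemma tens2_Delta: "tens2 A q (Delta p) =
    lext (\<lambda>w. wsum w (\<lambda>u v. wmon [uq_class A q (wmon u), uq_class A q (wmon v)])) p"
  by (simp add: tens2_def Delta_def lext_lext wsum_lext tp_wmon lext_single smul_one)

lemma comult_Uq: "comult (Uq A q) C = tens2 A q (Delta (coset_rep C))"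
  by (simp add: tens2_Delta) (simp add: Uq_def lin_ext_lext wsum_def)

lemma comult_Uq_lext: "comult (Uq A q) C =
    lext (\<lambda>w. wsum w (\<lambda>u v. wmon [uq_class A q (wmon u), uq_class A q (wmon v)])) (coset_rep C)"
  by (simp add: comult_Uq tens2_Delta)

lemma lext_comult_Uq: "lext f (comult (Uq A q) C) =
    lext (\<lambda>w. wsum w (\<lambda>u v. f [uq_class A q (wmon u), uq_class A q (wmon v)])) (coset_rep C)"
  by (simp add: comult_Uq_lext lext_lext wsum_lext)

lemma lin_form_comult_Uq: "lin_form f (comult (Uq A q) C) =
    lin_form (\<lambda>w. wsum w (\<lambda>u v. f [uq_class A q (wmon u), uq_class A q (wmon v)])) (coset_rep C)"
  by (simp add: comult_Uq_lext lin_form_lext wsum_lin_form)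

lemma keys_wsum: "Poly_Mapping.keys (wsum w g) \<subseteq> (\<Union>u v. Poly_Mapping.keys (g u v))"
proof -
  have "wsum w g \<in> {t. Poly_Mapping.keys t \<subseteq> (\<Union>u v. Poly_Mapping.keys (g u v))}"
    using keys_add by (intro wsum_in) fastforce+
  then show ?thesis by simp
qed

lemma keys_comult_Uq:
  fixes q :: "'i \<Rightarrow> 'i \<Rightarrow> 'k::field"
  shows "xs \<in> Poly_Mapping.keys (comult (Uq A q) C) \<Longrightarrow>
    \<exists>u v. xs = [uq_class A q (wmon u), uq_class A q (wmon v)]"
proof -
  assume "xs \<in> Poly_Mapping.keys (comult (Uq A q) C)"
  then obtain w where "xs \<in> Poly_Mapping.keys
      (wsum w (\<lambda>u v. wmon [uq_class A q (wmon u), uq_class A q (wmon v)]) :: _ \<Rightarrow>\<^sub>0 'k)"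
    unfolding comult_Uq_lext using keys_lext by fast
  then show ?thesis
    using keys_wsum by (fastforce simp: wmon_def)
qed

section \<open>The Hopf axioms for the quotient\<close>

context uq
begin

abbreviation "cls \<equiv> uq_class A q"
abbreviation "U \<equiv> Uq A q"

lemma cls_eq_iff: "cls p = cls p' \<longleftrightarrow> p \<approx> p'"
  by (simp add: uq_class_eq_iff eqv_def)

lemma eqv_lext: "(\<And>x. x \<in> Poly_Mapping.keys t \<Longrightarrow> f x \<approx> g x) \<Longrightarrow> lext f t \<approx> lext g t"
  unfolding eqv_def lext_fun_diff[symmetric] by (rule two_sided_lext[OF I])

lemma eqv_wsum: "(\<And>u v. f u v \<approx> g u v) \<Longrightarrow> wsum w f \<approx> wsum w g"
  unfolding eqv_def wsum_diff[symmetric] by (intro wsum_in two_sided_zero[OF I] two_sided_add[OF I])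

text \<open>The keys of the chosen coproduct are pairs of classes of words, so only the values of
  \<open>f\<close> on such pairs matter.\<close>

lemma lin_sum_comult:
  assumes "\<And>u v. f [cls (wmon u), cls (wmon v)] = cls (g u v)"
  shows "lin_sum U f (comult U C) = cls (lext (\<lambda>w. wsum w g) (coset_rep C))"
proof -
  define h where "h xs = coset_rep (f xs)" for xs
  have h: "h [cls (wmon u), cls (wmon v)] \<approx> g u v" for u v
    unfolding h_def assms using coset_rep_class by (simp add: eqv_def)
  have "lin_sum U f (comult U C) = cls (lext h (comult U C))"
  proof (rule lin_sum_Uq)
    fix xs assume "xs \<in> Poly_Mapping.keys (comult U C)"
    then obtain u v where "xs = [cls (wmon u), cls (wmon v)]"
      using keys_comult_Uq by blast
    then show "f xs = cls (h xs)"
      using h[of u v] by (simp add: assms cls_eq_iff eqv_sym)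
  qed
  also have "\<dots> = cls (lext (\<lambda>w. wsum w (\<lambda>u v. h [cls (wmon u), cls (wmon v)])) (coset_rep C))"
    by (simp add: lext_comult_Uq)
  also have "\<dots> = cls (lext (\<lambda>w. wsum w g) (coset_rep C))"
    unfolding cls_eq_iff by (intro eqv_lext eqv_wsum h)
  finally show ?thesis .
qed

lemma tens2_tp: "tensor_eq U (tens2 A q (tp a b)) (wmon [cls a, cls b])"
proof -
  have w: "tensor_eq U (tens2 A q (tp (wmon u) b)) (wmon [cls (wmon u), cls b])" for u
  proof (induction b rule: poly_mapping_linear_induct)
    case (single v c)
    show ?case
      using tensor_eq_sym[OF tensor_eq_pair_smult(2)[of "cls (wmon v)" U "cls (wmon u)" c]]
      by (simp add: single_eq_wmon tp_simps tp_wmon tens2_def lext_smul lext_single smul_simps Uq_smult)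
  next
    case (add s t)
    have "tensor_eq U (wmon [cls (wmon u), cls s] + wmon [cls (wmon u), cls t]) (wmon [cls (wmon u), cls (s + t)])"
      using tensor_eq_sym[OF tensor_eq_pair_add(2)[of "cls s" U "cls t" "cls (wmon u)"]]
      by (simp add: Uq_add)
    then show ?case
      using tensor_eq_trans[OF tensor_eq_add[OF add.IH]] by (simp add: tp_simps tens2_def lext_add)
  qed
  show ?thesis
  proof (induction a rule: poly_mapping_linear_induct)
    case (single u c)
    have "tensor_eq U (smul c (wmon [cls (wmon u), cls b])) (wmon [cls (smul c (wmon u)), cls b])"
      using tensor_eq_sym[OF tensor_eq_pair_smult(1)[of "cls (wmon u)" U "cls b" c]]
      by (simp add: Uq_smult)
    then show ?case
      using tensor_eq_trans[OF tensor_eq_smul[OF w]]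
      by (simp add: single_eq_wmon tp_simps tens2_def lext_smul)
  next
    case (add s t)
    have "tensor_eq U (wmon [cls s, cls b] + wmon [cls t, cls b]) (wmon [cls (s + t), cls b])"
      using tensor_eq_sym[OF tensor_eq_pair_add(1)[of "cls s" U "cls t" "cls b"]]
      by (simp add: Uq_add)
    then show ?case
      using tensor_eq_trans[OF tensor_eq_add[OF add.IH]] by (simp add: tp_simps tens2_def lext_add)
  qed
qed

lemma tens2_ideal: "t \<in> J \<Longrightarrow> tensor_eq U (tens2 A q t) 0"
proof (induction t rule: tensor_ideal.induct)
  case (left a b)
  \<comment> \<open>Writing the zero class as a multiple by the scalar 0 lets the scaling relation
    of formal tensors remove the whole pair.\<close>
  then have "cls a = 0 \<odot>\<^bsub>U\<^esub> cls 0"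
    by (simp add: Uq_smult cls_eq_iff eqv_zero smul_simps)
  then show ?case
    using tensor_eq_trans[OF tens2_tp[of a b]] tensor_eq_pair_smult(1)[of "cls 0" U "cls b" 0]
    by (simp add: smul_simps)
next
  case (right b a)
  then have "cls b = 0 \<odot>\<^bsub>U\<^esub> cls 0"
    by (simp add: Uq_smult cls_eq_iff eqv_zero smul_simps)
  then show ?case
    using tensor_eq_trans[OF tens2_tp[of a b]] tensor_eq_pair_smult(2)[of "cls 0" U "cls a" 0]
    by (simp add: smul_simps)
next
  case (add s t)
  then show ?case
    using tensor_eq_add[of U "tens2 A q s" 0 "tens2 A q t" 0] by (simp add: tens2_def lext_add)
qed

lemma tens2_eqv: "s \<approx>\<^sub>J t \<Longrightarrow> tensor_eq U (tens2 A q s) (tens2 A q t)"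
  using tens2_ideal[of "s - t"] by (simp add: eqvJ_def tensor_eq_def tens2_def lext_diff)

text \<open>Independence of the representative, up to \<open>tensor_eq\<close>; it comes from
  \<open>Delta_ideal\<close>.\<close>

lemma comult_class: "tensor_eq U (comult U (cls p)) (tens2 A q (Delta p))"
  unfolding comult_Uq
  by (rule tens2_eqv) (use Delta_ideal[OF coset_rep_class] in \<open>simp add: eqvJ_def Delta_simps\<close>)

lemma counit_class: "counit U (cls p) = eps p"
  using eps_ideal[OF coset_rep_class[of A q p]] by (simp add: Uq_def eps_def lin_form_diff)

lemma antipode_class: "antipode U (cls p) = cls (antip p)"
  using antip_ideal[OF coset_rep_class[of A q p]]
  by (simp add: Uq_def lin_ext_lext cls_eq_iff eqv_def antip_def lext_diff)

lemma comult_mult_class: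
  "lext (\<lambda>xs. lext (\<lambda>ys. wmon [xs ! 0 \<otimes>\<^bsub>U\<^esub> ys ! 0, xs ! 1 \<otimes>\<^bsub>U\<^esub> ys ! 1]) (comult U y)) (comult U x)
    = tens2 A q (Delta (coset_rep x) * Delta (coset_rep y))"
proof -
  have "tens2 A q (Delta p * Delta p') = lext (\<lambda>w. wsum w (\<lambda>u v. lext (\<lambda>w'. wsum w' (\<lambda>u' v'.
      wmon [cls (wmon u * wmon u'), cls (wmon v * wmon v')])) p')) p" for p p'
  proof (induction p rule: poly_mapping_linear_induct)
    case (single w c)
    have w: "tens2 A q (Delta (wmon w) * Delta p') = wsum w (\<lambda>u v. lext (\<lambda>w'. wsum w' (\<lambda>u' v'.
      wmon [cls (wmon u * wmon u'), cls (wmon v * wmon v')])) p')"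
    proof (induction p' rule: poly_mapping_linear_induct)
      case (single w' c')
      have "tens2 A q (Delta (wmon w) * Delta (wmon w')) = wsum w (\<lambda>u v. wsum w' (\<lambda>u' v'.
          wmon [cls (wmon u * wmon u'), cls (wmon v * wmon v')]))"
        unfolding Delta_wmon wsum_mult_right unfolding wsum_mult_left
        by (simp add: tens2_def wsum_lext tp_mult flip: wmon_append) (simp add: tp_wmon lext_single smul_one)
      then show ?case
        by (simp add: single_eq_wmon Delta_simps smul_simps tens2_def lext_smul flip: wsum_smul)
    qed (simp add: Delta_simps distrib_left tens2_def lext_add wsum_add)
    then show ?case
      by (simp add: single_eq_wmon Delta_simps smul_simps tens2_def lext_smul)
  qed (simp add: Delta_simps distrib_right tens2_def lext_add)
  then show ?thesis
    by (simp add: lext_comult_Uq Uq_mult)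
qed

text \<open>The counit and antipode laws are equalities in the quotient and are checked on the
  chosen representative. The laws that compare coproducts hold up to \<open>tensor_eq\<close> and go
  through pairs of words.\<close>

theorem hopf_algebra_Uq: "hopf_algebra U"
proof (intro hopf_algebra.intro ring_Uq module_Uq hopf_algebra_axioms.intro, unfold lin_ext_lext scal_mult)
  fix x y c xs
  assume x: "x \<in> carrier U"
  then obtain p where p: "x = cls p" by (rule Uq_cases)
  show "counit U (c \<odot>\<^bsub>U\<^esub> x) = c * counit U x"
    by (simp add: p Uq_ops counit_class eps_simps)
  show "antipode U x \<in> carrier U" "antipode U (c \<odot>\<^bsub>U\<^esub> x) = c \<odot>\<^bsub>U\<^esub> antipode U x"
    by (simp_all add: p Uq_ops antipode_class antip_simps)
  show "length xs = 2 \<and> set xs \<subseteq> carrier U" if "xs \<in> Poly_Mapping.keys (comult U x)"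
    using keys_comult_Uq[OF that] by auto
  have "Delta (coset_rep (c \<odot>\<^bsub>U\<^esub> x)) \<approx>\<^sub>J Delta (smul c (coset_rep x))"
    unfolding eqvJ_def Delta_simps(2)[symmetric]
    by (rule Delta_ideal)
      (use x in \<open>simp add: class_coset_rep module.smult_closed[OF module_Uq] flip: eqv_def cls_eq_iff Uq_smult\<close>)
  then show "tensor_eq U (comult U (c \<odot>\<^bsub>U\<^esub> x)) (smul c (comult U x))"
    unfolding comult_Uq using tens2_eqv by (fastforce simp: Delta_simps tens2_def lext_smul)
  show "tensor_eq U (lext (\<lambda>xs. comult U (xs ! 0) * wmon [xs ! 1]) (comult U x))
      (lext (\<lambda>xs. wmon [xs ! 0] * comult U (xs ! 1)) (comult U x))"
  proof -
    have "tensor_eq U (lext (\<lambda>xs. comult U (xs ! 0) * wmon [xs ! 1]) (comult U x))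
        (lext (\<lambda>w. wsum w (\<lambda>u v. tens2 A q (Delta (wmon u)) * wmon [cls (wmon v)])) (coset_rep x))"
      unfolding lext_comult_Uq by (intro tensor_eq_lext tensor_eq_wsum) (simp add: tensor_eq_append_right comult_class)
    also have "(\<lambda>w. wsum w (\<lambda>u v. tens2 A q (Delta (wmon u)) * wmon [cls (wmon v)])) =
        (\<lambda>w. wsum w (\<lambda>u v. wmon [cls (wmon u)] * tens2 A q (Delta (wmon v))))"
      by (intro ext) (simp add: tens2_Delta wsum_mult_left wsum_mult_right flip: wmon_append,
        rule wsum_coassoc)
    also have "tensor_eq U (lext \<dots> (coset_rep x))
        (lext (\<lambda>xs. wmon [xs ! 0] * comult U (xs ! 1)) (comult U x))"
      unfolding lext_comult_Uq
      by (intro tensor_eq_lext tensor_eq_wsum) (simp add: tensor_eq_append_left tensor_eq_sym[OF comult_class])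
    finally show ?thesis .
  qed
  have "lin_sum U (\<lambda>xs. counit U (xs ! 0) \<odot>\<^bsub>U\<^esub> xs ! 1) (comult U x) =
      cls (lext (\<lambda>w. wsum w (\<lambda>u v. if torus_word u then wmon v else 0)) (coset_rep x))"
    by (rule lin_sum_comult) (simp add: counit_class Uq_ops eps_simps word_counit_eq smul_simps)
  then show "lin_sum U (\<lambda>xs. counit U (xs ! 0) \<odot>\<^bsub>U\<^esub> xs ! 1) (comult U x) = x"
    using x by (simp add: wsum_left_torus lext_wmon_id class_coset_rep)
  have "lin_sum U (\<lambda>xs. counit U (xs ! 1) \<odot>\<^bsub>U\<^esub> xs ! 0) (comult U x) =
      cls (lext (\<lambda>w. wsum w (\<lambda>u v. if torus_word v then wmon u else 0)) (coset_rep x))"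
    by (rule lin_sum_comult) (simp add: counit_class Uq_ops eps_simps word_counit_eq smul_simps)
  then show "lin_sum U (\<lambda>xs. counit U (xs ! 1) \<odot>\<^bsub>U\<^esub> xs ! 0) (comult U x) = x"
    using x by (simp add: wsum_right_torus lext_wmon_id class_coset_rep)
  have eps: "counit U x \<odot>\<^bsub>U\<^esub> \<one>\<^bsub>U\<^esub> = cls (lext (\<lambda>w. smul (word_counit w) 1) (coset_rep x))"
    using counit_class[of "coset_rep x"] x
    by (simp add: Uq_ops class_coset_rep lext_fun_lin_form flip: eps_def)
  have "lin_sum U (\<lambda>xs. antipode U (xs ! 0) \<otimes>\<^bsub>U\<^esub> xs ! 1) (comult U x) =
      cls (lext (\<lambda>w. wsum w (\<lambda>u v. word_antipode u * wmon v)) (coset_rep x))"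
    by (rule lin_sum_comult) (simp add: antipode_class Uq_ops antip_wmon)
  also have "\<dots> = cls (lext (\<lambda>w. smul (word_counit w) 1) (coset_rep x))"
    unfolding cls_eq_iff by (intro eqv_lext antip_left)
  finally show "lin_sum U (\<lambda>xs. antipode U (xs ! 0) \<otimes>\<^bsub>U\<^esub> xs ! 1) (comult U x) = counit U x \<odot>\<^bsub>U\<^esub> \<one>\<^bsub>U\<^esub>"
    by (simp only: eps)
  have "lin_sum U (\<lambda>xs. xs ! 0 \<otimes>\<^bsub>U\<^esub> antipode U (xs ! 1)) (comult U x) =
      cls (lext (\<lambda>w. wsum w (\<lambda>u v. wmon u * word_antipode v)) (coset_rep x))"
    by (rule lin_sum_comult) (simp add: antipode_class Uq_ops antip_wmon)
  also have "\<dots> = cls (lext (\<lambda>w. smul (word_counit w) 1) (coset_rep x))"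
    unfolding cls_eq_iff by (intro eqv_lext antip_right)
  finally show "lin_sum U (\<lambda>xs. xs ! 0 \<otimes>\<^bsub>U\<^esub> antipode U (xs ! 1)) (comult U x) = counit U x \<odot>\<^bsub>U\<^esub> \<one>\<^bsub>U\<^esub>"
    by (simp only: eps)
  assume y: "y \<in> carrier U"
  then obtain p' where p': "y = cls p'" by (rule Uq_cases)
  show "(c \<odot>\<^bsub>U\<^esub> x) \<otimes>\<^bsub>U\<^esub> y = c \<odot>\<^bsub>U\<^esub> (x \<otimes>\<^bsub>U\<^esub> y)" "x \<otimes>\<^bsub>U\<^esub> (c \<odot>\<^bsub>U\<^esub> y) = c \<odot>\<^bsub>U\<^esub> (x \<otimes>\<^bsub>U\<^esub> y)"
    by (simp_all add: p p' Uq_ops smul_simps)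
  show "counit U (x \<oplus>\<^bsub>U\<^esub> y) = counit U x + counit U y" "counit U (x \<otimes>\<^bsub>U\<^esub> y) = counit U x * counit U y"
    by (simp_all add: p p' Uq_ops counit_class eps_simps)
  show "antipode U (x \<oplus>\<^bsub>U\<^esub> y) = antipode U x \<oplus>\<^bsub>U\<^esub> antipode U y"
    by (simp add: p p' Uq_ops antipode_class antip_simps)
  have "Delta (coset_rep (x \<oplus>\<^bsub>U\<^esub> y)) \<approx>\<^sub>J Delta (coset_rep x + coset_rep y)"
    unfolding eqvJ_def Delta_simps(2)[symmetric]
    by (rule Delta_ideal)
      (use x y in \<open>simp add: class_coset_rep ring.ring_simprules[OF ring_Uq] flip: eqv_def cls_eq_iff Uq_add\<close>)
  then show "tensor_eq U (comult U (x \<oplus>\<^bsub>U\<^esub> y)) (comult U x + comult U y)"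
    unfolding comult_Uq using tens2_eqv by (fastforce simp: Delta_simps tens2_def lext_add)
  have "Delta (coset_rep (x \<otimes>\<^bsub>U\<^esub> y)) \<approx>\<^sub>J Delta (coset_rep x * coset_rep y)"
    unfolding eqvJ_def Delta_simps(2)[symmetric]
    by (rule Delta_ideal)
      (use x y in \<open>simp add: class_coset_rep ring.ring_simprules[OF ring_Uq] flip: eqv_def cls_eq_iff Uq_mult\<close>)
  then show "tensor_eq U (comult U (x \<otimes>\<^bsub>U\<^esub> y))
      (lext (\<lambda>xs. lext (\<lambda>ys. wmon [xs ! 0 \<otimes>\<^bsub>U\<^esub> ys ! 0, xs ! 1 \<otimes>\<^bsub>U\<^esub> ys ! 1]) (comult U y)) (comult U x))"
    unfolding comult_mult_class unfolding comult_Uq Delta_mult by (rule tens2_eqv)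
next
  show "tensor_eq U (comult U \<one>\<^bsub>U\<^esub>) (wmon [\<one>\<^bsub>U\<^esub>, \<one>\<^bsub>U\<^esub>])"
    using comult_class[of 1] by (simp add: Uq_ops tens2_def lext_single Delta_wmon tp_wmon smul_one flip: wmon_Nil)
  show "counit U \<one>\<^bsub>U\<^esub> = 1"
    by (simp add: Uq_ops counit_class eps_one)
qed

end

section \<open>Multilinear maps and iterated coproducts\<close>

text \<open>Multilinearity makes a Sweedler sum depend only on the tensor and not on the formal
  combination denoting it. Stating it by list update lets the entries be computed for a concrete
  length.\<close>

definition multilin :: "('k::field, 'h, 'z) module_scheme \<Rightarrow> nat \<Rightarrow> ('h list \<Rightarrow> 'h) \<Rightarrow> bool" where
  "multilin H n f \<longleftrightarrow>
     (\<forall>xs. length xs = n \<longrightarrow> set xs \<subseteq> carrier H \<longrightarrow> f xs \<in> carrier H) \<and>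
     (\<forall>xs i x y c. length xs = n \<longrightarrow> set xs \<subseteq> carrier H \<longrightarrow> i < n \<longrightarrow> x \<in> carrier H \<longrightarrow> y \<in> carrier H \<longrightarrow>
        f (xs[i := x \<oplus>\<^bsub>H\<^esub> y]) = f (xs[i := x]) \<oplus>\<^bsub>H\<^esub> f (xs[i := y]) \<and>
        f (xs[i := c \<odot>\<^bsub>H\<^esub> x]) = c \<odot>\<^bsub>H\<^esub> f (xs[i := x]))"

lemma multilinD:
  assumes "multilin H n f" "length us + length vs + 1 = n" "set us \<subseteq> carrier H" "set vs \<subseteq> carrier H"
    "x \<in> carrier H" "y \<in> carrier H"
  shows "f (us @ [x \<oplus>\<^bsub>H\<^esub> y] @ vs) = f (us @ [x] @ vs) \<oplus>\<^bsub>H\<^esub> f (us @ [y] @ vs)"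
    and "f (us @ [c \<odot>\<^bsub>H\<^esub> x] @ vs) = c \<odot>\<^bsub>H\<^esub> f (us @ [x] @ vs)"
    and "f (us @ [x] @ vs) \<in> carrier H"
proof -
  have upd: "(us @ [x] @ vs)[length us := z] = us @ [z] @ vs" for z
    by (simp add: list_update_append)
  note ml = assms(1)[unfolded multilin_def, THEN conjunct2, rule_format,
      of "us @ [x] @ vs" "length us" x y c, unfolded upd]
  show "f (us @ [x \<oplus>\<^bsub>H\<^esub> y] @ vs) = f (us @ [x] @ vs) \<oplus>\<^bsub>H\<^esub> f (us @ [y] @ vs)"
    and "f (us @ [c \<odot>\<^bsub>H\<^esub> x] @ vs) = c \<odot>\<^bsub>H\<^esub> f (us @ [x] @ vs)"
    using ml assms by simp_all
  show "f (us @ [x] @ vs) \<in> carrier H"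
    using assms unfolding multilin_def by simp
qed

text \<open>Every step splits the head of the list, in parallel with
  \<open>comult_pow\<close>.\<close>

primrec wpow :: "nat \<Rightarrow> 'i gen list \<Rightarrow> ('i gen list list \<Rightarrow> 'b) \<Rightarrow> 'b::comm_monoid_add" where
  "wpow 0 w g = g [w]"
| "wpow (Suc n) w g = wpow n w (\<lambda>ws. wsum (hd ws) (\<lambda>u v. g (u # v # tl ws)))"

lemma lext_wpow: "lext f (wpow n w g) = wpow n w (\<lambda>ws. lext f (g ws))"
  by (induction n arbitrary: g) (simp_all add: wsum_lext)

lemma tensor_eq_wpow:
  assumes "\<And>ws. length ws = Suc n \<Longrightarrow> tensor_eq H (f ws) (g ws)"
  shows "tensor_eq H (wpow n w f) (wpow n w g)"
  using assms
proof (induction n arbitrary: f g)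
  case (Suc n)
  show ?case
    unfolding wpow.simps by (rule Suc.IH) (intro tensor_eq_wsum Suc.prems, simp)
qed simp

lemma tensor_eq_mult_left:
  assumes "\<And>ys. ys \<in> Poly_Mapping.keys r \<Longrightarrow> set ys \<subseteq> carrier H" "tensor_eq H s t"
  shows "tensor_eq H (r * s) (r * t)"
proof -
  have "tensor_eq H (lext (\<lambda>ys. wmon ys * s) r) (lext (\<lambda>ys. wmon ys * t) r)"
    by (intro tensor_eq_lext tensor_eq_append_left assms)
  then show ?thesis by (simp add: lext_fun_mult_right lext_wmon_id)
qed

section \<open>Sweedler sums do not depend on the formal combination\<close>

context uq
begin

lemma tensor_eq_comult_mult:
  "tensor_eq U s t \<Longrightarrow> tensor_eq U (comult U x * s) (comult U x * t)"
  using keys_comult_Uq by (intro tensor_eq_mult_left) fastforce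

lemma comult_eq:
  assumes "x \<in> carrier U" "y \<in> carrier U"
  shows "tensor_eq U (comult U (x \<oplus>\<^bsub>U\<^esub> y)) (comult U x + comult U y)"
    and "tensor_eq U (comult U (c \<odot>\<^bsub>U\<^esub> x)) (smul c (comult U x))"
  using hopf_algebra.comult_add[OF hopf_algebra_Uq] hopf_algebra.comult_smult[OF hopf_algebra_Uq] assms
  by (simp_all add: scal_mult)

lemma lin_sum_carrier:
  assumes "\<And>x. x \<in> Poly_Mapping.keys t \<Longrightarrow> f x \<in> carrier U"
  shows "lin_sum U f t = cls (lext (\<lambda>x. coset_rep (f x)) t)"
  by (rule lin_sum_Uq) (simp add: assms class_coset_rep)

lemma lin_sum_closed:
  assumes "\<And>x. x \<in> Poly_Mapping.keys t \<Longrightarrow> f x \<in> carrier U"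
  shows "lin_sum U f t \<in> carrier U"
  using assms by (simp add: lin_sum_carrier)

lemma lin_sum_fun_add:
  assumes "\<And>x. x \<in> Poly_Mapping.keys t \<Longrightarrow> f x \<in> carrier U" "\<And>x. x \<in> Poly_Mapping.keys t \<Longrightarrow> g x \<in> carrier U"
  shows "lin_sum U (\<lambda>x. f x \<oplus>\<^bsub>U\<^esub> g x) t = lin_sum U f t \<oplus>\<^bsub>U\<^esub> lin_sum U g t"
proof -
  have "lin_sum U (\<lambda>x. f x \<oplus>\<^bsub>U\<^esub> g x) t = cls (lext (\<lambda>x. coset_rep (f x) + coset_rep (g x)) t)"
    by (rule lin_sum_Uq) (simp add: assms class_coset_rep flip: Uq_add)
  then show ?thesis using assms by (simp add: lin_sum_carrier Uq_add lext_fun_add)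
qed

lemma lin_sum_fun_smult:
  assumes "\<And>x. x \<in> Poly_Mapping.keys t \<Longrightarrow> f x \<in> carrier U"
  shows "lin_sum U (\<lambda>x. c \<odot>\<^bsub>U\<^esub> f x) t = c \<odot>\<^bsub>U\<^esub> lin_sum U f t"
proof -
  have "lin_sum U (\<lambda>x. c \<odot>\<^bsub>U\<^esub> f x) t = cls (lext (\<lambda>x. smul c (coset_rep (f x))) t)"
    by (rule lin_sum_Uq) (simp add: assms class_coset_rep flip: Uq_smult)
  then show ?thesis using assms by (simp add: lin_sum_carrier Uq_smult lext_fun_smul)
qed

lemma lin_sum_cong: "(\<And>x. x \<in> Poly_Mapping.keys t \<Longrightarrow> f x = g x) \<Longrightarrow>
    (\<And>x. x \<in> Poly_Mapping.keys t \<Longrightarrow> g x \<in> carrier U) \<Longrightarrow> lin_sum U f t = lin_sum U g t"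
  by (simp add: lin_sum_carrier cong: lext_cong)

lemma lin_sum_tensor_eq:
  assumes ml: "multilin U n f" and st: "tensor_eq U s t"
    and s: "\<And>xs. xs \<in> Poly_Mapping.keys s \<Longrightarrow> length xs = n \<and> set xs \<subseteq> carrier U"
    and t: "\<And>xs. xs \<in> Poly_Mapping.keys t \<Longrightarrow> length xs = n \<and> set xs \<subseteq> carrier U"
  shows "lin_sum U f s = lin_sum U f t"
proof -
  \<comment> \<open>The relations involve lists of every length, while \<open>f\<close> is
    multilinear only at length \<open>n\<close>; all other lists are sent to 0.\<close>
  define g where "g xs = (if length xs = n then coset_rep (f xs) else 0)" for xs
  have g: "cls (g xs) = f xs" if "length xs = n" "set xs \<subseteq> carrier U" for xs
    using that ml by (simp add: g_def class_coset_rep multilin_def)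
  have "lext g (s - t) \<in> I"
    using st unfolding tensor_eq_def
  proof (induction rule: free_space.span_induct_alt)
    case base
    show ?case using two_sided_zero[OF I] by simp
  next
    case (step c r r')
    have "lext g r \<in> I"
      using step(1)
    proof cases
      case (add x y us vs)
      show ?thesis
      proof (cases "length us + length vs + 1 = n")
        case True
        have "cls (g (us @ [x \<oplus>\<^bsub>U\<^esub> y] @ vs)) = cls (g (us @ [x] @ vs) + g (us @ [y] @ vs))"
          unfolding Uq_add[symmetric] using True add multilinD[OF ml True, of x y]
          by (subst (1 2 3) g) (auto simp: ring.ring_simprules[OF ring_Uq])
        then show ?thesis
          by (simp add: add(1) lext_diff cls_eq_iff eqv_def diff_diff_eq lext_add)
      qed (simp add: add(1) lext_diff g_def two_sided_zero[OF I])
    next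
      case (smult x us vs d)
      show ?thesis
      proof (cases "length us + length vs + 1 = n")
        case True
        have "cls (g (us @ [d \<odot>\<^bsub>U\<^esub> x] @ vs)) = cls (smul d (g (us @ [x] @ vs)))"
          unfolding Uq_smult[symmetric] using True smult multilinD[OF ml True, of x x]
          by (subst (1 2) g) (auto simp: module.smult_closed[OF module_Uq])
        then show ?thesis
          by (simp add: smult(1) lext_diff scal_mult lext_smul cls_eq_iff eqv_def)
      qed (simp add: smult(1) lext_diff scal_mult lext_smul g_def smul_simps two_sided_zero[OF I])
    qed
    then have "smul c (lext g r) + lext g r' \<in> I"
      using step by (intro two_sided_add[OF I] two_sided_smul[OF I])
    then show ?case by (simp add: lext_add lext_smul scal_mult)
  qed
  then have "cls (lext g s) = cls (lext g t)"
    by (simp add: cls_eq_iff eqv_def lext_diff)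
  moreover have "lin_sum U f s = cls (lext g s)" "lin_sum U f t = cls (lext g t)"
    using s t g by (auto intro!: lin_sum_Uq)
  ultimately show ?thesis by simp
qed

text \<open>A scalar-valued function is made algebra-valued by multiplying the unit with it, and the
  counit recovers its values.\<close>

lemma lin_form_tensor_eq:
  assumes ml: "multilin U n (\<lambda>xs. f xs \<odot>\<^bsub>U\<^esub> \<one>\<^bsub>U\<^esub>)" and st: "tensor_eq U s t"
    and s: "\<And>xs. xs \<in> Poly_Mapping.keys s \<Longrightarrow> length xs = n \<and> set xs \<subseteq> carrier U"
    and t: "\<And>xs. xs \<in> Poly_Mapping.keys t \<Longrightarrow> length xs = n \<and> set xs \<subseteq> carrier U"
  shows "lin_form f s = lin_form f t"
proof -
  have "counit U (lin_sum U (\<lambda>xs. f xs \<odot>\<^bsub>U\<^esub> \<one>\<^bsub>U\<^esub>) t) = lin_form f t" for t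
    by (subst lin_sum_Uq[of t _ _ _ "\<lambda>xs. smul (f xs) 1"])
      (simp_all add: Uq_ops counit_class lext_fun_lin_form eps_simps eps_one)
  then show ?thesis
    using lin_sum_tensor_eq[OF assms] by metis
qed

section \<open>Iterated coproducts of classes\<close>

abbreviation "clsw w \<equiv> cls (wmon w)"

definition tensor_pow :: "nat \<Rightarrow> ('i gen list \<Rightarrow>\<^sub>0 'k) \<Rightarrow> ('i gen list \<Rightarrow>\<^sub>0 'k) set list \<Rightarrow>\<^sub>0 'k" where
  "tensor_pow n = lext (\<lambda>w. wpow n w (\<lambda>ws. wmon (map clsw ws)))"

lemma comult_pow_class: "tensor_eq U (comult_pow U n (cls p)) (tensor_pow n p)"
proof (induction n)
  case 0
  have "tensor_eq U (wmon [cls p]) (lext (\<lambda>w. wmon [clsw w]) p)"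
  proof (induction p rule: poly_mapping_linear_induct)
    case (single w c)
    have "wmon [c \<odot>\<^bsub>U\<^esub> clsw w] - scal c * wmon [clsw w] \<in> multilin_rels U"
      using multilin_rels.smult[of "clsw w" U "[]" "[]" c] by simp
    from free_space.span_base[OF this] show ?case
      by (simp add: single_eq_wmon lext_smul Uq_smult tensor_eq_def scal_mult)
  next
    case (add s t)
    have "wmon [cls s \<oplus>\<^bsub>U\<^esub> cls t] - wmon [cls s] - wmon [cls t] \<in> multilin_rels U"
      using multilin_rels.add[of "cls s" U "cls t" "[]" "[]"] by simp
    from free_space.span_base[OF this]
    have "tensor_eq U (wmon [cls (s + t)]) (wmon [cls s] + wmon [cls t])"
      by (simp add: Uq_add tensor_eq_def diff_diff_eq)
    with tensor_eq_add[OF add] show ?case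
      using tensor_eq_trans by (fastforce simp: lext_add)
  qed
  then show ?case by (simp add: tensor_pow_def)
next
  case (Suc n)
  define f where "f xs = comult U (hd xs) * wmon (tl xs)" for xs
  have "tensor_eq U (lext f (comult_pow U n (cls p))) (lext f (tensor_pow n p))"
  proof (rule tensor_eq_map[OF _ _ _ Suc.IH])
    fix t assume "t \<in> multilin_rels U"
    then have "tensor_eq U (lext f t) 0"
    proof cases
      case (add x y us vs)
      \<comment> \<open>A relation in the head position is absorbed by the additivity of
        \<open>comult\<close>; one further back is only multiplied by a coproduct on the
        left.\<close>
      have "tensor_eq U (f (us @ [x \<oplus>\<^bsub>U\<^esub> y] @ vs)) (f (us @ [x] @ vs) + f (us @ [y] @ vs))"
      proof (cases us)
        case Nil
        show ?thesis
          using tensor_eq_append_right[OF _ comult_eq(1)] add by (simp add: f_def Nil distrib_right)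
      next
        case (Cons u us')
        have "tensor_eq U (wmon (us' @ [x \<oplus>\<^bsub>U\<^esub> y] @ vs)) (wmon (us' @ [x] @ vs) + wmon (us' @ [y] @ vs))"
          using multilin_rels.add[of x U y us' vs] add Cons
          by (simp add: tensor_eq_def diff_diff_eq free_space.span_base)
        then show ?thesis
          using tensor_eq_comult_mult[of _ _ u] by (fastforce simp: f_def Cons distrib_left)
      qed
      then show ?thesis by (simp add: add(1) lext_diff lext_add tensor_eq_def diff_diff_eq)
    next
      case (smult x us vs d)
      have "tensor_eq U (f (us @ [d \<odot>\<^bsub>U\<^esub> x] @ vs)) (smul d (f (us @ [x] @ vs)))"
      proof (cases us)
        case Nil
        show ?thesis
          using tensor_eq_append_right[OF _ comult_eq(2)] smult by (simp add: f_def Nil smul_simps)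
      next
        case (Cons u us')
        have "tensor_eq U (wmon (us' @ [d \<odot>\<^bsub>U\<^esub> x] @ vs)) (smul d (wmon (us' @ [x] @ vs)))"
          using free_space.span_base[OF multilin_rels.smult[of x U us' vs d]] smult Cons
          by (simp add: tensor_eq_def scal_mult)
        then show ?thesis
          using tensor_eq_comult_mult[of _ _ u] by (fastforce simp: f_def Cons smul_simps)
      qed
      then show ?thesis by (simp add: smult(1) lext_diff scal_mult lext_smul tensor_eq_def)
    qed
    then show "lext f t \<in> free_space.span (multilin_rels U)" by (simp add: tensor_eq_def)
  qed (simp_all add: lext_add lext_smul)
  also have "lext f (tensor_pow n p) = lext (\<lambda>w. wpow n w (\<lambda>ws. f (map clsw ws))) p"
    by (simp add: tensor_pow_def lext_lext lext_wpow)
  also have "tensor_eq U \<dots> (tensor_pow (Suc n) p)"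
    unfolding tensor_pow_def wpow.simps
  proof (intro tensor_eq_lext tensor_eq_wpow)
    fix ws :: "'i gen list list" assume "length ws = Suc n"
    then obtain w ws' where ws: "ws = w # ws'" by (cases ws) auto
    have "tensor_eq U (f (map clsw ws)) (tens2 A q (Delta (wmon w)) * wmon (map clsw ws'))"
      unfolding f_def ws by (simp, intro tensor_eq_append_right comult_class) auto
    then show "tensor_eq U (f (map clsw ws)) (wsum (hd ws) (\<lambda>u v. wmon (map clsw (u # v # tl ws))))"
      by (simp add: ws tens2_Delta wsum_mult_right flip: wmon_append)
  qed
  finally show ?case by (simp add: f_def lin_ext_lext)
qed

lemma keys_comult_pow:
  assumes "x \<in> carrier U" "xs \<in> Poly_Mapping.keys (comult_pow U n x)"
  shows "length xs = Suc n \<and> set xs \<subseteq> carrier U"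
  using assms(2)
proof (induction n arbitrary: xs)
  case 0
  then show ?case using assms(1) by (simp add: wmon_def)
next
  case (Suc n)
  from Suc.prems obtain ys where ys: "ys \<in> Poly_Mapping.keys (comult_pow U n x)"
    and "xs \<in> Poly_Mapping.keys (comult U (hd ys) * wmon (tl ys))"
    using keys_lext unfolding comult_pow.simps lin_ext_lext by fast
  then obtain zs where "zs \<in> Poly_Mapping.keys (comult U (hd ys))" "xs = zs @ tl ys"
    using keys_mult by (fastforce simp: wmon_def plus_list_def)
  then show ?case
    using Suc.IH[OF ys] keys_comult_Uq[of zs A q "hd ys"] by (cases ys) auto
qed

lemma keys_tensor_pow:
  assumes "xs \<in> Poly_Mapping.keys (tensor_pow n p)"
  shows "length xs = Suc n \<and> set xs \<subseteq> carrier U"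
proof -
  have "Poly_Mapping.keys (wpow n w g) \<subseteq> (\<Union>ws\<in>{ws. length ws = Suc n}. Poly_Mapping.keys (g ws))"
    for w :: "'i gen list" and g :: "_ \<Rightarrow> ('i gen list \<Rightarrow>\<^sub>0 'k) set list \<Rightarrow>\<^sub>0 'k"
  proof (induction n arbitrary: g)
    case (Suc n)
    show ?case
    proof
      fix k assume "k \<in> Poly_Mapping.keys (wpow (Suc n) w g)"
      then obtain ws where "length ws = Suc n"
        "k \<in> Poly_Mapping.keys (wsum (hd ws) (\<lambda>u v. g (u # v # tl ws)))"
        using Suc by fastforce
      moreover from this obtain u v where "k \<in> Poly_Mapping.keys (g (u # v # tl ws))"
        using keys_wsum by fastforce
      ultimately show "k \<in> (\<Union>ws\<in>{ws. length ws = Suc (Suc n)}. Poly_Mapping.keys (g ws))"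
        by (intro UN_I[of "u # v # tl ws"]) auto
    qed
  next
    case 0
    show ?case unfolding wpow.simps by (rule UN_upper) simp
  qed
  then obtain ws where "length ws = Suc n" "xs \<in> Poly_Mapping.keys (wmon (map clsw ws) :: _ \<Rightarrow>\<^sub>0 'k)"
    using assms keys_lext unfolding tensor_pow_def by fast
  then show ?thesis by (auto simp: wmon_def)
qed

lemma lin_sum_comult_pow:
  assumes "multilin U (Suc n) f"
  shows "lin_sum U f (comult_pow U n (cls p)) = lin_sum U f (tensor_pow n p)"
  by (rule lin_sum_tensor_eq[OF assms comult_pow_class keys_comult_pow keys_tensor_pow])
    (rule Uq_class_closed)

lemma lin_sum_tensor_pow:
  assumes "\<And>ws. length ws = Suc n \<Longrightarrow> f (map clsw ws) = cls (g ws)"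
    and "multilin U (Suc n) f"
  shows "lin_sum U f (tensor_pow n p) = cls (lext (\<lambda>w. wpow n w g) p)"
proof -
  define h where "h xs = coset_rep (f xs)" for xs
  have h: "h (map clsw ws) \<approx> g ws" if "length ws = Suc n" for ws
    unfolding h_def assms(1)[OF that] using coset_rep_class by (simp add: eqv_def)
  have *: "wpow m w f' \<approx> wpow m w g'" if "\<And>ws. length ws = Suc m \<Longrightarrow> f' ws \<approx> g' ws" for m w f' g'
    using that
  proof (induction m arbitrary: f' g')
    case (Suc m)
    show ?case unfolding wpow.simps by (rule Suc.IH) (intro eqv_wsum Suc.prems, simp)
  qed simp
  have "lin_sum U f (tensor_pow n p) = cls (lext h (tensor_pow n p))"
    using keys_tensor_pow assms(2) unfolding h_def by (intro lin_sum_carrier) (simp add: multilin_def)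
  also have "\<dots> = cls (lext (\<lambda>w. wpow n w (\<lambda>ws. h (map clsw ws))) p)"
    by (simp add: tensor_pow_def lext_lext lext_wpow)
  also have "\<dots> = cls (lext (\<lambda>w. wpow n w g) p)"
    unfolding cls_eq_iff by (intro eqv_lext * h)
  finally show ?thesis .
qed

end

section \<open>Weights of words\<close>

lemma bichar_add_left: "(\<And>i j. r i j \<noteq> 0) \<Longrightarrow> bichar r (\<lambda>j. \<mu> j + \<nu> j) \<kappa> = bichar r \<mu> \<kappa> * bichar r \<nu> \<kappa>"
  and bichar_add_right: "(\<And>i j. r i j \<noteq> 0) \<Longrightarrow> bichar r \<kappa> (\<lambda>j. \<mu> j + \<nu> j) = bichar r \<kappa> \<mu> * bichar r \<kappa> \<nu>"
  by (simp_all add: bichar_def distrib_left distrib_right power_int_add prod.distrib)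

lemma prod_inverse: "(\<Prod>x\<in>B. inverse (f x)) = inverse (\<Prod>x\<in>B. f x)" for f :: "'a \<Rightarrow> 'k::field"
  using prod_inversef[of f B] by (simp add: comp_def)

lemma bichar_minus_left: "bichar r (\<lambda>j. - \<mu> j) \<kappa> = inverse (bichar r \<mu> \<kappa>)"
  and bichar_minus_right: "bichar r \<kappa> (\<lambda>j. - \<mu> j) = inverse (bichar r \<kappa> \<mu>)"
  by (simp_all add: bichar_def power_int_minus prod_inverse)

lemma bichar_nonzero: "(\<And>i j. r i j \<noteq> 0) \<Longrightarrow> bichar r \<mu> \<nu> \<noteq> 0"
  by (simp add: bichar_def)

lemma bichar_zero [simp]: "bichar r (\<lambda>j. 0) \<nu> = 1" "bichar r \<mu> (\<lambda>j. 0) = 1"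
  by (simp_all add: bichar_def)

lemma bichar_inverse: "bichar (\<lambda>i j. inverse (r i j)) \<mu> \<nu> = inverse (bichar r \<mu> \<nu>)"
  by (simp add: bichar_def power_int_inverse prod_inverse)

lemma bichar_single:
  "bichar r (\<lambda>k. if k = i then s else 0) (\<lambda>k. if k = j then t else 0) = r i j powi (s * t)"
proof -
  have "(\<Prod>b\<in>UNIV. r a b powi ((if a = i then s else 0) * (if b = j then t else 0))) =
      (if a = i then r i j powi (s * t) else 1)" for a
  proof -
    have "(\<Prod>b\<in>UNIV. r a b powi ((if a = i then s else 0) * (if b = j then t else 0))) =
        (\<Prod>b\<in>UNIV. if b = j then (if a = i then r i j powi (s * t) else 1) else 1)"
      by (rule prod.cong) auto
    then show ?thesis by simp
  qed
  then show ?thesis by (simp add: bichar_def)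
qed

lemma torus_weight_Nil [simp]: "torus_weight [] = (\<lambda>j. 0)"
  and torus_weight_Cons: "torus_weight (x # w) = (\<lambda>j. gen_weight x j + torus_weight w j)"
  and torus_weight_append: "torus_weight (u @ v) = (\<lambda>j. torus_weight u j + torus_weight v j)"
  by (auto simp: torus_weight_def)

lemma left_torus_append: "left_torus (u @ v) = left_torus u @ left_torus v"
  and right_torus_append: "right_torus (u @ v) = right_torus u @ right_torus v"
  by (induction u rule: word_induct) simp_all

text \<open>With \<open>right_weight\<close> this is a bigrading by the root lattice:
  \<open>E i\<close> has degree (alpha_i, 0), \<open>F i\<close> has degree (0, alpha_i), and a
  torus letter has the same weight on both sides.\<close>

definition left_weight :: "'i gen list \<Rightarrow> 'i \<Rightarrow> int" where
  "left_weight w = torus_weight (left_torus w)"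

definition right_weight :: "'i gen list \<Rightarrow> 'i \<Rightarrow> int" where
  "right_weight w = torus_weight (right_torus w)"

lemma weight_append:
  shows left_weight_append: "left_weight (u @ v) = (\<lambda>j. left_weight u j + left_weight v j)"
    and right_weight_append: "right_weight (u @ v) = (\<lambda>j. right_weight u j + right_weight v j)"
  by (simp_all add: left_weight_def right_weight_def left_torus_append right_torus_append torus_weight_append)

lemma weight_torus_word: "torus_word w \<Longrightarrow> left_weight w = torus_weight w"
  "torus_word w \<Longrightarrow> right_weight w = torus_weight w"
  by (simp_all add: left_weight_def right_weight_def left_torus_id right_torus_id)

lemma weight_Nil [simp]: "left_weight [] = (\<lambda>j. 0)" "right_weight [] = (\<lambda>j. 0)"
  by (simp_all add: left_weight_def right_weight_def)

text \<open>Up to sign the antipode of a word is a word again. Separating the two gives it weights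
  and a scalar under rescaling.\<close>

fun gen_antipode_word :: "'i gen \<Rightarrow> 'i gen list" where
  "gen_antipode_word (E i) = [K_inv i, E i]"
| "gen_antipode_word (F i) = [F i, K'_inv i]"
| "gen_antipode_word (K i) = [K_inv i]"
| "gen_antipode_word (K_inv i) = [K i]"
| "gen_antipode_word (K' i) = [K'_inv i]"
| "gen_antipode_word (K'_inv i) = [K' i]"

definition antipode_word :: "'i gen list \<Rightarrow> 'i gen list" where
  "antipode_word w = concat (map gen_antipode_word (rev w))"

definition antipode_sign :: "'i gen list \<Rightarrow> 'k::comm_ring_1" where
  "antipode_sign w = (\<Prod>x\<leftarrow>w. if is_torus x then 1 else - 1)"

lemma word_antipode_eq:
  "(word_antipode w :: 'i gen list \<Rightarrow>\<^sub>0 'k::comm_ring_1) = smul (antipode_sign w) (wmon (antipode_word w))"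
proof (induction w)
  case Nil
  show ?case by (simp add: antipode_sign_def antipode_word_def smul_one wmon_Nil)
next
  case (Cons x w)
  have "gen_antipode x = smul (if is_torus x then 1 else - 1) (wmon (gen_antipode_word x) :: 'i gen list \<Rightarrow>\<^sub>0 'k)"
    by (cases x) (simp_all add: wmon_Cons wmon_Nil smul_simps)
  then show ?case
    by (simp add: Cons antipode_sign_def antipode_word_def smul_simps wmon_append mult.commute)
qed

lemma antipode_word_Nil [simp]: "antipode_word [] = []"
  and antipode_word_Cons: "antipode_word (x # w) = antipode_word w @ gen_antipode_word x"
  by (simp_all add: antipode_word_def)

lemma antipode_sign_torus: "torus_word w \<Longrightarrow> antipode_sign w = 1"
  by (induction w) (simp_all add: antipode_sign_def)

lemma torus_word_antipode_word [simp]: "torus_word (antipode_word w) \<longleftrightarrow> torus_word w"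
proof (induction w)
  case (Cons x w)
  then show ?case by (cases x) (auto simp: antipode_word_Cons)
qed simp

text \<open>The antipode exchanges the tensor factors of the coproduct and inverts torus
  elements.\<close>

lemma weight_antipode_word:
  "left_weight (antipode_word w) = (\<lambda>j. - right_weight w j)"
  "right_weight (antipode_word w) = (\<lambda>j. - left_weight w j)"
proof (induction w)
  case (Cons x w)
  {
    case 1
    have "left_weight (gen_antipode_word x) j = - right_weight [x] j" for j
      by (cases x) (simp_all add: left_weight_def right_weight_def torus_weight_Cons)
    then show ?case
      using Cons right_weight_append[of "[x]" w] by (simp add: antipode_word_Cons weight_append fun_eq_iff)
  next
    case 2
    have "right_weight (gen_antipode_word x) j = - left_weight [x] j" for j
      by (cases x) (simp_all add: left_weight_def right_weight_def torus_weight_Cons)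
    then show ?case
      using Cons left_weight_append[of "[x]" w] by (simp add: antipode_word_Cons weight_append fun_eq_iff)
  }
qed simp_all

section \<open>The cocycle\<close>

definition word_form :: "('i::finite \<Rightarrow> 'i \<Rightarrow> 'k::field) \<Rightarrow> 'i gen list \<Rightarrow> 'i gen list \<Rightarrow> 'k" where
  "word_form r u v = (if torus_word u \<and> torus_word v then bichar r (torus_weight u) (torus_weight v) else 0)"

lemma wsum_form_left:
  fixes h :: "_ \<Rightarrow> _ \<Rightarrow> 'k::field"
  shows "wsum w (\<lambda>u v. wsum w' (\<lambda>u' v'. word_form r u u' * h v v')) =
    bichar r (left_weight w) (left_weight w') * h w w'"
  by (subst wsum_left_torus', simp add: word_form_def)+ (simp add: word_form_def left_weight_def)

lemma wsum_form_left_smul: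
  fixes h :: "_ \<Rightarrow> _ \<Rightarrow> ('i::finite gen list \<Rightarrow>\<^sub>0 'k::field)"
  shows "wsum w (\<lambda>u v. wsum w' (\<lambda>u' v'. smul (word_form r u u') (h v v'))) =
    smul (bichar r (left_weight w) (left_weight w')) (h w w')"
  by (subst wsum_left_torus', simp add: word_form_def smul_simps)+ (simp add: word_form_def left_weight_def)

lemma wsum_form_right_smul:
  fixes h :: "_ \<Rightarrow> _ \<Rightarrow> ('i::finite gen list \<Rightarrow>\<^sub>0 'k::field)"
  shows "wsum w (\<lambda>u v. wsum w' (\<lambda>u' v'. smul (word_form r v v') (h u u'))) =
    smul (bichar r (right_weight w) (right_weight w')) (h w w')"
  by (subst wsum_right_torus', simp add: word_form_def smul_simps)+ (simp add: word_form_def right_weight_def)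

lemma wsum_swap: "wsum w (\<lambda>u v. wsum w' (\<lambda>u' v'. g u v u' v')) = wsum w' (\<lambda>u' v'. wsum w (\<lambda>u v. g u v u' v'))"
  by (induction w arbitrary: g rule: word_induct) (simp_all add: wsum_torus wsum_add)

lemma wsum_lin_form_swap:
  "wsum w (\<lambda>u v. lin_form (\<lambda>x. g x u v) t) = lin_form (\<lambda>x. wsum w (\<lambda>u v. g x u v)) t"
  by (induction w arbitrary: g rule: word_induct) (simp_all add: wsum_torus lin_form_fun_add)

text \<open>Since \<open>r\<close> is an arbitrary nonzero family, the convolution inverse of the
  form is the same construction for the family of inverses.\<close>

locale uq_form = uq A p for A :: "'i::finite \<Rightarrow> 'i \<Rightarrow> int" and p :: "'i \<Rightarrow> 'i \<Rightarrow> 'k::field" +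
  fixes r :: "'i \<Rightarrow> 'i \<Rightarrow> 'k"
  assumes r_nonzero: "r i j \<noteq> 0"
begin

lemmas bichar_simps = bichar_add_left[of r, OF r_nonzero] bichar_add_right[of r, OF r_nonzero]
  bichar_minus_left bichar_minus_right bichar_nonzero[of r, OF r_nonzero]

lemma word_form_append:
  shows word_form_append_left: "word_form r (u @ u') v = word_form r u v * word_form r u' v"
    and word_form_append_right: "word_form r u (v @ v') = word_form r u v * word_form r u v'"
  by (auto simp: word_form_def torus_weight_append bichar_simps)

text \<open>In one argument the form is multiplicative on words, vanishes on E and F, and does not
  distinguish K from K'; the last point settles the relation between E and F. The value
  \<open>f []\<close> is not replaced by 1, because it is 0 when the fixed word is not a torus
  word.\<close>

lemma word_form_ideal:
  assumes "a \<in> I"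
  shows "lin_form (\<lambda>u. word_form r u v) a = 0" and "lin_form (\<lambda>u. word_form r v u) a = 0"
proof -
  have *: "lin_form f a = 0"
    if f: "\<And>u u'. f (u @ u') = f u * f u'"
      and inv: "\<And>i. f [] = f [K i] * f [K_inv i]" "\<And>i. f [] = f [K' i] * f [K'_inv i]"
      and EF: "\<And>i. f [E i] = 0" "\<And>i. f [F i] = 0"
      and KK: "\<And>i. f [K i] = f [K' i]" for f :: "'i gen list \<Rightarrow> 'k"
  proof -
    have hom: "lin_form f (s * t) = lin_form f s * lin_form f t" for s t
      by (rule lin_form_hom) (simp add: plus_list_def f)
    have one: "lin_form f 1 = f []"
      using lin_form_wmon[of f "[]"] by (simp add: wmon_Nil)
    have inv': "f [K' i] * f [K_inv i] = f []" "f [K_inv i] * f [K' i] = f []"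
      "f [K' i] * f [K'_inv i] = f []" "f [K'_inv i] * f [K' i] = f []" for i
      by (metis inv KK mult.commute)+
    have "two_sided {a. lin_form f a = 0}"
      by (simp add: two_sided_def lin_form_add hom)
    moreover have "uq_rels A p \<subseteq> {a. lin_form f a = 0}"
    proof
      fix a assume "a \<in> uq_rels A p"
      then have "lin_form f a = 0"
        by cases (simp_all add: lin_form_diff lin_form_sum lin_form_smul hom gn_def scal_mult one inv' EF KK)
      then show "a \<in> {a. lin_form f a = 0}" by simp
    qed
    ultimately show ?thesis using uq_ideal_minimal assms by blast
  qed
  have neg: "(\<lambda>j. if j = i then - 1 else 0 :: int) = (\<lambda>j. - (if j = i then 1 else 0))" for i :: 'i
    by auto
  show "lin_form (\<lambda>u. word_form r u v) a = 0"
    by (rule *) (auto simp: word_form_append, auto simp: word_form_def torus_weight_Cons neg bichar_simps)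
  show "lin_form (\<lambda>u. word_form r v u) a = 0"
    by (rule *) (auto simp: word_form_append, auto simp: word_form_def torus_weight_Cons neg bichar_simps)
qed

section \<open>Existence of the form and the cocycle identity\<close>

definition is_form :: "(('i gen list \<Rightarrow>\<^sub>0 'k) set \<Rightarrow> ('i gen list \<Rightarrow>\<^sub>0 'k) set \<Rightarrow> 'k) \<Rightarrow> bool" where
  "is_form \<sigma> \<longleftrightarrow> bilinear_form U \<sigma> \<and> (\<forall>u v. \<sigma> (clsw u) (clsw v) = word_form r u v)"

lemma is_form_exists: "\<exists>\<sigma>. is_form \<sigma>"
proof -
  define \<sigma> where "\<sigma> x y = lin_form (\<lambda>u. lin_form (\<lambda>v. word_form r u v) (coset_rep y)) (coset_rep x)" for x y
  have \<sigma>: "\<sigma> (cls a) (cls b) = lin_form (\<lambda>u. lin_form (\<lambda>v. word_form r u v) b) a" for a b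
  proof -
    have "lin_form (\<lambda>v. word_form r u v) (coset_rep (cls b)) = lin_form (\<lambda>v. word_form r u v) b" for u
      using word_form_ideal(2)[OF coset_rep_class[of A p b]] by (simp add: lin_form_diff)
    moreover have "lin_form (\<lambda>u. word_form r u v) (coset_rep (cls a)) = lin_form (\<lambda>u. word_form r u v) a" for v
      using word_form_ideal(1)[OF coset_rep_class[of A p a]] by (simp add: lin_form_diff)
    ultimately show ?thesis
      unfolding \<sigma>_def by (simp add: lin_form_swap[of _ b])
  qed
  have "is_form \<sigma>"
    unfolding is_form_def bilinear_form_def
    by (auto simp: \<sigma> Uq_ops lin_form_add lin_form_smul lin_form_fun_add lin_form_fun_mult elim!: Uq_cases)
  then show ?thesis by blast
qed

lemma bilinear_form_expand:
  assumes "bilinear_form U \<sigma>" "y \<in> carrier U"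
  shows "\<sigma> (cls a) y = lin_form (\<lambda>u. \<sigma> (clsw u) y) a" and "\<sigma> y (cls a) = lin_form (\<lambda>u. \<sigma> y (clsw u)) a"
proof -
  have add: "\<sigma> (cls (a + b)) y = \<sigma> (cls a) y + \<sigma> (cls b) y" "\<sigma> y (cls (a + b)) = \<sigma> y (cls a) + \<sigma> y (cls b)" for a b
    using assms unfolding bilinear_form_def Uq_add[symmetric] by simp_all
  have smul: "\<sigma> (cls (smul c a)) y = c * \<sigma> (cls a) y" "\<sigma> y (cls (smul c a)) = c * \<sigma> y (cls a)" for a c
    using assms unfolding bilinear_form_def Uq_smult[symmetric] by simp_all
  show "\<sigma> (cls a) y = lin_form (\<lambda>u. \<sigma> (clsw u) y) a"
    by (induction a rule: poly_mapping_linear_induct)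
      (simp_all add: single_eq_wmon lin_form_smul lin_form_add add smul)
  show "\<sigma> y (cls a) = lin_form (\<lambda>u. \<sigma> y (clsw u)) a"
    by (induction a rule: poly_mapping_linear_induct)
      (simp_all add: single_eq_wmon lin_form_smul lin_form_add add smul)
qed

lemma convolution_left_form:
  assumes \<sigma>: "is_form \<sigma>"
  shows "convolution U \<sigma> \<tau> x y = lin_form (\<lambda>w. lin_form (\<lambda>w'.
      bichar r (left_weight w) (left_weight w') * \<tau> (clsw w) (clsw w')) (coset_rep y)) (coset_rep x)"
proof -
  have "convolution U \<sigma> \<tau> x y = lin_form (\<lambda>w. lin_form (\<lambda>w'. wsum w (\<lambda>u v. wsum w' (\<lambda>u' v'.
      \<sigma> (clsw u) (clsw u') * \<tau> (clsw v) (clsw v')))) (coset_rep y)) (coset_rep x)"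
    by (simp add: convolution_def lin_form_comult_Uq wsum_lin_form_swap)
  then show ?thesis
    using \<sigma> by (simp add: is_form_def wsum_form_left[of _ _ r "\<lambda>v v'. \<tau> (clsw v) (clsw v')"])
qed

lemma cocycle:
  assumes \<sigma>: "is_form \<sigma>"
  shows "hopf_2_cocycle U \<sigma>"
proof -
  have bil: "bilinear_form U \<sigma>" and val: "\<sigma> (clsw u) (clsw v) = word_form r u v" for u v
    using \<sigma> by (simp_all add: is_form_def)
  have one: "\<one>\<^bsub>U\<^esub> = clsw []" by (simp add: Uq_one wmon_Nil)
  have expand: "\<sigma> x (clsw v) = lin_form (\<lambda>u. word_form r u v) (coset_rep x)"
    "\<sigma> (clsw v) x = lin_form (\<lambda>u. word_form r v u) (coset_rep x)" if "x \<in> carrier U" for x v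
    using bilinear_form_expand[OF bil, of "clsw v" "coset_rep x"] that
    by (simp_all add: class_coset_rep val)
  have unit: "\<sigma> x \<one>\<^bsub>U\<^esub> = counit U x \<and> \<sigma> \<one>\<^bsub>U\<^esub> x = counit U x" if "x \<in> carrier U" for x
  proof -
    have "(\<lambda>u. word_form r u []) = word_counit" "(\<lambda>u. word_form r [] u) = word_counit"
      by (auto simp: word_form_def word_counit_eq fun_eq_iff)
    then show ?thesis
      using expand[OF that, of "[]"] counit_class[of "coset_rep x"] that
      by (simp add: one class_coset_rep eps_def)
  qed
  have assoc: "lin_form (\<lambda>as. lin_form (\<lambda>bs. \<sigma> (as ! 0) (bs ! 0) * \<sigma> (as ! 1 \<otimes>\<^bsub>U\<^esub> bs ! 1) c) (comult U b)) (comult U a)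
      = lin_form (\<lambda>bs. lin_form (\<lambda>cs. \<sigma> (bs ! 0) (cs ! 0) * \<sigma> a (bs ! 1 \<otimes>\<^bsub>U\<^esub> cs ! 1)) (comult U c)) (comult U b)"
    if a: "a \<in> carrier U" and b: "b \<in> carrier U" and c: "c \<in> carrier U" for a b c
  proof -
    have "lin_form (\<lambda>as. lin_form (\<lambda>bs. \<sigma> (as ! 0) (bs ! 0) * \<sigma> (as ! 1 \<otimes>\<^bsub>U\<^esub> bs ! 1) c) (comult U b)) (comult U a)
        = lin_form (\<lambda>w. lin_form (\<lambda>w'. wsum w (\<lambda>u v. wsum w' (\<lambda>u' v'.
            word_form r u u' * \<sigma> (clsw (v @ v')) c))) (coset_rep b)) (coset_rep a)"
      by (simp add: lin_form_comult_Uq wsum_lin_form_swap val Uq_mult flip: wmon_append)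
    also have "\<dots> = lin_form (\<lambda>w. lin_form (\<lambda>w'. lin_form (\<lambda>w''.
        bichar r (left_weight w) (left_weight w') * word_form r (w @ w') w'') (coset_rep c)) (coset_rep b)) (coset_rep a)"
      unfolding wsum_form_left[of _ _ r "\<lambda>v v'. \<sigma> (clsw (v @ v')) c"] by (simp add: expand(2)[OF c] lin_form_fun_mult)
    also have "\<dots> = lin_form (\<lambda>w. lin_form (\<lambda>w'. lin_form (\<lambda>w''.
        bichar r (left_weight w') (left_weight w'') * word_form r w (w' @ w'')) (coset_rep c)) (coset_rep b)) (coset_rep a)"
    proof -
      \<comment> \<open>Both sides vanish unless all three words are torus words. Then left weights
        are torus weights, and both sides are the product of the bicharacter over the three pairs of
        words.\<close>
      have "bichar r (left_weight w) (left_weight w') * word_form r (w @ w') w''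
          = bichar r (left_weight w') (left_weight w'') * word_form r w (w' @ w'')" for w w' w''
        by (simp add: word_form_append) (simp add: word_form_def weight_torus_word)
      then show ?thesis by simp
    qed
    also have "\<dots> = lin_form (\<lambda>w'. lin_form (\<lambda>w''. lin_form (\<lambda>w.
        bichar r (left_weight w') (left_weight w'') * word_form r w (w' @ w'')) (coset_rep a)) (coset_rep c)) (coset_rep b)"
      by (subst lin_form_swap) (subst lin_form_swap[of _ "coset_rep c"], rule refl)
    also have "\<dots> = lin_form (\<lambda>w. lin_form (\<lambda>w'. wsum w (\<lambda>u v. wsum w' (\<lambda>u' v'.
            word_form r u u' * \<sigma> a (clsw (v @ v'))))) (coset_rep c)) (coset_rep b)"
      unfolding wsum_form_left[of _ _ r "\<lambda>v v'. \<sigma> a (clsw (v @ v'))"] by (simp add: expand(1)[OF a] lin_form_fun_mult)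
    also have "\<dots> = lin_form (\<lambda>bs. lin_form (\<lambda>cs. \<sigma> (bs ! 0) (cs ! 0) * \<sigma> a (bs ! 1 \<otimes>\<^bsub>U\<^esub> cs ! 1)) (comult U c)) (comult U b)"
      by (simp add: lin_form_comult_Uq wsum_lin_form_swap val Uq_mult flip: wmon_append)
    finally show ?thesis .
  qed
  from bil unit assoc show ?thesis
    by (simp add: hopf_2_cocycle_def)
qed

end

lemma wsum_lext_swap:
  "wsum w (\<lambda>u v. lext (\<lambda>x. g x u v) t) = lext (\<lambda>x. wsum w (\<lambda>u v. g x u v)) t"
  by (induction w arbitrary: g rule: word_induct) (simp_all add: wsum_torus lext_fun_add)

text \<open>Where the form vanishes this rests on \<open>inverse 0 = 0\<close>.\<close>

lemma word_form_inverse: "word_form (\<lambda>i j. inverse (r i j)) u v = inverse (word_form r u v)"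
  by (simp add: word_form_def bichar_inverse)

lemma counit_Uq: "counit (Uq A q) x = eps (coset_rep x)"
  by (simp add: Uq_def eps_def)

text \<open>
  The product \<open>\<sigma>(a\<^sub>1, b\<^sub>1) a\<^sub>2b\<^sub>2 \<sigma>\<^sup>-\<^sup>1(a\<^sub>3, b\<^sub>3)\<close> of two words \<open>a\<close>, \<open>b\<close> is \<open>twist r a b\<close> times their
  concatenation, because \<open>\<sigma>\<close> only sees the torus part of a coproduct.
\<close>

definition twist :: "('i::finite \<Rightarrow> 'i \<Rightarrow> 'k::field) \<Rightarrow> 'i gen list \<Rightarrow> 'i gen list \<Rightarrow> 'k" where
  "twist r u v = bichar r (left_weight u) (left_weight v) * inverse (bichar r (right_weight u) (right_weight v))"

section \<open>Calculation in the quotient and the convolution inverse\<close>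

context uq
begin

lemma Uq_simprules1:
  assumes "x \<in> carrier U"
  shows "c \<odot>\<^bsub>U\<^esub> x \<in> carrier U" "antipode U x \<in> carrier U"
    "(c + c') \<odot>\<^bsub>U\<^esub> x = c \<odot>\<^bsub>U\<^esub> x \<oplus>\<^bsub>U\<^esub> c' \<odot>\<^bsub>U\<^esub> x" "c \<odot>\<^bsub>U\<^esub> (c' \<odot>\<^bsub>U\<^esub> x) = (c * c') \<odot>\<^bsub>U\<^esub> x"
    "antipode U (c \<odot>\<^bsub>U\<^esub> x) = c \<odot>\<^bsub>U\<^esub> antipode U x"
  using assms by (auto simp: Uq_ops smul_simps smul_add_left antipode_class antip_simps elim!: Uq_cases)

lemma Uq_simprules2:
  assumes "x \<in> carrier U" "y \<in> carrier U"
  shows "x \<otimes>\<^bsub>U\<^esub> y \<in> carrier U" "x \<oplus>\<^bsub>U\<^esub> y \<in> carrier U"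
    "c \<odot>\<^bsub>U\<^esub> (x \<oplus>\<^bsub>U\<^esub> y) = c \<odot>\<^bsub>U\<^esub> x \<oplus>\<^bsub>U\<^esub> c \<odot>\<^bsub>U\<^esub> y"
    "(c \<odot>\<^bsub>U\<^esub> x) \<otimes>\<^bsub>U\<^esub> y = c \<odot>\<^bsub>U\<^esub> (x \<otimes>\<^bsub>U\<^esub> y)" "x \<otimes>\<^bsub>U\<^esub> (c \<odot>\<^bsub>U\<^esub> y) = c \<odot>\<^bsub>U\<^esub> (x \<otimes>\<^bsub>U\<^esub> y)"
    "antipode U (x \<oplus>\<^bsub>U\<^esub> y) = antipode U x \<oplus>\<^bsub>U\<^esub> antipode U y"
  using assms by (auto simp: Uq_ops smul_simps antipode_class antip_simps elim!: Uq_cases)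

lemma Uq_simprules3:
  assumes "x \<in> carrier U" "y \<in> carrier U" "z \<in> carrier U"
  shows "(x \<oplus>\<^bsub>U\<^esub> y) \<otimes>\<^bsub>U\<^esub> z = x \<otimes>\<^bsub>U\<^esub> z \<oplus>\<^bsub>U\<^esub> y \<otimes>\<^bsub>U\<^esub> z" "z \<otimes>\<^bsub>U\<^esub> (x \<oplus>\<^bsub>U\<^esub> y) = z \<otimes>\<^bsub>U\<^esub> x \<oplus>\<^bsub>U\<^esub> z \<otimes>\<^bsub>U\<^esub> y"
  using assms by (auto simp: Uq_ops distrib_left distrib_right elim!: Uq_cases)

lemmas Uq_simprules = Uq_simprules1 Uq_simprules2 Uq_simprules3

lemma one_in_U [simp]: "\<one>\<^bsub>U\<^esub> \<in> carrier U"
  by (simp add: Uq_one)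

lemma bilinear_formD:
  assumes "bilinear_form U f" "x \<in> carrier U" "y \<in> carrier U" "z \<in> carrier U"
  shows "f (x \<oplus>\<^bsub>U\<^esub> y) z = f x z + f y z" "f z (x \<oplus>\<^bsub>U\<^esub> y) = f z x + f z y"
  using assms unfolding bilinear_form_def by blast+

lemma bilinear_form_smult:
  assumes "bilinear_form U f" "x \<in> carrier U" "z \<in> carrier U"
  shows "f (c \<odot>\<^bsub>U\<^esub> x) z = c * f x z" "f z (c \<odot>\<^bsub>U\<^esub> x) = c * f z x"
  using assms unfolding bilinear_form_def by blast+

lemma keys_tens2: "xs \<in> Poly_Mapping.keys (tens2 A q t) \<Longrightarrow> length xs = 2 \<and> set xs \<subseteq> carrier U"
proof -
  assume "xs \<in> Poly_Mapping.keys (tens2 A q t)"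
  moreover have "Poly_Mapping.keys (tens2 A q t) \<subseteq>
      (\<Union>x\<in>Poly_Mapping.keys t. Poly_Mapping.keys ((\<lambda>(u, v). wmon [clsw u, clsw v] :: _ \<Rightarrow>\<^sub>0 'k) x))"
    unfolding tens2_def by (rule keys_lext)
  ultimately show ?thesis by (fastforce simp: wmon_def split: prod.splits)
qed

text \<open>Replaces the chosen representative by \<open>a\<close> itself. Their coproducts agree
  only as tensors, hence the bilinearity of \<open>f\<close>.\<close>

lemma lin_form_comult_class:
  assumes f: "bilinear_form U f"
  shows "lin_form (\<lambda>xs. f (xs ! 0) (xs ! 1)) (comult U (cls a)) =
    lin_form (\<lambda>w. wsum w (\<lambda>u v. f (clsw u) (clsw v))) a"
proof -
  have "multilin U 2 (\<lambda>xs. f (xs ! 0) (xs ! 1) \<odot>\<^bsub>U\<^esub> \<one>\<^bsub>U\<^esub>)"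
    unfolding multilin_def
  proof (intro conjI allI impI)
    fix xs x y c and i :: nat assume "length xs = 2" "set xs \<subseteq> carrier U" "i < 2" "x \<in> carrier U" "y \<in> carrier U"
    moreover from this have "xs ! 0 \<in> carrier U" "xs ! 1 \<in> carrier U" "i = 0 \<or> i = 1" by auto
    ultimately show "f (xs[i := x \<oplus>\<^bsub>U\<^esub> y] ! 0) (xs[i := x \<oplus>\<^bsub>U\<^esub> y] ! 1) \<odot>\<^bsub>U\<^esub> \<one>\<^bsub>U\<^esub> =
        f (xs[i := x] ! 0) (xs[i := x] ! 1) \<odot>\<^bsub>U\<^esub> \<one>\<^bsub>U\<^esub> \<oplus>\<^bsub>U\<^esub> f (xs[i := y] ! 0) (xs[i := y] ! 1) \<odot>\<^bsub>U\<^esub> \<one>\<^bsub>U\<^esub>"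
      "f (xs[i := c \<odot>\<^bsub>U\<^esub> x] ! 0) (xs[i := c \<odot>\<^bsub>U\<^esub> x] ! 1) \<odot>\<^bsub>U\<^esub> \<one>\<^bsub>U\<^esub> =
        c \<odot>\<^bsub>U\<^esub> (f (xs[i := x] ! 0) (xs[i := x] ! 1) \<odot>\<^bsub>U\<^esub> \<one>\<^bsub>U\<^esub>)"
      using bilinear_formD[OF f] bilinear_form_smult[OF f] by (auto simp: Uq_simprules)
  qed (simp add: Uq_simprules)
  from lin_form_tensor_eq[OF this comult_class]
  have "lin_form (\<lambda>xs. f (xs ! 0) (xs ! 1)) (comult U (cls a)) =
      lin_form (\<lambda>xs. f (xs ! 0) (xs ! 1)) (tens2 A q (Delta a))"
    using keys_tens2 unfolding comult_Uq by blast
  also have "\<dots> = lin_form (\<lambda>w. wsum w (\<lambda>u v. f (clsw u) (clsw v))) a"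
    by (simp add: tens2_Delta lin_form_lext wsum_lin_form)
  finally show ?thesis .
qed

end

context uq_form
begin

lemma inverse_form: "uq_form A p (\<lambda>i j. inverse (r i j))"
  by unfold_locales (simp add: r_nonzero)

interpretation inv_form: uq_form A p "\<lambda>i j. inverse (r i j)"
  by (rule inverse_form)

lemma conv_inverse_exists:
  assumes \<sigma>: "is_form \<sigma>"
  shows "\<exists>\<tau>. conv_inverse U \<sigma> \<tau>"
proof -
  obtain \<tau> where \<tau>: "inv_form.is_form \<tau>" using inv_form.is_form_exists by blast
  have "bilinear_form U \<tau>" and \<tau>_val: "\<tau> (clsw u) (clsw v) = inverse (word_form r u v)" for u v
    using \<tau> by (simp_all add: inv_form.is_form_def word_form_inverse)
  have \<sigma>_val: "\<sigma> (clsw u) (clsw v) = word_form r u v" for u v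
    using \<sigma> by (simp add: is_form_def)
  have eps: "lin_form (\<lambda>w. lin_form (\<lambda>w'. word_counit w * word_counit w') (coset_rep y)) (coset_rep x) =
      counit U x * counit U y" for x y
    by (simp add: counit_Uq eps_def lin_form_fun_mult mult.commute[of _ "lin_form word_counit (coset_rep y)"])
  have "bichar r (left_weight w) (left_weight w') * inverse (word_form r w w') = word_counit w * word_counit w'"
    for w w'
    by (simp add: word_form_def word_counit_eq weight_torus_word bichar_simps)
  then have "convolution U \<sigma> \<tau> x y = counit U x * counit U y" for x y
    unfolding convolution_left_form[OF \<sigma>] \<tau>_val by (simp add: eps)
  moreover have "inverse (bichar r (left_weight w) (left_weight w')) * word_form r w w' = word_counit w * word_counit w'"
    for w w'
    by (simp add: word_form_def word_counit_eq weight_torus_word bichar_simps)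
  then have "convolution U \<tau> \<sigma> x y = counit U x * counit U y" for x y
    unfolding inv_form.convolution_left_form[OF \<tau>] \<sigma>_val bichar_inverse by (simp add: eps)
  ultimately show ?thesis
    using \<open>bilinear_form U \<tau>\<close> unfolding conv_inverse_def by blast
qed

text \<open>\<open>conv_inv\<close> is an arbitrary choice, so its values have to be extracted from
  the defining equation. There \<open>\<sigma>\<close> meets only the left torus parts, which leaves
  one nonzero factor times \<open>\<tau> (clsw u) (clsw v)\<close>.\<close>

lemma conv_inverse_value:
  assumes \<sigma>: "is_form \<sigma>" and \<tau>: "conv_inverse U \<sigma> \<tau>"
  shows "\<tau> (clsw u) (clsw v) = inverse (word_form r u v)"
proof -
  have bil: "bilinear_form U \<sigma>" "bilinear_form U \<tau>"
    using assms by (simp_all add: is_form_def conv_inverse_def)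
  \<comment> \<open>The coproducts of the two arguments are replaced one at a time, so the inner sum
    must be bilinear in the remaining pair.\<close>
  define g where "g a a' = lin_form (\<lambda>bs. \<sigma> a (bs ! 0) * \<tau> a' (bs ! 1)) (comult U (clsw v))" for a a'
  have g: "bilinear_form U g"
    unfolding bilinear_form_def
  proof (intro ballI allI)
    fix x y z c assume xyz: "x \<in> carrier U" "y \<in> carrier U" "z \<in> carrier U"
    have mem: "bs ! 0 \<in> carrier U \<and> bs ! 1 \<in> carrier U" if "bs \<in> Poly_Mapping.keys (comult U (clsw v))" for bs
      using keys_comult_Uq[OF that] by auto
    note D = bilinear_formD[OF bil(1)] bilinear_formD[OF bil(2)] bilinear_form_smult[OF bil(1)] bilinear_form_smult[OF bil(2)]
    show "g (x \<oplus>\<^bsub>U\<^esub> y) z = g x z + g y z \<and> g (c \<odot>\<^bsub>U\<^esub> x) z = c * g x z \<and>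
        g z (x \<oplus>\<^bsub>U\<^esub> y) = g z x + g z y \<and> g z (c \<odot>\<^bsub>U\<^esub> x) = c * g z x"
      unfolding g_def lin_form_fun_add[symmetric] lin_form_fun_mult[symmetric]
      by (intro conjI lin_form_cong) (use mem xyz in \<open>simp_all add: D algebra_simps\<close>)
  qed
  have h: "bilinear_form U (\<lambda>b b'. \<sigma> a b * \<tau> a' b')" if "a \<in> carrier U" "a' \<in> carrier U" for a a'
    unfolding bilinear_form_def
    using that by (auto simp: bilinear_formD[OF bil(1)] bilinear_formD[OF bil(2)]
        bilinear_form_smult[OF bil(1)] bilinear_form_smult[OF bil(2)] algebra_simps)
  have "convolution U \<sigma> \<tau> (clsw u) (clsw v) = lin_form (\<lambda>as. g (as ! 0) (as ! 1)) (comult U (clsw u))"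
    by (simp add: convolution_def g_def)
  also have "\<dots> = wsum u (\<lambda>a a'. g (clsw a) (clsw a'))"
    unfolding lin_form_comult_class[OF g] by simp
  also have "\<dots> = wsum u (\<lambda>a a'. wsum v (\<lambda>b b'. word_form r a b * \<tau> (clsw a') (clsw b')))"
  proof -
    have "g (clsw a) (clsw a') = wsum v (\<lambda>b b'. word_form r a b * \<tau> (clsw a') (clsw b'))" for a a'
      using lin_form_comult_class[OF h, of "clsw a" "clsw a'" "wmon v"] \<sigma> by (simp add: is_form_def g_def)
    then show ?thesis by simp
  qed
  also have "\<dots> = bichar r (left_weight u) (left_weight v) * \<tau> (clsw u) (clsw v)"
    by (rule wsum_form_left)
  finally have "bichar r (left_weight u) (left_weight v) * \<tau> (clsw u) (clsw v) = word_counit u * word_counit v"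
    using \<tau> by (simp add: conv_inverse_def counit_class eps_wmon)
  then show ?thesis
    using bichar_simps(5)[of "left_weight u" "left_weight v"]
    by (auto simp: word_counit_eq word_form_def weight_torus_word field_simps split: if_splits)
qed

text \<open>The deformed product lifted to the free algebra.\<close>

definition star :: "('i gen list \<Rightarrow>\<^sub>0 'k) \<Rightarrow> ('i gen list \<Rightarrow>\<^sub>0 'k) \<Rightarrow> 'i gen list \<Rightarrow>\<^sub>0 'k" where
  "star a b = lext (\<lambda>w. lext (\<lambda>w'. smul (twist r w w') (wmon (w @ w'))) b) a"

text \<open>This is \<open>inverse (twist r w w)\<close>, the factor by which the deformed antipode
  of a word differs from the original one.\<close>

definition antipode_scalar :: "'i gen list \<Rightarrow> 'k" where
  "antipode_scalar w = inverse (bichar r (left_weight w) (left_weight w)) * bichar r (right_weight w) (right_weight w)"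

lemma wpow_numeral:
  "wpow 2 w h = wsum w (\<lambda>x c. wsum x (\<lambda>a b. h [a, b, c]))"
  "wpow 4 w h = wsum w (\<lambda>x e. wsum x (\<lambda>x d. wsum x (\<lambda>x c. wsum x (\<lambda>a b. h [a, b, c, d, e]))))"
  by (simp_all add: eval_nat_numeral)

section \<open>The deformed product and antipode on classes\<close>

context
  fixes \<sigma> assumes \<sigma>: "is_form \<sigma>"
begin

abbreviation "\<tau> \<equiv> conv_inv U \<sigma>"

lemma conv_inverse_conv_inv: "conv_inverse U \<sigma> \<tau>"
  unfolding conv_inv_def using conv_inverse_exists[OF \<sigma>] by (rule someI_ex)

lemma bilinear_forms: "bilinear_form U \<sigma>" "bilinear_form U \<tau>"
  using \<sigma> conv_inverse_conv_inv by (simp_all add: is_form_def conv_inverse_def)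

lemmas form_simps = bilinear_formD[OF bilinear_forms(1)] bilinear_formD[OF bilinear_forms(2)]
  bilinear_form_smult[OF bilinear_forms(1)] bilinear_form_smult[OF bilinear_forms(2)]

lemma form_values: "\<sigma> (clsw u) (clsw v) = word_form r u v" "\<tau> (clsw u) (clsw v) = inverse (word_form r u v)"
  using \<sigma> conv_inverse_value[OF \<sigma> conv_inverse_conv_inv] by (simp_all add: is_form_def)

lemma deformed_mult_class: "deformed_mult U \<sigma> (cls a) (cls b) = cls (star a b)"
proof -
  define G where "G as bs = (\<sigma> (as ! 0) (bs ! 0) * \<tau> (as ! 2) (bs ! 2)) \<odot>\<^bsub>U\<^esub> (as ! 1 \<otimes>\<^bsub>U\<^esub> bs ! 1)" for as bs
  have nth: "xs ! 0 \<in> carrier U" "xs ! 1 \<in> carrier U" "xs ! 2 \<in> carrier U"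
    if "length xs = 3" "set xs \<subseteq> carrier U" for xs
    using that by (auto intro!: subsetD[OF that(2)])
  have cases3: "i = 0 \<or> i = 1 \<or> i = 2" if "i < 3" for i :: nat
    using that by auto
  have closed: "G as bs \<in> carrier U"
    if "length as = 3" "set as \<subseteq> carrier U" "length bs = 3" "set bs \<subseteq> carrier U" for as bs
    unfolding G_def using nth that by (simp add: Uq_simprules)
  \<comment> \<open>Multilinearity is needed in \<open>bs\<close> for fixed \<open>as\<close>, and
    in \<open>as\<close> for the whole inner sum, so that both chosen iterated coproducts can be
    replaced by those of words.\<close>
  have ml: "multilin U 3 (G as)" if as: "length as = 3" "set as \<subseteq> carrier U" for as
    unfolding multilin_def
  proof (intro conjI allI impI)
    fix xs x y c and i :: nat
    assume xs: "length xs = 3" "set xs \<subseteq> carrier U" "i < 3" "x \<in> carrier U" "y \<in> carrier U"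
    note mem = nth[OF as] nth[OF xs(1,2)] xs(4,5)
    show "G as (xs[i := x \<oplus>\<^bsub>U\<^esub> y]) = G as (xs[i := x]) \<oplus>\<^bsub>U\<^esub> G as (xs[i := y])"
      "G as (xs[i := c \<odot>\<^bsub>U\<^esub> x]) = c \<odot>\<^bsub>U\<^esub> G as (xs[i := x])"
      using cases3[OF xs(3)] mem xs(1)
      by (auto simp: G_def form_simps Uq_simprules distrib_left distrib_right mult_ac)
  qed (use closed as in auto)
  have ml': "multilin U 3 (\<lambda>as. lin_sum U (G as) t)"
    if t: "\<And>bs. bs \<in> Poly_Mapping.keys t \<Longrightarrow> length bs = 3 \<and> set bs \<subseteq> carrier U" for t
    unfolding multilin_def
  proof (intro conjI allI impI)
    fix xs x y c and i :: nat
    assume xs: "length xs = 3" "set xs \<subseteq> carrier U" "i < 3" "x \<in> carrier U" "y \<in> carrier U"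
    have upd: "length (xs[i := z]) = 3 \<and> set (xs[i := z]) \<subseteq> carrier U" if "z \<in> carrier U" for z
      using that xs set_update_subset_insert[of xs i z] by auto
    note mem = nth[OF xs(1,2)] xs(4,5)
    have G: "G (xs[i := x \<oplus>\<^bsub>U\<^esub> y]) bs = G (xs[i := x]) bs \<oplus>\<^bsub>U\<^esub> G (xs[i := y]) bs"
      "G (xs[i := c \<odot>\<^bsub>U\<^esub> x]) bs = c \<odot>\<^bsub>U\<^esub> G (xs[i := x]) bs"
      if bs: "length bs = 3" "set bs \<subseteq> carrier U" for bs
      using cases3[OF xs(3)] mem nth[OF bs] xs(1)
      by (auto simp: G_def form_simps Uq_simprules distrib_left distrib_right mult_ac)
    have closed': "G (xs[i := z]) bs \<in> carrier U" if "z \<in> carrier U" "bs \<in> Poly_Mapping.keys t" for z bs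
      using upd closed t that by simp
    have "lin_sum U (G (xs[i := x \<oplus>\<^bsub>U\<^esub> y])) t = lin_sum U (\<lambda>bs. G (xs[i := x]) bs \<oplus>\<^bsub>U\<^esub> G (xs[i := y]) bs) t"
      by (rule lin_sum_cong) (use G t closed' xs in \<open>simp_all add: Uq_simprules\<close>)
    then show "lin_sum U (G (xs[i := x \<oplus>\<^bsub>U\<^esub> y])) t = lin_sum U (G (xs[i := x])) t \<oplus>\<^bsub>U\<^esub> lin_sum U (G (xs[i := y])) t"
      using lin_sum_fun_add[of t "G (xs[i := x])" "G (xs[i := y])"] closed' xs by simp
    have "lin_sum U (G (xs[i := c \<odot>\<^bsub>U\<^esub> x])) t = lin_sum U (\<lambda>bs. c \<odot>\<^bsub>U\<^esub> G (xs[i := x]) bs) t"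
      by (rule lin_sum_cong) (use G t closed' xs in \<open>simp_all add: Uq_simprules\<close>)
    then show "lin_sum U (G (xs[i := c \<odot>\<^bsub>U\<^esub> x])) t = c \<odot>\<^bsub>U\<^esub> lin_sum U (G (xs[i := x])) t"
      using lin_sum_fun_smult[of t "G (xs[i := x])" c] closed' xs by simp
  qed (use closed t in \<open>auto intro!: lin_sum_closed\<close>)
  define g where "g ws zs = smul (word_form r (ws ! 0) (zs ! 0) * inverse (word_form r (ws ! 2) (zs ! 2)))
      (wmon (ws ! 1 @ zs ! 1))" for ws zs
  have Gg: "G (map clsw ws) (map clsw zs) = cls (g ws zs)" if "length ws = Suc 2" "length zs = Suc 2" for ws zs
    using that by (simp add: G_def g_def form_values Uq_ops wmon_append)
  have inner: "lin_sum U (G (map clsw ws)) (comult_pow U 2 (cls b)) = cls (lext (\<lambda>w'. wpow 2 w' (g ws)) b)"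
    if "length ws = Suc 2" for ws
  proof -
    have ml2: "multilin U (Suc 2) (G (map clsw ws))"
      using ml[of "map clsw ws"] that by (simp add: image_subset_iff)
    show ?thesis
      unfolding lin_sum_comult_pow[OF ml2] by (rule lin_sum_tensor_pow[OF Gg ml2]) (simp_all add: that)
  qed
  have ml3: "multilin U (Suc 2) (\<lambda>as. lin_sum U (G as) (comult_pow U 2 (cls b)))"
    using ml'[of "comult_pow U 2 (cls b)"] keys_comult_pow[of "cls b" _ 2] by simp
  have "deformed_mult U \<sigma> (cls a) (cls b) = lin_sum U (\<lambda>as. lin_sum U (G as) (comult_pow U 2 (cls b))) (comult_pow U 2 (cls a))"
    by (simp add: deformed_mult_def G_def[abs_def])
  also have "\<dots> = cls (lext (\<lambda>w. wpow 2 w (\<lambda>ws. lext (\<lambda>w'. wpow 2 w' (g ws)) b)) a)"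
    unfolding lin_sum_comult_pow[OF ml3] by (rule lin_sum_tensor_pow[OF inner ml3])
  also have "(\<lambda>w. wpow 2 w (\<lambda>ws. lext (\<lambda>w'. wpow 2 w' (g ws)) b)) =
      (\<lambda>w. lext (\<lambda>w'. smul (twist r w w') (wmon (w @ w'))) b)"
  proof
    fix w
    have "wsum w (\<lambda>x z. wsum x (\<lambda>u v. wsum w' (\<lambda>x' z'. wsum x' (\<lambda>u' v'.
        smul (word_form r u u' * inverse (word_form r z z')) (wmon (v @ v')))))) =
        smul (twist r w w') (wmon (w @ w'))" for w'
    proof -
      have "wsum w (\<lambda>x z. wsum x (\<lambda>u v. wsum w' (\<lambda>x' z'. wsum x' (\<lambda>u' v'.
          smul (word_form r u u' * inverse (word_form r z z')) (wmon (v @ v')))))) =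
          wsum w (\<lambda>x z. wsum w' (\<lambda>x' z'. wsum x (\<lambda>u v. wsum x' (\<lambda>u' v'.
          smul (word_form r u u') (smul (inverse (word_form r z z')) (wmon (v @ v')))))))"
        by (subst wsum_swap) (simp add: smul_smul)
      \<comment> \<open>The inner sums collapse to the left torus parts. The outer ones then
        collapse to the right, as the inverse of the form is the form of the inverses.\<close>
      also have "\<dots> = wsum w (\<lambda>x z. wsum w' (\<lambda>x' z'.
          smul (word_form (\<lambda>i j. inverse (r i j)) z z')
            (smul (bichar r (left_weight x) (left_weight x')) (wmon (x @ x')))))"
        unfolding word_form_inverse
        by (subst wsum_form_left_smul) (simp add: smul_smul mult.commute)
      also have "\<dots> = smul (twist r w w') (wmon (w @ w'))"
        by (subst wsum_form_right_smul) (simp add: smul_smul twist_def bichar_inverse mult.commute)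
      finally show ?thesis .
    qed
    then show "wpow 2 w (\<lambda>ws. lext (\<lambda>w'. wpow 2 w' (g ws)) b) =
        lext (\<lambda>w'. smul (twist r w w') (wmon (w @ w'))) b"
      by (simp add: wpow_numeral g_def wsum_lext_swap)
  qed
  finally show ?thesis by (simp add: star_def)
qed

lemma deformed_antipode_class:
  "deformed_antipode U \<sigma> (cls a) = cls (lext (\<lambda>w. smul (antipode_scalar w) (word_antipode w)) a)"
proof -
  define G where "G as = (\<sigma> (as ! 0) (antipode U (as ! 1)) * \<tau> (antipode U (as ! 3)) (as ! 4)) \<odot>\<^bsub>U\<^esub> antipode U (as ! 2)" for as
  have nth: "xs ! 0 \<in> carrier U" "xs ! 1 \<in> carrier U" "xs ! 2 \<in> carrier U" "xs ! 3 \<in> carrier U" "xs ! 4 \<in> carrier U"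
    if "length xs = Suc 4" "set xs \<subseteq> carrier U" for xs
    using that by (auto intro!: subsetD[OF that(2)])
  have ml: "multilin U (Suc 4) G"
    unfolding multilin_def
  proof (intro conjI allI impI)
    fix xs x y c and i :: nat
    assume xs: "length xs = Suc 4" "set xs \<subseteq> carrier U" "i < Suc 4" "x \<in> carrier U" "y \<in> carrier U"
    note mem = nth[OF xs(1,2)] xs(4,5)
    have i: "i = 0 \<or> i = 1 \<or> i = 2 \<or> i = 3 \<or> i = 4" using xs(3) by auto
    show "G (xs[i := x \<oplus>\<^bsub>U\<^esub> y]) = G (xs[i := x]) \<oplus>\<^bsub>U\<^esub> G (xs[i := y])"
      "G (xs[i := c \<odot>\<^bsub>U\<^esub> x]) = c \<odot>\<^bsub>U\<^esub> G (xs[i := x])"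
      using i mem xs(1)
      by (auto simp: G_def form_simps Uq_simprules distrib_left distrib_right mult_ac)
  qed (use nth in \<open>simp add: G_def Uq_simprules\<close>)
  define g where "g ws = smul (word_form r (ws ! 0) (antipode_word (ws ! 1)) *
      inverse (word_form r (antipode_word (ws ! 3)) (ws ! 4))) (word_antipode (ws ! 2))" for ws
  \<comment> \<open>The form sees the antipode of a word only if that word is a torus word, and then
    the sign is 1.\<close>
  have sign: "antipode_sign v * word_form r u (antipode_word v) = word_form r u (antipode_word v)"
    "antipode_sign v * inverse (word_form r (antipode_word v) u) = inverse (word_form r (antipode_word v) u)" for u v
    by (auto simp: word_form_def antipode_sign_torus)
  have S: "antipode U (clsw w) = antipode_sign w \<odot>\<^bsub>U\<^esub> clsw (antipode_word w)" for w
    by (simp add: antipode_class antip_wmon word_antipode_eq Uq_smult)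
  have \<sigma>S: "\<sigma> (clsw u) (antipode U (clsw v)) = word_form r u (antipode_word v)"
    "\<tau> (antipode U (clsw v)) (clsw u) = inverse (word_form r (antipode_word v) u)" for u v
    by (simp_all add: S form_simps form_values sign)
  have Gg: "G (map clsw ws) = cls (g ws)" if "length ws = Suc 4" for ws
    using that by (simp add: G_def g_def \<sigma>S) (simp add: antipode_class antip_wmon Uq_ops)
  have "deformed_antipode U \<sigma> (cls a) = lin_sum U G (comult_pow U 4 (cls a))"
    by (simp add: deformed_antipode_def G_def[abs_def])
  also have "\<dots> = cls (lext (\<lambda>w. wpow 4 w g) a)"
    unfolding lin_sum_comult_pow[OF ml] by (rule lin_sum_tensor_pow[OF Gg ml])
  also have "(\<lambda>w. wpow 4 w g) = (\<lambda>w. smul (antipode_scalar w) (word_antipode w))"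
  proof
    fix w
    have zero: "word_form r u v = 0" if "\<not> torus_word u \<or> \<not> torus_word v" for u v
      using that by (auto simp: word_form_def)
    have "wpow 4 w g = wsum w (\<lambda>x e. wsum x (\<lambda>x d. wsum x (\<lambda>x c. wsum x (\<lambda>a b.
        smul (word_form r a (antipode_word b) * inverse (word_form r (antipode_word d) e)) (word_antipode c)))))"
      by (simp add: wpow_numeral g_def)
    \<comment> \<open>The two inner sums collapse to the left, because \<open>\<sigma>\<close> needs
      torus words in the first two tensor factors; the two outer ones collapse to the right, because
      the inverse form needs them in the last two.\<close>
    also have "\<dots> = wsum w (\<lambda>x e. wsum x (\<lambda>x d. wsum x (\<lambda>x c.
        smul (word_form r (left_torus x) (antipode_word x) * inverse (word_form r (antipode_word d) e)) (word_antipode c))))"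
      by (subst wsum_left_torus') (simp_all add: zero smul_zero_left)
    also have "\<dots> = wsum w (\<lambda>x e. wsum x (\<lambda>x d.
        smul (word_form r (left_torus (left_torus x)) (antipode_word (left_torus x)) * inverse (word_form r (antipode_word d) e)) (word_antipode x)))"
      by (subst wsum_left_torus') (simp_all add: zero smul_zero_left)
    also have "\<dots> = wsum w (\<lambda>x e.
        smul (word_form r (left_torus (left_torus x)) (antipode_word (left_torus x)) * inverse (word_form r (antipode_word (right_torus x)) e)) (word_antipode x))"
      by (subst wsum_right_torus') (simp_all add: zero smul_zero_left)
    also have "\<dots> = 
        smul (word_form r (left_torus (left_torus w)) (antipode_word (left_torus w)) * inverse (word_form r (antipode_word (right_torus w)) (right_torus w))) (word_antipode w)"
      by (subst wsum_right_torus') (simp_all add: zero smul_zero_left)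
    also have "word_form r (left_torus (left_torus w)) (antipode_word (left_torus w)) =
        inverse (bichar r (left_weight w) (left_weight w))"
    proof -
      have "torus_weight (antipode_word (left_torus w)) = (\<lambda>j. - left_weight w j)"
        using weight_antipode_word(1)[of "left_torus w"]
        by (simp add: weight_torus_word flip: left_weight_def)
      then show ?thesis
        by (simp add: word_form_def left_torus_id bichar_simps flip: left_weight_def)
    qed
    also have "inverse (word_form r (antipode_word (right_torus w)) (right_torus w)) =
        bichar r (right_weight w) (right_weight w)"
    proof -
      have "torus_weight (antipode_word (right_torus w)) = (\<lambda>j. - right_weight w j)"
        using weight_antipode_word(1)[of "right_torus w"]
        by (simp add: weight_torus_word right_weight_def right_torus_id)
      then show ?thesis
        by (simp add: word_form_def bichar_simps flip: right_weight_def)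
    qed
    finally show "wpow 4 w g = smul (antipode_scalar w) (word_antipode w)"
      by (simp add: antipode_scalar_def)
  qed
  finally show ?thesis .
qed

end

end

section \<open>Rescaling words\<close>

lemma weight_gen :
  "left_weight [E i] = (\<lambda>k. if k = i then 1 else 0)" "right_weight [E i] = (\<lambda>k. 0)"
  "left_weight [F i] = (\<lambda>k. 0)" "right_weight [F i] = (\<lambda>k. if k = i then 1 else 0)"
  "left_weight [K i] = (\<lambda>k. if k = i then 1 else 0)" "right_weight [K i] = (\<lambda>k. if k = i then 1 else 0)"
  "left_weight [K_inv i] = (\<lambda>k. if k = i then -1 else 0)" "right_weight [K_inv i] = (\<lambda>k. if k = i then -1 else 0)"
  "left_weight [K' i] = (\<lambda>k. if k = i then 1 else 0)" "right_weight [K' i] = (\<lambda>k. if k = i then 1 else 0)"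
  "left_weight [K'_inv i] = (\<lambda>k. if k = i then -1 else 0)" "right_weight [K'_inv i] = (\<lambda>k. if k = i then -1 else 0)"
  by (simp_all add: left_weight_def right_weight_def torus_weight_Cons cong: if_cong)

lemma weight_Cons:
  "left_weight (x # w) = (\<lambda>j. left_weight [x] j + left_weight w j)"
  "right_weight (x # w) = (\<lambda>j. right_weight [x] j + right_weight w j)"
  using weight_append[of "[x]" w] by simp_all

lemma weight_gen_Cons:
  "left_weight (E i # w) = (\<lambda>k. (if k = i then 1 else 0) + left_weight w k)" "right_weight (E i # w) = right_weight w"
  "left_weight (F i # w) = left_weight w" "right_weight (F i # w) = (\<lambda>k. (if k = i then 1 else 0) + right_weight w k)"
  "left_weight (K i # w) = (\<lambda>k. (if k = i then 1 else 0) + left_weight w k)"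
  "right_weight (K i # w) = (\<lambda>k. (if k = i then 1 else 0) + right_weight w k)"
  "left_weight (K' i # w) = (\<lambda>k. (if k = i then 1 else 0) + left_weight w k)"
  "right_weight (K' i # w) = (\<lambda>k. (if k = i then 1 else 0) + right_weight w k)"
  by (subst weight_Cons, simp add: weight_gen)+

text \<open>The outer weights of a coproduct term are those of the word, and the two inner ones
  agree. In products of twists over both tensor factors the inner contributions therefore
  cancel.\<close>

lemma word_comult_weights:
  "(u, v) \<in> set (word_comult w) \<Longrightarrow>
    left_weight u = left_weight w \<and> right_weight v = right_weight w \<and> right_weight u = left_weight v"
proof (induction w arbitrary: u v rule: word_induct)
  case (E i w)
  from E.prems consider u' where "u = E i # u'" "(u', v) \<in> set (word_comult w)"
    | u' v' where "u = K i # u'" "v = E i # v'" "(u', v') \<in> set (word_comult w)"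
    by auto
  then show ?case
    by cases (use E.IH in \<open>force simp: weight_gen_Cons\<close>)+
next
  case (F i w)
  from F.prems consider v' where "v = F i # v'" "(u, v') \<in> set (word_comult w)"
    | u' v' where "u = F i # u'" "v = K' i # v'" "(u', v') \<in> set (word_comult w)"
    by auto
  then show ?case
    by cases (use F.IH in \<open>force simp: weight_gen_Cons\<close>)+
next
  case (torus x w)
  then obtain u' v' where uv: "u = x # u'" "v = x # v'" "(u', v') \<in> set (word_comult w)"
    by (cases x) auto
  have "left_weight [x] = right_weight [x]" using torus(1) by (simp add: weight_torus_word)
  then show ?case
    using torus.IH[OF uv(3)] unfolding uv weight_Cons[of x u'] weight_Cons[of x v'] weight_Cons[of x w] by simp
qed simp

text \<open>By bimultiplicativity this is the product of \<open>twist\<close> over all pairs of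
  letters in their order; \<open>wscalar_append\<close> says that \<open>twist\<close> is its
  coboundary.\<close>

primrec wscalar :: "('i::finite \<Rightarrow> 'i \<Rightarrow> 'k::field) \<Rightarrow> 'i gen list \<Rightarrow> 'k" where
  "wscalar r [] = 1"
| "wscalar r (x # w) = twist r [x] w * wscalar r w"

definition rescale :: "('i::finite \<Rightarrow> 'i \<Rightarrow> 'k::field) \<Rightarrow> ('i gen list \<Rightarrow>\<^sub>0 'k) \<Rightarrow> 'i gen list \<Rightarrow>\<^sub>0 'k" where
  "rescale r = lext (\<lambda>w. smul (wscalar r w) (wmon w))"

lemma rescale_simps:
  shows rescale_add: "rescale r (a + b) = rescale r a + rescale r b"
    and rescale_diff: "rescale r (a - b) = rescale r a - rescale r b"
    and rescale_smul: "rescale r (smul c a) = smul c (rescale r a)"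
    and rescale_wmon: "rescale r (wmon w) = smul (wscalar r w) (wmon w)"
    and rescale_sum: "rescale r (\<Sum>x\<in>B. f x) = (\<Sum>x\<in>B. rescale r (f x))"
    and rescale_zero: "rescale r 0 = 0"
  by (simp_all add: rescale_def lext_add lext_diff lext_smul lext_sum)

lemma rescale_one: "rescale r 1 = 1"
  using rescale_wmon[of r "[]"] by (simp add: wmon_Nil smul_one)

lemma lext_rescale: "lext f (rescale r a) = lext (\<lambda>w. smul (wscalar r w) (f w)) a"
  by (simp add: rescale_def lext_lext lext_smul)

text \<open>The word \<open>w\<close> only stands for its bidegree.\<close>

definition homogeneous :: "'i gen list \<Rightarrow> ('i gen list \<Rightarrow>\<^sub>0 'k::field) \<Rightarrow> bool" where
  "homogeneous w a \<longleftrightarrow>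
     (\<forall>v\<in>Poly_Mapping.keys a. left_weight v = left_weight w \<and> right_weight v = right_weight w)"

lemma homogeneous_diff: "homogeneous w a \<Longrightarrow> homogeneous w b \<Longrightarrow> homogeneous w (a - b)"
  unfolding homogeneous_def by (auto simp: in_keys_iff lookup_minus)

lemma homogeneous_add: "homogeneous w a \<Longrightarrow> homogeneous w b \<Longrightarrow> homogeneous w (a + b)"
  unfolding homogeneous_def by (auto simp: in_keys_iff lookup_add)

lemma homogeneous_zero: "homogeneous w 0"
  by (simp add: homogeneous_def)

lemma homogeneous_smul: "homogeneous w a \<Longrightarrow> homogeneous w (smul c a)"
  unfolding homogeneous_def by (auto simp: in_keys_iff lookup_smul)

lemma homogeneous_sum: "(\<And>x. x \<in> B \<Longrightarrow> homogeneous w (f x)) \<Longrightarrow> homogeneous w (\<Sum>x\<in>B. f x)"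
  by (induction B rule: infinite_finite_induct) (auto intro: homogeneous_zero homogeneous_add)

lemma homogeneous_wmon: "left_weight v = left_weight w \<Longrightarrow> right_weight v = right_weight w \<Longrightarrow> homogeneous w (wmon v)"
  by (simp add: homogeneous_def wmon_def)

lemma gn_power: "gn x ^ n = wmon (replicate n x)"
  by (induction n) (simp_all add: wmon_Nil wmon_Cons)

lemma weight_replicate: "left_weight (replicate n x) = (\<lambda>j. int n * left_weight [x] j)"
  "right_weight (replicate n x) = (\<lambda>j. int n * right_weight [x] j)"
proof (induction n)
  case (Suc n)
  {
    case 1
    show ?case using Suc weight_Cons(1)[of x "replicate n x"] by (simp add: algebra_simps)
  next
    case 2
    show ?case using Suc weight_Cons(2)[of x "replicate n x"] by (simp add: algebra_simps)
  }
qed simp_all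

lemma serre_coeff_mult: "serre_coeff q c n k * d ^ k = serre_coeff q (c * d) n k"
  by (simp add: serre_coeff_def power_mult_distrib)

section \<open>Twists and scalars of words\<close>

context
  fixes r :: "'i::finite \<Rightarrow> 'i \<Rightarrow> 'k::field"
  assumes r_nonzero: "\<And>i j. r i j \<noteq> 0"
begin

lemmas bichar_add = bichar_add_left[of r, OF r_nonzero] bichar_add_right[of r, OF r_nonzero]
lemmas bichar_nz = bichar_nonzero[of r, OF r_nonzero]

lemma twist_append: "twist r (u @ u') v = twist r u v * twist r u' v" "twist r u (v @ v') = twist r u v * twist r u v'"
  by (simp_all add: twist_def weight_append bichar_add)

lemma twist_Nil: "twist r [] v = 1" "twist r u [] = 1"
  by (simp_all add: twist_def)

lemma twist_nonzero: "twist r u v \<noteq> 0"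
  by (simp add: twist_def bichar_nz)

lemma twist_torus: "torus_word u \<Longrightarrow> torus_word v \<Longrightarrow> twist r u v = 1"
  by (simp add: twist_def weight_torus_word bichar_nz)

text \<open>This makes the unchanged coproduct multiplicative for the deformed product.\<close>

lemma twist_comult:
  assumes "(u, v) \<in> set (word_comult w)" "(u', v') \<in> set (word_comult w')"
  shows "twist r u u' * twist r v v' = twist r w w'"
  using word_comult_weights[OF assms(1)] word_comult_weights[OF assms(2)]
  by (simp add: twist_def bichar_nz)

lemma twist_replicate: "twist r (replicate n x) v = twist r [x] v ^ n" "twist r v (replicate n x) = twist r v [x] ^ n"
proof (induction n)
  case (Suc n)
  {
    case 1
    show ?case using Suc twist_append(1)[of "[x]" "replicate n x" v] by simp
  next
    case 2
    show ?case using Suc twist_append(2)[of v "[x]" "replicate n x"] by simp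
  }
qed (simp_all add: twist_Nil)

lemma twist_gens:
  "twist r [K i] [E j] = r i j" "twist r [E i] [K_inv j] = inverse (r i j)" "twist r [K i] [F j] = inverse (r i j)"
  "twist r [F i] [K_inv j] = r i j" "twist r [E i] [F j] = 1" "twist r [F i] [E j] = 1"
  "twist r [K' i] [E j] = r i j" "twist r [E i] [K'_inv j] = inverse (r i j)" "twist r [K' i] [F j] = inverse (r i j)"
  "twist r [F i] [K'_inv j] = r i j" "twist r [E i] [E j] = r i j" "twist r [F i] [F j] = inverse (r i j)"
  "twist r [K_inv i] [E j] = inverse (r i j)"
  by (simp_all add: twist_def weight_gen bichar_single power_int_minus)

lemma wscalar_nonzero: "wscalar r w \<noteq> 0"
  by (induction w) (simp_all add: twist_nonzero)

lemma wscalar_append: "wscalar r (u @ v) = wscalar r u * wscalar r v * twist r u v"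
proof (induction u)
  case (Cons x u)
  then show ?case using twist_append(1)[of "[x]" u v] by (simp add: twist_append(2))
qed (simp add: twist_Nil)

lemma wscalar_torus: "torus_word w \<Longrightarrow> wscalar r w = 1"
  by (induction w) (simp_all add: twist_torus)

lemma wscalar_short:
  "wscalar r [x] = 1" "wscalar r [x, y] = twist r [x] [y]"
  "wscalar r [x, y, z] = twist r [x] [y] * twist r [x] [z] * twist r [y] [z]"
  using twist_append(2)[of "[x]" "[y]" "[z]"] by (simp_all add: twist_Nil)

lemma mult_swap: "a * b * (c * d) = a * c * (b * d)" for a :: 'k
  by (simp add: mult_ac)

text \<open>Makes the rescaling compatible with coproducts, so that the isomorphism is a coalgebra
  map.\<close>

lemma wscalar_comult: "(u, v) \<in> set (word_comult w) \<Longrightarrow> wscalar r u * wscalar r v = wscalar r w"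
proof (induction w arbitrary: u v rule: word_induct)
  case (E i w)
  note weights = word_comult_weights
  from E.prems consider u' where "u = E i # u'" "(u', v) \<in> set (word_comult w)"
    | u' v' where "u = K i # u'" "v = E i # v'" "(u', v') \<in> set (word_comult w)"
    by auto
  then show ?case
  proof cases
    case 1
    then show ?thesis using E.IH[OF 1(2)] weights[OF 1(2)] by (simp add: twist_def weight_gen)
  next
    case 2
    \<comment> \<open>The right weight of \<open>u'\<close> equals the left weight of
      \<open>v'\<close>, so what they contribute cancels.\<close>
    have "twist r [K i] u' * twist r [E i] v' = twist r [E i] w"
      using weights[OF 2(3)] by (simp add: twist_def weight_gen bichar_nz flip: mult.assoc)
    then show ?thesis
      using E.IH[OF 2(3)] unfolding 2(1,2) wscalar.simps by (subst mult_swap) simp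
  qed
next
  case (F i w)
  note weights = word_comult_weights
  from F.prems consider v' where "v = F i # v'" "(u, v') \<in> set (word_comult w)"
    | u' v' where "u = F i # u'" "v = K' i # v'" "(u', v') \<in> set (word_comult w)"
    by auto
  then show ?case
  proof cases
    case 1
    then show ?thesis using F.IH[OF 1(2)] weights[OF 1(2)] by (simp add: twist_def weight_gen)
  next
    case 2
    have "twist r [F i] u' * twist r [K' i] v' = twist r [F i] w"
      using weights[OF 2(3)] by (simp add: twist_def weight_gen bichar_nz flip: mult.assoc)
    then show ?thesis
      using F.IH[OF 2(3)] unfolding 2(1,2) wscalar.simps by (subst mult_swap) simp
  qed
next
  case (torus x w)
  then obtain u' v' where uv: "u = x # u'" "v = x # v'" "(u', v') \<in> set (word_comult w)"
    by (cases x) auto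
  have "left_weight [x] = right_weight [x]" using torus(1) by (simp add: weight_torus_word)
  then have "twist r [x] u' * twist r [x] v' = twist r [x] w"
    using word_comult_weights[OF uv(3)] by (simp add: twist_def bichar_nz)
  then show ?case using torus.IH[OF uv(3)] unfolding uv wscalar.simps by (subst mult_swap) simp
qed simp

text \<open>The position of \<open>y\<close> enters only through powers of two twists. This is why
  all terms of a Serre element are rescaled in a geometric pattern.\<close>

lemma wscalar_replicate:
  "wscalar r (replicate a x @ [y] @ replicate b x) =
    wscalar r (replicate (a + b) x) * twist r [x] [y] ^ a * twist r [y] [x] ^ b"
  by (simp only: replicate_add wscalar_append twist_append twist_replicate wscalar_short) simp

text \<open>The twists of the surrounding words with a term of \<open>a\<close> depend only on its
  bidegree, so they come out as one scalar for all terms.\<close>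

lemma rescale_homogeneous:
  assumes "homogeneous w a"
  shows "\<exists>c. rescale r (wmon u * a * wmon v) = smul c (wmon u * rescale r a * wmon v)"
proof -
  define c where "c = wscalar r u * wscalar r v * twist r u w * twist r u v * twist r w v"
  have "wmon u * a * wmon v = lext (\<lambda>z. wmon (u @ z @ v)) a"
    by (simp add: lext_fun_mult_left lext_fun_mult_right lext_wmon_id wmon_append mult.assoc)
  then have "rescale r (wmon u * a * wmon v) = lext (\<lambda>z. smul (wscalar r (u @ z @ v)) (wmon (u @ z @ v))) a"
    by (simp add: rescale_def lext_lext)
  also have "\<dots> = lext (\<lambda>z. smul c (wmon u * smul (wscalar r z) (wmon z) * wmon v)) a"
  proof (rule lext_cong)
    fix z assume "z \<in> Poly_Mapping.keys a"
    then have "left_weight z = left_weight w" "right_weight z = right_weight w"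
      using assms by (auto simp: homogeneous_def)
    then have "twist r u z = twist r u w" "twist r z v = twist r w v"
      by (simp_all add: twist_def)
    then show "smul (wscalar r (u @ z @ v)) (wmon (u @ z @ v)) = smul c (wmon u * smul (wscalar r z) (wmon z) * wmon v)"
      by (simp add: wscalar_append twist_append c_def smul_simps wmon_append mult_ac mult.assoc)
  qed
  also have "\<dots> = smul c (wmon u * rescale r a * wmon v)"
    by (simp add: rescale_def lext_fun_smul lext_fun_mult_left lext_fun_mult_right)
  finally show ?thesis by blast
qed

section \<open>Rescaling maps one ideal of relations into the other\<close>

lemma rescale_ideal:
  fixes q q' :: "'i \<Rightarrow> 'i \<Rightarrow> 'k"
  assumes q': "\<And>i j. q' i j = q i j * r j i / r i j" and a: "a \<in> uq_ideal A q"
  shows "rescale r a \<in> uq_ideal A q'"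
proof -
  let ?I = "uq_ideal A q'"
  note I = two_sided_uq_ideal[of A q']
  \<comment> \<open>Rescaling is not multiplicative, so the preimage of the ideal is not evidently
    an ideal; multiplication by words on both sides is therefore built into
    \<open>S\<close>.\<close>
  define S where "S = {a. \<forall>u v. rescale r (wmon u * a * wmon v) \<in> ?I}"
  have S: "two_sided S"
    unfolding two_sided_def
  proof (intro conjI ballI allI)
    show "0 \<in> S" by (simp add: S_def rescale_zero two_sided_zero[OF I])
    show "a + b \<in> S" if "a \<in> S" "b \<in> S" for a b
      using that by (simp add: S_def distrib_left distrib_right rescale_add two_sided_add[OF I])
    have words: "wmon w * a \<in> S" "a * wmon w \<in> S" if "a \<in> S" for a w
    proof -
      have "wmon u * (wmon w * a) * wmon v = wmon (u @ w) * a * wmon v"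
        "wmon u * (a * wmon w) * wmon v = wmon u * a * wmon (w @ v)" for u v
        by (simp_all add: wmon_append mult.assoc)
      then show "wmon w * a \<in> S" "a * wmon w \<in> S"
        using that by (simp_all add: S_def)
    qed
    have smul: "smul c a \<in> S" if "a \<in> S" for a c
      using that by (simp add: S_def smul_simps rescale_smul two_sided_smul[OF I])
    have add: "a + b \<in> S" if "a \<in> S" "b \<in> S" for a b
      using that by (simp add: S_def distrib_left distrib_right rescale_add two_sided_add[OF I])
    show "t * a \<in> S" if "a \<in> S" for a t
      by (induction t rule: poly_mapping_linear_induct)
        (simp_all add: single_eq_wmon smul_mult distrib_right smul words that add)
    show "a * t \<in> S" if "a \<in> S" for a t
      by (induction t rule: poly_mapping_linear_induct)
        (simp_all add: single_eq_wmon mult_smul distrib_left smul words that add)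
  qed
  have in_S: "a \<in> S" if "homogeneous w a" "rescale r a \<in> ?I" for a w
  proof -
    have "rescale r (wmon u * a * wmon v) \<in> ?I" for u v
    proof -
      obtain c where "rescale r (wmon u * a * wmon v) = smul c (wmon u * rescale r a * wmon v)"
        using rescale_homogeneous[OF \<open>homogeneous w a\<close>] by blast
      then show ?thesis
        using that(2) by (simp add: two_sided_smul[OF I] two_sided_left[OF I] two_sided_right[OF I])
    qed
    then show ?thesis by (simp add: S_def)
  qed
  have q_diag: "q' i i = q i i" for i by (simp add: q' r_nonzero)
  have rels: "b \<in> ?I" if "b \<in> uq_rels A q'" for b
    using that uq_rels_subset by blast
  have gn3: "gn x * gn y * gn z = wmon [x, y, z]" "gn x * gn y = wmon [x, y]" for x y z :: "'i gen"
    by (simp_all add: wmon_Cons wmon_Nil mult.assoc)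
  note hom = homogeneous_diff homogeneous_smul homogeneous_wmon
  have inverse: "gn x * gn y - 1 \<in> S"
    if "gn x * gn y - 1 \<in> ?I" "is_torus x" "is_torus y" "(\<lambda>j. gen_weight x j + gen_weight y j) = (\<lambda>j. 0)" for x y
  proof (rule in_S)
    show "homogeneous [] (gn x * gn y - 1)"
      unfolding gn3 wmon_Nil[symmetric] using that
      by (intro hom) (simp_all add: weight_torus_word torus_weight_Cons)
    show "rescale r (gn x * gn y - 1) \<in> ?I"
      using that by (simp add: gn3 rescale_simps rescale_one wscalar_short twist_torus smul_one del: wscalar.simps)
  qed
  have conj: "gn x * gn y * gn z - scal c * gn y \<in> S"
    if rel: "gn x * gn y * gn z - scal c' * gn y \<in> ?I" and torus: "is_torus x" "is_torus z"
      and weights: "(\<lambda>j. gen_weight x j + gen_weight z j) = (\<lambda>j. 0)"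
      and c: "c = twist r [x] [y] * twist r [y] [z] * c'" for x y z c c'
  proof (rule in_S)
    have "left_weight [x] = gen_weight x" "left_weight [z] = gen_weight z"
      "right_weight [x] = gen_weight x" "right_weight [z] = gen_weight z"
      using torus by (simp_all add: weight_torus_word torus_weight_Cons)
    then have "left_weight [x, y, z] = left_weight [y]" "right_weight [x, y, z] = right_weight [y]"
      using weights by (simp_all add: weight_Cons[of _ "_ # _"] fun_eq_iff)
    then show "homogeneous [y] (gn x * gn y * gn z - scal c * gn y)"
      unfolding gn3(1) scal_mult unfolding gn_def by (intro hom) simp_all
    have "rescale r (gn x * gn y * gn z - scal c * gn y) =
        smul (twist r [x] [y] * twist r [y] [z]) (gn x * gn y * gn z - scal c' * gn y)"
      unfolding gn3(1) scal_mult c unfolding gn_def using torus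
      by (simp add: rescale_simps wscalar_short twist_torus smul_simps mult_ac del: wscalar.simps)
    then show "rescale r (gn x * gn y * gn z - scal c * gn y) \<in> ?I"
      using rel by (simp add: two_sided_smul[OF I])
  qed
  have "uq_rels A q \<subseteq> S"
  proof
    fix b assume "b \<in> uq_rels A q"
    then show "b \<in> S"
    proof cases
      case (torus_comm x y)
      show ?thesis
      proof (rule in_S)
        show "homogeneous [x, y] b"
          unfolding torus_comm(1) gn3 using torus_comm(2,3)
          by (intro hom) (simp_all add: weight_torus_word torus_weight_Cons add.commute)
        show "rescale r b \<in> ?I"
          using rels[OF uq_rels.torus_comm[OF torus_comm(2,3)]] torus_comm(2,3)
          by (simp add: torus_comm(1) gn3 rescale_simps wscalar_short twist_torus smul_one)
      qed
    next
      case (K_right_inv i)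
      show ?thesis
        unfolding K_right_inv by (rule inverse[OF rels[OF uq_rels.K_right_inv]]) (simp_all add: fun_eq_iff)
    next
      case (K_left_inv i)
      show ?thesis
        unfolding K_left_inv by (rule inverse[OF rels[OF uq_rels.K_left_inv]]) (simp_all add: fun_eq_iff)
    next
      case (Kp_right_inv i)
      show ?thesis
        unfolding Kp_right_inv by (rule inverse[OF rels[OF uq_rels.Kp_right_inv]]) (simp_all add: fun_eq_iff)
    next
      case (Kp_left_inv i)
      show ?thesis
        unfolding Kp_left_inv by (rule inverse[OF rels[OF uq_rels.Kp_left_inv]]) (simp_all add: fun_eq_iff)
    next
      case (K_E i j)
      show ?thesis
        unfolding K_E
        by (rule conj[OF rels[OF uq_rels.K_E[where i = i and j = j]]])
          (simp_all add: fun_eq_iff twist_gens q' r_nonzero field_simps)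
    next
      case (Kp_E i j)
      show ?thesis
        unfolding Kp_E
        by (rule conj[OF rels[OF uq_rels.Kp_E[where i = i and j = j]]])
          (simp_all add: fun_eq_iff twist_gens q' r_nonzero field_simps)
    next
      case (K_F i j)
      show ?thesis
        unfolding K_F
        by (rule conj[OF rels[OF uq_rels.K_F[where i = i and j = j]]])
          (simp_all add: fun_eq_iff twist_gens q' r_nonzero field_simps)
    next
      case (Kp_F i j)
      show ?thesis
        unfolding Kp_F
        by (rule conj[OF rels[OF uq_rels.Kp_F[where i = i and j = j]]])
          (simp_all add: fun_eq_iff twist_gens q' r_nonzero field_simps)
    next
      case (E_F i j)
      show ?thesis
      proof (rule in_S)
        \<comment> \<open>The product of \<open>E i\<close> and \<open>F i\<close> has the bidegree
          of \<open>K i\<close> and \<open>K' i\<close>, and the twists between \<open>E\<close> and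
          \<open>F\<close> are 1, so rescaling fixes this relation.\<close>
        have "homogeneous [E i, F j] (if i = j then scal (q i i / (q i i - 1)) * (gn (K i) - gn (K' i)) else 0)"
          by (auto simp: scal_mult gn_def weight_gen weight_Cons[of _ "_ # _"] intro!: hom homogeneous_zero)
        then show "homogeneous [E i, F j] b"
          unfolding E_F gn3(2)
          by (intro homogeneous_diff homogeneous_wmon) (simp_all add: weight_gen weight_Cons[of _ "_ # _"])
        have "rescale r b = gn (E i) * gn (F j) - gn (F j) * gn (E i)
            - (if i = j then scal (q' i i / (q' i i - 1)) * (gn (K i) - gn (K' i)) else 0)"
          unfolding E_F gn3(2) scal_mult unfolding gn_def
          by (auto simp: rescale_simps wscalar_short twist_gens smul_one q_diag simp del: wscalar.simps)
        then show "rescale r b \<in> ?I" using rels[OF uq_rels.E_F] by simp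
      qed
    next
      case (serre_E i j n)
      have b: "b = (\<Sum>k\<le>n. smul (serre_coeff (q i i) (q i j) n k)
          (wmon (replicate (n - k) (E i) @ [E j] @ replicate k (E i))))"
        unfolding serre_E(1) serre_E_eq serre_def by (simp add: gn_power wmon_append wmon_Cons mult.assoc)
      show ?thesis
      proof (rule in_S)
        show "homogeneous (replicate n (E i) @ [E j]) b"
          unfolding b
          by (intro homogeneous_sum hom) (auto simp: weight_append weight_replicate weight_gen weight_gen_Cons of_nat_diff algebra_simps fun_eq_iff)
        have "rescale r b = smul (wscalar r (replicate n (E i)) * r i j ^ n)
            (serre (*) (q' i i) (q' i j) n (gn (E i)) (gn (E j)))"
        proof -
          have "serre_coeff (q i i) (q i j) n k * wscalar r (replicate (n - k) (E i) @ [E j] @ replicate k (E i)) =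
              wscalar r (replicate n (E i)) * r i j ^ n * serre_coeff (q' i i) (q' i j) n k" if "k \<le> n" for k
          proof -
            \<comment> \<open>Moving one letter \<open>E i\<close> past \<open>E j\<close> changes
              the scalar by \<open>r j i / r i j\<close>, which is exactly the factor that turns
              \<open>q i j\<close> into \<open>q' i j\<close>.\<close>
            have "r i j ^ (n - k) * r j i ^ k = r i j ^ n * (r j i / r i j) ^ k"
              using that by (simp add: r_nonzero power_diff power_divide)
            then show ?thesis
              unfolding wscalar_replicate twist_gens q_diag q' times_divide_eq_right[symmetric]
                serre_coeff_mult[symmetric]
              using that by (simp add: mult_ac)
          qed
          then show ?thesis
            unfolding b serre_def smul_sum rescale_sum
            by (intro sum.cong refl)
              (simp add: rescale_simps smul_smul, simp add: gn_power wmon_append wmon_Cons mult.assoc)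
        qed
        then show "rescale r b \<in> ?I"
          using rels[OF uq_rels.serre_E[where A = A and q = q' and i = i and j = j and n = n, OF serre_E(2,3)]] two_sided_smul[OF I]
          unfolding serre_E_eq by simp
      qed
    next
      case (serre_F i j n)
      have b: "b = (\<Sum>k\<le>n. smul (serre_coeff (q i i) (q i j) n k)
          (wmon (replicate k (F i) @ [F j] @ replicate (n - k) (F i))))"
        unfolding serre_F(1) serre_F_eq serre_def by (simp add: gn_power wmon_append wmon_Cons mult.assoc)
      show ?thesis
      proof (rule in_S)
        show "homogeneous (replicate n (F i) @ [F j]) b"
          unfolding b
          by (intro homogeneous_sum hom) (auto simp: weight_append weight_replicate weight_gen weight_gen_Cons of_nat_diff algebra_simps fun_eq_iff)
        have "rescale r b = smul (wscalar r (replicate n (F i)) * inverse (r j i) ^ n)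
            (serre (\<lambda>a b. b * a) (q' i i) (q' i j) n (gn (F i)) (gn (F j)))"
        proof -
          have "serre_coeff (q i i) (q i j) n k * wscalar r (replicate k (F i) @ [F j] @ replicate (n - k) (F i)) =
              wscalar r (replicate n (F i)) * inverse (r j i) ^ n * serre_coeff (q' i i) (q' i j) n k" if "k \<le> n" for k
          proof -
            \<comment> \<open>Twists of \<open>F\<close> letters are inverse to those of
              \<open>E\<close> letters, but the Serre relation has them in the opposite order, so
              the ratio per step is again \<open>r j i / r i j\<close>.\<close>
            have "inverse (r i j) ^ k * inverse (r j i) ^ (n - k) = inverse (r j i) ^ n * (r j i / r i j) ^ k"
              using that by (simp add: r_nonzero power_diff power_divide divide_simps)
            then show ?thesis
              unfolding wscalar_replicate twist_gens q_diag q' times_divide_eq_right[symmetric]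
                serre_coeff_mult[symmetric]
              using that by (simp add: mult_ac)
          qed
          then show ?thesis
            unfolding b serre_def smul_sum rescale_sum
            by (intro sum.cong refl)
              (simp add: rescale_simps smul_smul, simp add: gn_power wmon_append wmon_Cons mult.assoc)
        qed
        then show "rescale r b \<in> ?I"
          using rels[OF uq_rels.serre_F[where A = A and q = q' and i = i and j = j and n = n, OF serre_F(2,3)]] two_sided_smul[OF I]
          unfolding serre_F_eq by simp
      qed
    qed
  qed
  then have "a \<in> S" using uq_ideal_minimal[OF S] a by blast
  then have "rescale r (wmon [] * a * wmon []) \<in> ?I" by (simp only: S_def mem_Collect_eq)
  then show ?thesis by (simp add: wmon_Nil)
qed

lemma rescale_eps: "eps (rescale r a) = eps a"
proof -
  have eq: "(\<lambda>w. wscalar r w * word_counit w) = word_counit"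
    by (simp add: word_counit_eq wscalar_torus fun_eq_iff)
  then show ?thesis
    by (simp add: rescale_def eps_def lin_form_lext lin_form_smul eq)
qed

end

lemma twist_inverse: "twist (\<lambda>i j. inverse (r i j)) u v = inverse (twist r u v)"
  by (simp add: twist_def bichar_inverse)

lemma wscalar_inverse: "wscalar (\<lambda>i j. inverse (r i j)) w = inverse (wscalar r w)"
  by (induction w) (simp_all add: twist_inverse)

lemma rescale_rescale_inverse:
  assumes "\<And>i j. r i j \<noteq> 0"
  shows "rescale r (rescale (\<lambda>i j. inverse (r i j)) a) = a" "rescale (\<lambda>i j. inverse (r i j)) (rescale r a) = a"
proof -
  have "wscalar r w \<noteq> 0" for w using assms by (rule wscalar_nonzero)
  then show "rescale r (rescale (\<lambda>i j. inverse (r i j)) a) = a" "rescale (\<lambda>i j. inverse (r i j)) (rescale r a) = a"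
    by (simp_all add: rescale_def lext_lext lext_smul smul_smul wscalar_inverse smul_one lext_wmon_id)
qed

section \<open>The isomorphism\<close>

text \<open>The parameters \<open>p\<close> belong to the algebra that is deformed, to which the
  unqualified names refer, and \<open>q\<close> to the multiparameter algebra. Rescaling by
  \<open>r\<close> leads from the second to the first.\<close>

locale uq_twisted = uq_form A p r + Q: uq A q
  for A :: "'i::finite \<Rightarrow> 'i \<Rightarrow> int" and p q r :: "'i \<Rightarrow> 'i \<Rightarrow> 'k::field" +
  fixes \<sigma>
  assumes p_q: "p i j = q i j * r j i / r i j" and \<sigma>: "is_form \<sigma>"
begin

abbreviation "D \<equiv> deformation U \<sigma>"

abbreviation "r' \<equiv> \<lambda>i j. inverse (r i j)"

lemmas wscalar_rules = wscalar_nonzero[of r, OF r_nonzero] wscalar_append[of r, OF r_nonzero]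
  wscalar_torus[of r, OF r_nonzero] wscalar_comult[of r, OF r_nonzero]
lemmas rescale_inverse = rescale_rescale_inverse[of r, OF r_nonzero]

lemma rescale_in_ideal: "a \<in> Q.I \<Longrightarrow> rescale r a \<in> I"
  by (rule rescale_ideal[where r = r and q = q and q' = p]) (simp_all add: r_nonzero p_q)

lemma rescale_inverse_in_ideal: "a \<in> I \<Longrightarrow> rescale r' a \<in> Q.I"
  by (rule rescale_ideal[where r = r' and q = p and q' = q]) (simp_all add: r_nonzero p_q field_simps)

lemma D_carrier: "carrier D = carrier U"
  and D_zero: "\<zero>\<^bsub>D\<^esub> = \<zero>\<^bsub>U\<^esub>"
  and D_one: "\<one>\<^bsub>D\<^esub> = \<one>\<^bsub>U\<^esub>"
  and D_add: "(\<oplus>\<^bsub>D\<^esub>) = (\<oplus>\<^bsub>U\<^esub>)"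
  and D_smult: "(\<odot>\<^bsub>D\<^esub>) = (\<odot>\<^bsub>U\<^esub>)"
  and D_comult: "comult D = comult U"
  and D_counit: "counit D = counit U"
  and D_mult: "(\<otimes>\<^bsub>D\<^esub>) = deformed_mult U \<sigma>"
  and D_antipode: "antipode D = deformed_antipode U \<sigma>"
  by (simp_all add: deformation_def)

lemma D_lin_sum: "lin_sum D f t = lin_sum U f t"
  by (simp add: lin_sum_def finsum_def finprod_def D_carrier D_zero D_add D_smult)

lemma D_tensor_eq: "tensor_eq D = tensor_eq U"
proof -
  have "multilin_rels D = multilin_rels U"
  proof (intro equalityI subsetI)
    fix t assume "t \<in> multilin_rels D"
    then show "t \<in> multilin_rels U"
      by cases (auto simp: D_carrier D_add D_smult intro: multilin_rels.intros[simplified])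
  next
    fix t assume "t \<in> multilin_rels U"
    then show "t \<in> multilin_rels D"
      using multilin_rels.add[of _ D] multilin_rels.smult[of _ D]
      by cases (auto simp: D_carrier D_add D_smult)
  qed
  then show ?thesis by (intro ext) (simp add: tensor_eq_def)
qed

text \<open>Coordinates on the deformation in which its product is that of the free algebra. The
  isomorphism will send \<open>Q.cls a\<close> to \<open>rcls a\<close>.\<close>

definition rcls :: "('i gen list \<Rightarrow>\<^sub>0 'k) \<Rightarrow> ('i gen list \<Rightarrow>\<^sub>0 'k) set" where
  "rcls a = cls (rescale r a)"

text \<open>By \<open>wscalar_append\<close> the twist in \<open>star\<close> is the failure of the
  rescaling to be multiplicative.\<close>

lemma star_rescale: "star (rescale r a) (rescale r b) = rescale r (a * b)"
proof (induction a rule: poly_mapping_linear_induct)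
  case (single w c)
  show ?case
  proof (induction b rule: poly_mapping_linear_induct)
    case (single w' c')
    show ?case
      by (simp add: single_eq_wmon star_def rescale_simps lext_smul smul_simps wscalar_rules mult_ac flip: wmon_append)
  qed (simp add: single_eq_wmon star_def rescale_simps lext_smul lext_add smul_simps distrib_left)
qed (simp add: star_def rescale_simps lext_add distrib_right)

lemma rcls_ops:
  "rcls a \<otimes>\<^bsub>D\<^esub> rcls b = rcls (a * b)" "rcls a \<oplus>\<^bsub>D\<^esub> rcls b = rcls (a + b)" "c \<odot>\<^bsub>D\<^esub> rcls a = rcls (smul c a)"
  "\<one>\<^bsub>D\<^esub> = rcls 1" "\<zero>\<^bsub>D\<^esub> = rcls 0"
  by (simp_all add: rcls_def D_mult D_add D_smult D_one D_zero deformed_mult_class[OF \<sigma>] star_rescale Uq_ops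
      rescale_simps rescale_one)

lemma rcls_carrier [simp]: "rcls a \<in> carrier D"
  by (simp add: rcls_def D_carrier)

lemma rcls_cases:
  assumes "x \<in> carrier D"
  obtains a where "x = rcls a" "coset_rep x = rescale r a"
proof
  show "coset_rep x = rescale r (rescale r' (coset_rep x))"
    by (simp add: rescale_inverse)
  then show "x = rcls (rescale r' (coset_rep x))"
    using assms by (simp add: rcls_def D_carrier class_coset_rep)
qed

text \<open>Well-definedness and injectivity of the isomorphism: one direction rescales by
  \<open>r\<close>, the other by its inverse.\<close>

lemma rcls_eq_iff: "rcls a = rcls b \<longleftrightarrow> Q.cls a = Q.cls b"
proof
  assume "rcls a = rcls b"
  then have "rescale r (a - b) \<in> I"
    by (simp add: rcls_def cls_eq_iff eqv_def rescale_simps)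
  then have "rescale r' (rescale r (a - b)) \<in> Q.I" by (rule rescale_inverse_in_ideal)
  then show "Q.cls a = Q.cls b" by (simp add: rescale_inverse Q.cls_eq_iff Q.eqv_def)
next
  assume "Q.cls a = Q.cls b"
  then have "rescale r (a - b) \<in> I"
    by (intro rescale_in_ideal) (simp add: Q.cls_eq_iff Q.eqv_def)
  then show "rcls a = rcls b"
    by (simp add: rcls_def cls_eq_iff eqv_def rescale_simps)
qed

text \<open>\<open>antipode_scalar\<close> is quadratic in the weights, so a new letter produces
  cross terms. They are accounted for by the twists of the letter with the rest of the word before
  and after the antipode. In consequence rescaling turns the antipode into the deformed one.\<close>

lemma wscalar_antipode_word: "wscalar r (antipode_word w) = wscalar r w * antipode_scalar w"
proof (induction w)
  case (Cons x w)
  let ?b = "bichar r"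
  note nz = bichar_nonzero[of r, OF r_nonzero]
  have gen: "wscalar r (gen_antipode_word x) = antipode_scalar [x]"
    by (cases x) (simp_all add: wscalar_short[where r = r, OF r_nonzero] antipode_scalar_def twist_gens[of r, OF r_nonzero]
        weight_gen bichar_single r_nonzero del: wscalar.simps)
  have "twist r (antipode_word w) (gen_antipode_word x) =
      ?b (right_weight w) (right_weight [x]) * inverse (?b (left_weight w) (left_weight [x]))"
    using weight_antipode_word[of w] weight_antipode_word[of "[x]"]
    by (simp add: twist_def antipode_word_Cons bichar_minus_left bichar_minus_right)
  then have "wscalar r (antipode_word (x # w)) = wscalar r w * antipode_scalar w * antipode_scalar [x] *
      (?b (right_weight w) (right_weight [x]) * inverse (?b (left_weight w) (left_weight [x])))"
    by (simp add: antipode_word_Cons wscalar_rules gen Cons.IH)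
  also have "\<dots> = twist r [x] w * wscalar r w * antipode_scalar (x # w)"
    unfolding antipode_scalar_def twist_def weight_Cons[of x w] bichar_simps
    using nz by (simp add: field_simps)
  finally show ?case by simp
qed (simp add: antipode_scalar_def)

lemma antipode_rcls: "antipode D (rcls a) = rcls (antip a)"
proof -
  have S: "rescale r (word_antipode w) = smul (wscalar r w * antipode_scalar w) (word_antipode w)" for w
    by (simp add: word_antipode_eq rescale_simps wscalar_antipode_word smul_smul mult_ac)
  have "rescale r (antip a) = lext (\<lambda>w. rescale r (word_antipode w)) a"
    by (simp add: antip_def rescale_def lext_lext)
  also have "\<dots> = lext (\<lambda>w. smul (antipode_scalar w) (word_antipode w)) (rescale r a)"
    by (simp add: S lext_rescale smul_smul)
  finally show ?thesis
    by (simp add: D_antipode rcls_def deformed_antipode_class[OF \<sigma>])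
qed

lemma clsw_rcls: "clsw w = rcls (smul (inverse (wscalar r w)) (wmon w))"
  by (simp add: rcls_def rescale_simps smul_smul wscalar_rules smul_one)

section \<open>The Hopf axioms for the deformation\<close>

lemma abelian_group_D: "abelian_group D"
proof (rule abelian_groupI)
  show "\<exists>y\<in>carrier D. y \<oplus>\<^bsub>D\<^esub> x = \<zero>\<^bsub>D\<^esub>" if x: "x \<in> carrier D" for x
  proof -
    obtain a where "x = rcls a" using x by (rule rcls_cases)
    then have "rcls (- a) \<oplus>\<^bsub>D\<^esub> x = \<zero>\<^bsub>D\<^esub>" by (simp add: rcls_ops)
    then show ?thesis by (intro bexI[of _ "rcls (- a)"]) simp_all
  qed
qed (auto simp: rcls_ops add_ac elim!: rcls_cases)

lemma ring_D: "ring D"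
  by (intro ringI abelian_group_D monoidI)
    (auto simp: rcls_ops mult.assoc distrib_left distrib_right elim!: rcls_cases)

lemma module_D: "module (ring_of_type_algebra :: 'k ring) D"
  by (intro moduleI cring_from_type_algebra abelian_group_D)
    (auto simp: rcls_ops smul_simps smul_add_left elim!: rcls_cases)

lemma comult_mult_D:
  assumes "x \<in> carrier U" "y \<in> carrier U"
  shows "tensor_eq U (comult U (deformed_mult U \<sigma> x y))
    (lext (\<lambda>xs. lext (\<lambda>ys. wmon [deformed_mult U \<sigma> (xs ! 0) (ys ! 0), deformed_mult U \<sigma> (xs ! 1) (ys ! 1)])
      (comult U y)) (comult U x))"
proof -
  let ?a = "coset_rep x" and ?b = "coset_rep y"
  let ?T = "lext (\<lambda>w. wsum w (\<lambda>u v. lext (\<lambda>w'. wsum w' (\<lambda>u' v'.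
      smul (twist r w w') (wmon [clsw (u @ u'), clsw (v @ v')]))) ?b)) ?a"
  have xy: "deformed_mult U \<sigma> x y = cls (star ?a ?b)"
    using deformed_mult_class[OF \<sigma>, of ?a ?b] assms by (simp add: class_coset_rep)
  have words: "deformed_mult U \<sigma> (clsw u) (clsw u') = twist r u u' \<odot>\<^bsub>U\<^esub> clsw (u @ u')" for u u' :: "'i gen list"
    by (simp add: deformed_mult_class[OF \<sigma>] star_def Uq_smult)
  have pair: "tensor_eq U (wmon [c \<odot>\<^bsub>U\<^esub> z, d \<odot>\<^bsub>U\<^esub> z']) (smul (c * d) (wmon [z, z']))"
    if "z \<in> carrier U" "z' \<in> carrier U" for c d z z'
    using tensor_eq_trans[OF tensor_eq_pair_smult(1)[of z U "d \<odot>\<^bsub>U\<^esub> z'" c]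
        tensor_eq_smul[OF tensor_eq_pair_smult(2)[of z' U z d], of c]] that
    by (simp add: Uq_simprules smul_smul)
  have "tensor_eq U (lext (\<lambda>xs. lext (\<lambda>ys. wmon [deformed_mult U \<sigma> (xs ! 0) (ys ! 0), deformed_mult U \<sigma> (xs ! 1) (ys ! 1)])
      (comult U y)) (comult U x)) ?T"
    unfolding lext_comult_Uq
  proof (intro tensor_eq_lext tensor_eq_wsum)
    fix w u v w' u' v' :: "'i gen list" assume "(u, v) \<in> set (word_comult w)" "(u', v') \<in> set (word_comult w')"
    then have "twist r u u' * twist r v v' = twist r w w'"
      by (rule twist_comult[of r, OF r_nonzero])
    then show "tensor_eq U (wmon [deformed_mult U \<sigma> ([clsw u, clsw v] ! 0) ([clsw u', clsw v'] ! 0),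
        deformed_mult U \<sigma> ([clsw u, clsw v] ! 1) ([clsw u', clsw v'] ! 1)])
        (smul (twist r w w') (wmon [clsw (u @ u'), clsw (v @ v')]))"
      using pair[of "clsw (u @ u')" "clsw (v @ v')" "twist r u u'" "twist r v v'"] by (simp add: words)
  qed
  also have "?T = tens2 A p (Delta (star ?a ?b))"
    by (simp add: tens2_Delta star_def lext_lext lext_smul wsum_lext_swap wsum_append flip: wsum_smul)
  also have "tensor_eq U \<dots> (comult U (cls (star ?a ?b)))"
    by (rule tensor_eq_sym[OF comult_class])
  finally show ?thesis by (simp add: xy tensor_eq_sym)
qed

theorem hopf_algebra_D: "hopf_algebra D"
proof -
  interpret H: hopf_algebra U by (rule hopf_algebra_Uq)
  have eps_D: "lext (\<lambda>w. smul (word_counit w) 1) (coset_rep x) = smul (counit U x) 1" for x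
    by (simp add: lext_fun_lin_form counit_Uq eps_def)
  \<comment> \<open>The antipode law for words modulo the relations for \<open>q\<close> is
    rescaled. The scalars of \<open>u\<close> and \<open>v\<close> combine to that of
    \<open>w\<close> by \<open>wscalar_comult\<close>, and on torus words, the only ones with
    nonzero counit, it is 1.\<close>
  have antipode: "lext (\<lambda>w. wsum w g) (coset_rep x) \<approx> smul (counit U x) 1"
    if g: "\<And>u v :: 'i gen list. g u v = rescale r (smul (inverse (wscalar r u) * inverse (wscalar r v)) (h u v))"
      and h: "\<And>w. Q.eqv (wsum w h) (smul (word_counit w) 1)" for g h x
  proof -
    have "wsum w g \<approx> smul (word_counit w) 1" for w
    proof -
      have "wsum w g = wsum w (\<lambda>u v. rescale r (smul (inverse (wscalar r w)) (h u v)))"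
        by (rule wsum_cong) (simp add: g flip: wscalar_rules(4) inverse_mult_distrib)
      also have "\<dots> = rescale r (smul (inverse (wscalar r w)) (wsum w h))"
        by (simp add: wsum_smul) (rule wsum_map[symmetric], simp_all add: rescale_simps)
      also have "\<dots> \<approx> rescale r (smul (inverse (wscalar r w)) (smul (word_counit w) 1))"
        using rescale_in_ideal[OF h[unfolded Q.eqv_def]]
        unfolding rescale_smul by (intro eqv_smul) (simp add: eqv_def rescale_simps)
      also have "\<dots> = smul (word_counit w) 1"
        by (simp add: rescale_simps rescale_one smul_simps word_counit_eq wscalar_rules)
      finally show ?thesis .
    qed
    then have "lext (\<lambda>w. wsum w g) (coset_rep x) \<approx> lext (\<lambda>w. smul (word_counit w) 1) (coset_rep x)"
      by (intro eqv_lext)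
    then show ?thesis by (simp only: eps_D)
  qed
  show ?thesis
  proof (intro hopf_algebra.intro ring_D module_D hopf_algebra_axioms.intro,
      unfold lin_ext_lext scal_mult D_lin_sum D_tensor_eq D_comult D_counit)
    fix x y c xs
    assume x: "x \<in> carrier D"
    then have xU: "x \<in> carrier U" by (simp add: D_carrier)
    obtain a where a: "x = rcls a" using x by (rule rcls_cases)
    show "length xs = 2 \<and> set xs \<subseteq> carrier D" if "xs \<in> Poly_Mapping.keys (comult U x)"
      using H.comult_closed[OF xU that] by (simp add: D_carrier)
    show "tensor_eq U (comult U (c \<odot>\<^bsub>D\<^esub> x)) (smul c (comult U x))"
      using H.comult_smult[OF xU] by (simp add: D_smult scal_mult)
    show "tensor_eq U (lext (\<lambda>xs. comult U (xs ! 0) * wmon [xs ! 1]) (comult U x))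
        (lext (\<lambda>xs. wmon [xs ! 0] * comult U (xs ! 1)) (comult U x))"
      using H.coassoc[OF xU] by (simp add: lin_ext_lext)
    show "counit U (c \<odot>\<^bsub>D\<^esub> x) = c * counit U x"
      using H.counit_smult[OF xU] by (simp add: D_smult)
    show "lin_sum U (\<lambda>xs. counit U (xs ! 0) \<odot>\<^bsub>D\<^esub> xs ! 1) (comult U x) = x"
      "lin_sum U (\<lambda>xs. counit U (xs ! 1) \<odot>\<^bsub>D\<^esub> xs ! 0) (comult U x) = x"
      using H.counit_left[OF xU] H.counit_right[OF xU] by (simp_all add: D_smult)
    show "antipode D x \<in> carrier D" "antipode D (c \<odot>\<^bsub>D\<^esub> x) = c \<odot>\<^bsub>D\<^esub> antipode D x"
      by (simp_all add: a antipode_rcls rcls_ops antip_simps)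
    have unit: "counit U x \<odot>\<^bsub>D\<^esub> \<one>\<^bsub>D\<^esub> = cls (smul (counit U x) 1)"
      by (simp add: D_smult D_one Uq_ops)
    have "lin_sum U (\<lambda>xs. antipode D (xs ! 0) \<otimes>\<^bsub>D\<^esub> xs ! 1) (comult U x) =
        cls (lext (\<lambda>w. wsum w (\<lambda>u v. rescale r (smul (inverse (wscalar r u) * inverse (wscalar r v))
          (word_antipode u * wmon v)))) (coset_rep x))"
      by (rule lin_sum_comult) (simp add: clsw_rcls antipode_rcls rcls_ops antip_simps antip_wmon smul_simps mult.commute, simp add: rcls_def)
    also have "\<dots> = cls (smul (counit U x) 1)"
      unfolding cls_eq_iff by (rule antipode[OF refl Q.antip_left])
    finally show "lin_sum U (\<lambda>xs. antipode D (xs ! 0) \<otimes>\<^bsub>D\<^esub> xs ! 1) (comult U x) = counit U x \<odot>\<^bsub>D\<^esub> \<one>\<^bsub>D\<^esub>"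
      by (simp only: unit)
    have "lin_sum U (\<lambda>xs. xs ! 0 \<otimes>\<^bsub>D\<^esub> antipode D (xs ! 1)) (comult U x) =
        cls (lext (\<lambda>w. wsum w (\<lambda>u v. rescale r (smul (inverse (wscalar r u) * inverse (wscalar r v))
          (wmon u * word_antipode v)))) (coset_rep x))"
      by (rule lin_sum_comult) (simp add: clsw_rcls antipode_rcls rcls_ops antip_simps antip_wmon smul_simps mult.commute, simp add: rcls_def)
    also have "\<dots> = cls (smul (counit U x) 1)"
      unfolding cls_eq_iff by (rule antipode[OF refl Q.antip_right])
    finally show "lin_sum U (\<lambda>xs. xs ! 0 \<otimes>\<^bsub>D\<^esub> antipode D (xs ! 1)) (comult U x) = counit U x \<odot>\<^bsub>D\<^esub> \<one>\<^bsub>D\<^esub>"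
      by (simp only: unit)
    assume y: "y \<in> carrier D"
    then have yU: "y \<in> carrier U" by (simp add: D_carrier)
    obtain b where b: "y = rcls b" using y by (rule rcls_cases)
    show "(c \<odot>\<^bsub>D\<^esub> x) \<otimes>\<^bsub>D\<^esub> y = c \<odot>\<^bsub>D\<^esub> (x \<otimes>\<^bsub>D\<^esub> y)" "x \<otimes>\<^bsub>D\<^esub> (c \<odot>\<^bsub>D\<^esub> y) = c \<odot>\<^bsub>D\<^esub> (x \<otimes>\<^bsub>D\<^esub> y)"
      by (simp_all add: a b rcls_ops smul_simps)
    show "tensor_eq U (comult U (x \<oplus>\<^bsub>D\<^esub> y)) (comult U x + comult U y)"
      using H.comult_add[OF xU yU] by (simp add: D_add)
    show "counit U (x \<oplus>\<^bsub>D\<^esub> y) = counit U x + counit U y"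
      using H.counit_add[OF xU yU] by (simp add: D_add)
    show "antipode D (x \<oplus>\<^bsub>D\<^esub> y) = antipode D x \<oplus>\<^bsub>D\<^esub> antipode D y"
      by (simp add: a b antipode_rcls rcls_ops antip_simps)
    show "counit U (x \<otimes>\<^bsub>D\<^esub> y) = counit U x * counit U y"
      by (simp add: a b rcls_ops) (simp add: rcls_def counit_class rescale_eps[of r, OF r_nonzero] eps_mult)
    show "tensor_eq U (comult U (x \<otimes>\<^bsub>D\<^esub> y))
        (lext (\<lambda>xs. lext (\<lambda>ys. wmon [xs ! 0 \<otimes>\<^bsub>D\<^esub> ys ! 0, xs ! 1 \<otimes>\<^bsub>D\<^esub> ys ! 1]) (comult U y)) (comult U x))"
      unfolding D_mult by (rule comult_mult_D[OF xU yU])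
  next
    show "tensor_eq U (comult U \<one>\<^bsub>D\<^esub>) (wmon [\<one>\<^bsub>D\<^esub>, \<one>\<^bsub>D\<^esub>])"
      using H.comult_one by (simp add: D_one)
    show "counit U \<one>\<^bsub>D\<^esub> = 1"
      using H.counit_one by (simp add: D_one)
  qed
qed

theorem hopf_isomorphic_D: "hopf_isomorphic Q.U D"
proof -
  define h where "h C = rcls (coset_rep C)" for C
  have h_cls: "h (Q.cls a) = rcls a" for a
    unfolding h_def rcls_eq_iff by (rule class_coset_rep) simp
  have hom: "h \<in> ring_hom Q.U D"
    by (rule ring_hom_memI) (auto simp: h_cls rcls_ops Uq_ops elim!: Uq_cases)
  have "bij_betw h (carrier Q.U) (carrier D)"
    unfolding bij_betw_def
  proof
    show "inj_on h (carrier Q.U)"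
      by (intro inj_onI) (auto simp: h_cls rcls_eq_iff elim!: Uq_cases)
    show "h ` carrier Q.U = carrier D"
    proof (intro equalityI subsetI)
      fix x assume "x \<in> carrier D"
      then obtain a where "x = h (Q.cls a)" using h_cls by (auto elim!: rcls_cases)
      then show "x \<in> h ` carrier Q.U" by simp
    qed (auto simp: h_cls elim!: Uq_cases)
  qed
  then have iso: "h \<in> ring_iso Q.U D"
    using hom by (simp add: ring_iso_def)
  have comult: "tensor_eq D (comult D (h x)) (lin_ext (\<lambda>xs. wmon (map h xs)) (comult Q.U x))"
    if x: "x \<in> carrier Q.U" for x
  proof -
    let ?a = "coset_rep x"
    have pair: "tensor_eq U (wmon [rcls (wmon u), rcls (wmon v)]) (smul (wscalar r w) (wmon [clsw u, clsw v]))"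
      if "(u, v) \<in> set (word_comult w)" for u v w
    proof -
      have "tensor_eq U (wmon [wscalar r u \<odot>\<^bsub>U\<^esub> clsw u, wscalar r v \<odot>\<^bsub>U\<^esub> clsw v])
          (smul (wscalar r u) (smul (wscalar r v) (wmon [clsw u, clsw v])))"
        by (rule tensor_eq_trans[OF tensor_eq_pair_smult(1) tensor_eq_smul[OF tensor_eq_pair_smult(2)]])
          (simp_all add: Uq_simprules)
      then show ?thesis
        by (simp add: rcls_def rescale_simps Uq_smult smul_smul wscalar_rules(4)[OF that])
    qed
    have "lin_ext (\<lambda>xs. wmon (map h xs)) (comult Q.U x) =
        lext (\<lambda>w. wsum w (\<lambda>u v. wmon [rcls (wmon u), rcls (wmon v)])) ?a"
      by (simp add: lin_ext_lext lext_comult_Uq h_cls)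
    also have "tensor_eq U \<dots> (lext (\<lambda>w. wsum w (\<lambda>u v. smul (wscalar r w) (wmon [clsw u, clsw v]))) ?a)"
      by (intro tensor_eq_lext tensor_eq_wsum pair)
    also have "\<dots> = tens2 A p (Delta (rescale r ?a))"
      by (simp add: tens2_Delta lext_rescale wsum_smul)
    also have "tensor_eq U \<dots> (comult U (h x))"
      unfolding h_def rcls_def by (rule tensor_eq_sym[OF comult_class])
    finally show ?thesis by (simp add: D_tensor_eq D_comult tensor_eq_sym)
  qed
  have "h \<in> hopf_iso Q.U D"
    unfolding hopf_iso_def
  proof (intro CollectI conjI allI ballI)
    fix c x assume x: "x \<in> carrier Q.U"
    then obtain a where a: "x = Q.cls a" by (rule Uq_cases)
    show "h (c \<odot>\<^bsub>Q.U\<^esub> x) = c \<odot>\<^bsub>D\<^esub> h x"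
      by (simp add: a Uq_ops h_cls rcls_ops)
    show "counit D (h x) = counit Q.U x"
      by (simp add: a h_cls Q.counit_class D_counit)
        (simp add: rcls_def counit_class rescale_eps[of r, OF r_nonzero])
    show "h (antipode Q.U x) = antipode D (h x)"
      by (simp add: a h_cls Q.antipode_class antipode_rcls)
  qed (use iso comult in auto)
  then show ?thesis
    unfolding hopf_isomorphic_def using Q.hopf_algebra_Uq hopf_algebra_D by blast
qed

end

theorem theorem28:
  fixes A :: "'i::finite \<Rightarrow> 'i \<Rightarrow> int"
    and d :: "'i \<Rightarrow> int"
    and q :: "'i \<Rightarrow> 'i \<Rightarrow> 'k::field_char_0"
    and q0 :: 'k
    and r :: "'i \<Rightarrow> 'i \<Rightarrow> 'k"
    and \<tau> :: "'k \<Rightarrow> 'k"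
  assumes cartan: "gen_cartan_matrix A"
    and symm: "symmetrizer A d"
    and q_nonzero: "\<And>i j. q i j \<noteq> 0"
    and q_rel: "\<And>i j. q i j * q j i = q i i powi A i j"
    and q_not_root_of_unity: "\<And>i n. n > 0 \<Longrightarrow> q i i ^ n \<noteq> 1"
    and q_roots: "\<And>i m. m > 0 \<Longrightarrow> \<exists>x. x ^ m = q i i"
    and \<tau>_hom: "\<And>x y. \<tau> (x + y) = \<tau> x + \<tau> y" "\<And>x y. \<tau> (x * y) = \<tau> x * \<tau> y" "\<tau> 1 = 1"
    and \<tau>_invol: "\<And>x. \<tau> (\<tau> x) = x"
    and \<tau>_q: "\<And>i j. \<tau> (q i j) = q j i"
    and q_diag: "\<And>i. q i i = q0 powi (2 * d i)"
    and r_sqrt: "\<And>i j. r i j ^ 2 = q i j"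
    and r_compat: "\<And>i j. r i j * r j i = q0 powi (d i * A i j)"
  shows "(\<exists>\<sigma>. torus_form A d q0 r \<sigma>) \<and>
    (\<forall>\<sigma>. torus_form A d q0 r \<sigma> \<longrightarrow>
       hopf_2_cocycle (Uqq A d q0) \<sigma> \<and>
       (\<exists>\<sigma>'. conv_inverse (Uqq A d q0) \<sigma> \<sigma>') \<and>
       hopf_isomorphic (Uq A q) (deformation (Uqq A d q0) \<sigma>))"
proof -
  define p where "p i j = q0 powi (d i * A i j)" for i j
  have A: "A i i = 2" "i \<noteq> j \<Longrightarrow> A i j \<le> 0" for i j
    using cartan by (simp_all add: gen_cartan_matrix_def)
  have d: "d i > 0" "d i * A i j = d j * A j i" for i j
    using symm by (simp_all add: symmetrizer_def)
  have r: "r i j \<noteq> 0" for i j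
    using r_sqrt[of i j] q_nonzero[of i j] by auto
  have q0: "q0 \<noteq> 0"
  proof
    \<comment> \<open>Types are inhabited, so any index may be taken; as \<open>d i\<close> is
      positive, \<open>q i i\<close> would be zero.\<close>
    fix i :: 'i
    assume "q0 = 0"
    then show False
      using q_diag[of i] q_nonzero[of i i] d(1)[of i] by (simp add: power_int_0_left_if)
  qed
  have diag: "p i i = q i i" for i
    by (simp add: p_def A q_diag mult.commute)
  have "p i j * p j i = p i i powi A i j" for i j
  proof -
    have "p i j * p j i = q0 powi (d i * A i j + d i * A i j)"
      unfolding p_def d(2)[of j i] by (rule power_int_add[symmetric]) (simp add: q0)
    \<comment> \<open>The factor 2 is read as the diagonal entry \<open>A i i\<close>, so that the
      power of \<open>p i i\<close> appears.\<close>
    also have "d i * A i j + d i * A i j = d i * A i i * A i j"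
      by (simp add: A)
    finally show ?thesis by (simp add: p_def power_int_mult)
  qed
  then interpret P: uq_form A p r
    by unfold_locales (use A r q0 q_not_root_of_unity in \<open>auto simp: diag, auto simp: p_def\<close>)
  have Uqq: "Uqq A d q0 = Uq A p"
    by (simp add: Uqq_def flip: p_def)
  have form: "torus_form A d q0 r \<sigma> \<longleftrightarrow> P.is_form \<sigma>" for \<sigma>
    unfolding torus_form_def P.is_form_def Uqq uqq_word_def word_form_def torus_word_def p_def ..
  have "hopf_isomorphic (Uq A q) (deformation (Uq A p) \<sigma>)" if "P.is_form \<sigma>" for \<sigma>
  proof -
    \<comment> \<open>Here the sign of the square roots enters: with
      \<open>q i j = r i j ^ 2\<close> the right-hand side is \<open>r i j * r j i\<close>, which
      \<open>r_compat\<close> fixes.\<close>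
    have "p i j = q i j * r j i / r i j" for i j
      unfolding p_def r_compat[symmetric] r_sqrt[symmetric] by (simp add: r power2_eq_square)
    then interpret uq_twisted A p q r \<sigma>
      by unfold_locales (use A q_nonzero q_rel q_not_root_of_unity that in auto)
    show ?thesis by (rule hopf_isomorphic_D)
  qed
  then show ?thesis
    unfolding Uqq form using P.is_form_exists P.cocycle P.conv_inverse_exists by blast
qed

end
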